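(* Let $d\mu=w(\theta)\frac{d\theta}{2\pi}+d\mu_{\mathrm{s}}$ be a nontrivial probability measure on $\partial\mathbb{D}$ with $d\mu_{\mathrm{s}}$ singular. Let $\{n_\ell\}_{\ell=1}^\infty$ be a monotone sequence of positive integers with $\liminf_{\ell\to\infty}\frac{n_{\ell+1}}{n_\ell}>1$ and suppose that the Verblunsky coefficients satisfy $$\alpha_j(d\mu)=0\quad\text{if } j\notin\{n_\ell\}$$ and $$\sum_{j=0}^\infty|\alpha_j(d\mu)|^2<\infty.$$ Then $\mu_{\mathrm{s}}=0$, $\operatorname{supp}(d\mu)=\partial\mathbb{D}$, and $w,w^{-1}\in\bigcap_{1\le p<\infty}L^p(\partial\mathbb{D},\frac{d\theta}{2\pi})$.
   Context: $\mathbb{D}=\{|z|<1\}$. A probability measure on $\partial\mathbb{D}$ is nontrivial if it is not a finite combination of delta functions. For such $\mu$, $\Phi_n$ is the monic orthogonal polynomial of degree $n$ in $L^2(\partial\mathbb{D},d\mu)$ and the Verblunsky coefficients are $\alpha_n(d\mu)=-\overline{\Phi_{n+1}(0)}\in\mathbb{D}$, $n\ge0$. *)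

theory Defs
  imports "HOL-Probability.Probability" "HOL-Computational_Algebra.Polynomial"
begin

abbreviation unit_circle :: "complex set" where
  "unit_circle \<equiv> sphere 0 1"

abbreviation circle_borel :: "complex measure" where
  "circle_borel \<equiv> restrict_space borel unit_circle"

text \<open>The normalized arc-length measure \<open>d\<theta>/2\<pi>\<close>, where \<open>\<theta>\<close> is identified with
  \<open>z = exp (i\<theta>)\<close>.\<close>

definition arc_measure :: "complex measure" where
  "arc_measure = distr (uniform_measure lborel {0..<2*pi}) circle_borel cis"

definition nontrivial_measure :: "complex measure \<Rightarrow> bool" where
  "nontrivial_measure M \<longleftrightarrow>
     \<not> (\<exists>S c. finite S \<and> S \<subseteq> space M \<and>
            (\<forall>A\<in>sets M. emeasure M A = (\<Sum>z\<in>S. (c z :: ennreal) * indicator A z)))"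

definition mutually_singular :: "'a measure \<Rightarrow> 'a measure \<Rightarrow> bool" where
  "mutually_singular M N \<longleftrightarrow>
     (\<exists>A\<in>sets M \<inter> sets N. emeasure M A = 0 \<and> emeasure N (space N - A) = 0)"

definition measure_supp :: "'a::topological_space measure \<Rightarrow> 'a set" where
  "measure_supp M =
     {z \<in> space M. \<forall>U. open U \<longrightarrow> z \<in> U \<longrightarrow> 0 < emeasure M (U \<inter> space M)}"

definition in_Lp :: "'a measure \<Rightarrow> real \<Rightarrow> ('a \<Rightarrow> real) \<Rightarrow> bool" where
  "in_Lp M p f \<longleftrightarrow> f \<in> borel_measurable M \<and> integrable M (\<lambda>x. \<bar>f x\<bar> powr p)"

text \<open>In HOL \<open>inverse 0 = 0\<close>, so membership of the reciprocal of \<open>f\<close> in \<open>L\<^sup>p\<close> has to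
  include explicitly that \<open>f\<close> is nonzero almost everywhere.\<close>

definition inverse_in_Lp :: "'a measure \<Rightarrow> real \<Rightarrow> ('a \<Rightarrow> real) \<Rightarrow> bool" where
  "inverse_in_Lp M p f \<longleftrightarrow> (AE x in M. f x \<noteq> 0) \<and> in_Lp M p (\<lambda>x. inverse (f x))"

definition is_monic_OP :: "complex measure \<Rightarrow> nat \<Rightarrow> complex poly \<Rightarrow> bool" where
  "is_monic_OP M n P \<longleftrightarrow> degree P = n \<and> lead_coeff P = 1 \<and>
     (\<forall>Q. degree Q < n \<longrightarrow> (LINT z|M. cnj (poly Q z) * poly P z) = 0)"

definition monic_OP :: "complex measure \<Rightarrow> nat \<Rightarrow> complex poly" where
  "monic_OP M n = (THE P. is_monic_OP M n P)"

definition verblunsky :: "complex measure \<Rightarrow> nat \<Rightarrow> complex" where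
  "verblunsky M n = - cnj (poly (monic_OP M (Suc n)) 0)"

lemma poly_integrable:
  assumes "prob_space M" "sets M = sets circle_borel"
  shows "integrable M (\<lambda>z. cnj (poly Q z) * poly P z)"
proof -
  interpret prob_space M by fact
  have sp: "space M = unit_circle"
    using sets_eq_imp_space_eq[OF assms(2)] by (simp add: space_restrict_space)
  have cont: "continuous_on unit_circle (\<lambda>z. cnj (poly Q z) * poly P z)"
    by (intro continuous_intros)
  have "compact ((\<lambda>z. cnj (poly Q z) * poly P z) ` unit_circle)"
    by (intro compact_continuous_image cont compact_sphere)
  then have "bounded ((\<lambda>z. cnj (poly Q z) * poly P z) ` unit_circle)"
    by (rule compact_imp_bounded)
  then obtain B where "\<forall>x\<in>(\<lambda>z. cnj (poly Q z) * poly P z) ` unit_circle. norm x \<le> B"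
    unfolding bounded_iff by blast
  then have B: "\<And>z. z \<in> unit_circle \<Longrightarrow> norm (cnj (poly Q z) * poly P z) \<le> B"
    by blast
  have meas: "(\<lambda>z. cnj (poly Q z) * poly P z) \<in> borel_measurable M"
    unfolding measurable_cong_sets[OF assms(2) refl]
    by (intro borel_measurable_continuous_on_restrict cont)
  show ?thesis
    by (rule integrable_const_bound[where B = B, OF _ meas]) (use sp B in auto)
qed

lemma poly_norm_zero:
  assumes M: "prob_space M" "sets M = sets circle_borel" "nontrivial_measure M"
    and "(LINT z|M. cnj (poly R z) * poly R z) = 0"
  shows "R = 0"
proof (rule ccontr)
  assume R: "R \<noteq> 0"
  interpret prob_space M by fact
  have sp: "space M = unit_circle"
    using sets_eq_imp_space_eq[OF M(2)] by (simp add: space_restrict_space)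
  have eq: "cnj (poly R z) * poly R z = complex_of_real ((cmod (poly R z))\<^sup>2)" for z
    by (metis complex_norm_square mult.commute)
  have int: "integrable M (\<lambda>z. (cmod (poly R z))\<^sup>2)"
    using poly_integrable[OF M(1,2), of R R] unfolding eq by (simp only: complex_of_real_integrable_eq)
  have "(LINT z|M. (cmod (poly R z))\<^sup>2) = 0"
    using assms(4) unfolding eq by (simp only: integral_complex_of_real of_real_eq_0_iff)
  then have "AE z in M. (cmod (poly R z))\<^sup>2 = 0"
    by (subst (asm) integral_nonneg_eq_0_iff_AE[OF int]) auto
  then have AE: "AE z in M. poly R z = 0" by simp
  define S where "S = {z \<in> unit_circle. poly R z = 0}"
  have fin: "finite S" unfolding S_def using poly_roots_finite[OF R] by (auto intro: finite_subset)
  have sing: "{z} \<in> sets M" if "z \<in> S" for z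
    using that unfolding M(2) S_def by (auto simp: sets_restrict_space_iff)
  have "emeasure M A = (\<Sum>z\<in>S. emeasure M {z} * indicator A z)" if A: "A \<in> sets M" for A
  proof -
    have SA: "(\<Union>z\<in>S \<inter> A. {z}) \<in> sets M"
      using fin sing by (intro sets.finite_UN) auto
    have "emeasure M A = emeasure M (\<Union>z\<in>S \<inter> A. {z})"
      by (rule emeasure_eq_AE[OF _ A SA]) (use AE AE_space in \<open>eventually_elim, auto simp: S_def sp\<close>)
    also have "\<dots> = (\<Sum>z\<in>S \<inter> A. emeasure M {z})"
      using fin sing by (intro sum_emeasure[symmetric]) (auto simp: disjoint_family_on_def)
    also have "\<dots> = (\<Sum>z\<in>S. emeasure M {z} * indicator A z)"
      using fin by (intro sum.mono_neutral_cong_left) auto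
    finally show ?thesis .
  qed
  moreover have "S \<subseteq> space M" by (auto simp: S_def sp)
  ultimately show False using M(3) fin unfolding nontrivial_measure_def
    by (blast intro: exI[of _ "\<lambda>z. emeasure M {z}"])
qed

lemma integral_lin:
  assumes M: "prob_space M" "sets M = sets circle_borel"
  shows "(LINT z|M. cnj (poly Q z) * poly (P - smult c P') z)
     = (LINT z|M. cnj (poly Q z) * poly P z) - c * (LINT z|M. cnj (poly Q z) * poly P' z)"
proof -
  have "(LINT z|M. cnj (poly Q z) * poly (P - smult c P') z)
     = (LINT z|M. cnj (poly Q z) * poly P z - c * (cnj (poly Q z) * poly P' z))"
    by (simp add: algebra_simps)
  also have "\<dots> = (LINT z|M. cnj (poly Q z) * poly P z) - (LINT z|M. c * (cnj (poly Q z) * poly P' z))"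
    using poly_integrable[OF M] by (intro Bochner_Integration.integral_diff integrable_mult_right)
  finally show ?thesis by simp
qed

lemma integral_lin_left:
  assumes M: "prob_space M" "sets M = sets circle_borel"
  shows "(LINT z|M. cnj (poly (Q + smult c Q') z) * poly P z)
     = (LINT z|M. cnj (poly Q z) * poly P z) + cnj c * (LINT z|M. cnj (poly Q' z) * poly P z)"
proof -
  have "(LINT z|M. cnj (poly (Q + smult c Q') z) * poly P z)
     = (LINT z|M. cnj (poly Q z) * poly P z + cnj c * (cnj (poly Q' z) * poly P z))"
    by (simp add: algebra_simps)
  also have "\<dots> = (LINT z|M. cnj (poly Q z) * poly P z) + (LINT z|M. cnj c * (cnj (poly Q' z) * poly P z))"
    using poly_integrable[OF M] by (intro Bochner_Integration.integral_add integrable_mult_right)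
  finally show ?thesis by simp
qed

lemma degree_drop:
  assumes "degree R \<le> Suc n" "coeff R (Suc n) = 0"
  shows "degree R < Suc n"
proof (rule ccontr)
  assume "\<not> degree R < Suc n"
  then have "degree R = Suc n" using assms by simp
  then have "R = 0" using assms(2) leading_coeff_0_iff[of R] by simp
  then show False using \<open>degree R = Suc n\<close> by simp
qed

lemma monic_diff_degree:
  assumes "degree P = Suc n" "lead_coeff P = (1::complex)" "degree Q = Suc n" "lead_coeff Q = 1"
  shows "degree (P - Q) < Suc n"
proof (rule degree_drop)
  show "degree (P - Q) \<le> Suc n" by (rule degree_diff_le) (simp_all add: assms)
  have "coeff P (Suc n) = 1" "coeff Q (Suc n) = 1" using assms by metis+
  then show "coeff (P - Q) (Suc n) = 0" by simp
qed

text \<open>The definite description in the definition of \<open>monic_OP\<close> is well-defined.\<close>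

lemma ex1_monic_OP:
  assumes M: "prob_space M" "sets M = sets circle_borel" "nontrivial_measure M"
  shows "\<exists>!P. is_monic_OP M n P"
proof -
  have uniq: "P = Q" if P: "is_monic_OP M n P" and Q: "is_monic_OP M n Q" for P Q
  proof (cases n)
    case 0
    obtain a b where "P = [:a:]" "Q = [:b:]"
      using P Q 0 unfolding is_monic_OP_def by (meson degree_eq_zeroE)
    then show ?thesis using P Q unfolding is_monic_OP_def by simp
  next
    case (Suc m)
    define R where "R = P - smult 1 Q"
    have "degree R < n" unfolding R_def using P Q Suc monic_diff_degree[of P m Q]
      by (auto simp: is_monic_OP_def)
    then have "(LINT z|M. cnj (poly R z) * poly P z) = 0" "(LINT z|M. cnj (poly R z) * poly Q z) = 0"
      using P Q unfolding is_monic_OP_def by blast+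
    then have "(LINT z|M. cnj (poly R z) * poly R z) = 0"
      using integral_lin[OF M(1,2), of R P 1 Q] by (simp add: R_def[symmetric] del: smult_1_left)
    then have "R = 0" by (rule poly_norm_zero[OF M])
    then show ?thesis by (simp add: R_def)
  qed
  have ex: "\<exists>P. is_monic_OP M n P"
  proof (induction n rule: less_induct)
    case (less n)
    define \<Phi> where "\<Phi> m = (SOME P. is_monic_OP M m P)" for m
    have \<Phi>: "is_monic_OP M m (\<Phi> m)" if "m < n" for m
      unfolding \<Phi>_def using less[OF that] by (rule someI_ex)
    have "\<exists>P. degree P = n \<and> lead_coeff P = 1 \<and>
        (\<forall>Q. degree Q < k \<longrightarrow> (LINT z|M. cnj (poly Q z) * poly P z) = 0)" if "k \<le> n" for k
      using that
    proof (induction k)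
      case 0
      show ?case by (intro exI[of _ "monom 1 n"]) (simp add: degree_monom_eq)
    next
      case (Suc k)
      then obtain P where P: "degree P = n" "lead_coeff P = 1"
        and orth: "\<And>Q. degree Q < k \<Longrightarrow> (LINT z|M. cnj (poly Q z) * poly P z) = 0" by auto
      have F: "is_monic_OP M k (\<Phi> k)" using \<Phi> Suc by simp
      let ?d = "LINT z|M. cnj (poly (\<Phi> k) z) * poly (\<Phi> k) z"
      have "\<Phi> k \<noteq> 0" using F by (auto simp: is_monic_OP_def)
      then have d: "?d \<noteq> 0" using poly_norm_zero[OF M] by blast
      define c where "c = (LINT z|M. cnj (poly (\<Phi> k) z) * poly P z) / ?d"
      define P' where "P' = P - smult c (\<Phi> k)"
      have dk: "degree (smult c (\<Phi> k)) < degree P"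
        using F P Suc by (simp add: is_monic_OP_def degree_smult_eq)
      have 1: "degree P' = n"
        using degree_add_eq_left[of "- smult c (\<Phi> k)" P] dk P
        by (simp only: P'_def degree_minus diff_conv_add_uminus)
      have 2: "lead_coeff P' = 1"
        using P coeff_eq_0[OF dk] by (simp only: 1) (simp only: P'_def coeff_diff, simp)
      have low: "(LINT z|M. cnj (poly Q z) * poly P' z) = 0" if "degree Q < k" for Q
        unfolding P'_def using orth[OF that] F that
        by (subst integral_lin[OF M(1,2)]) (simp add: is_monic_OP_def)
      have top: "(LINT z|M. cnj (poly (\<Phi> k) z) * poly P' z) = 0"
        unfolding P'_def using d by (subst integral_lin[OF M(1,2)]) (simp add: c_def)
      have "(LINT z|M. cnj (poly Q z) * poly P' z) = 0" if Q: "degree Q < Suc k" for Q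
      proof (cases k)
        case 0
        obtain a b where "Q = [:a:]" "\<Phi> k = [:b:]"
          using F Q 0 unfolding is_monic_OP_def by (metis degree_eq_zeroE less_Suc0)
        then have "Q = 0 + smult (coeff Q 0) (\<Phi> k)"
          using F by (simp add: is_monic_OP_def)
        then show ?thesis using integral_lin_left[OF M(1,2), of 0 "coeff Q 0" "\<Phi> k" P'] top by simp
      next
        case (Suc m)
        define Q0 where "Q0 = Q - smult (coeff Q k) (\<Phi> k)"
        have "degree Q0 \<le> k" unfolding Q0_def using Q F
          by (intro degree_diff_le) (auto simp: is_monic_OP_def degree_smult_eq)
        moreover have "coeff Q0 k = 0" using F by (auto simp: Q0_def is_monic_OP_def)
        ultimately have "degree Q0 < k" using Suc degree_drop[of Q0 m] by simp
        moreover have "Q = Q0 + smult (coeff Q k) (\<Phi> k)" by (simp add: Q0_def)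
        ultimately show ?thesis
          using integral_lin_left[OF M(1,2), of Q0 "coeff Q k" "\<Phi> k" P'] top low[of Q0] by simp
      qed
      then show ?case using 1 2 by blast
    qed
    then show ?case unfolding is_monic_OP_def by blast
  qed
  show ?thesis using ex uniq by blast
qed

lemma prob_space_arc_measure: "prob_space arc_measure"
proof -
  interpret U: prob_space "uniform_measure lborel {0..<2*pi::real}"
    by (rule prob_space_uniform_measure) (auto simp: emeasure_lborel_Ico)
  show ?thesis unfolding arc_measure_def
    by (rule U.prob_space_distr, rule measurable_restrict_space2)
      (simp_all add: borel_measurable_continuous_onI continuous_on_cis cong: measurable_cong_sets)
qed

end

theory Submission
  imports Defs "HOL-Complex_Analysis.Complex_Analysis"
begin

text \<open>
  Write \<open>\<Phi>\<^sub>n\<close> for the monic orthogonal polynomials and \<open>\<Phi>s\<^sub>n\<close> for the reversed ones. On the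
  unit circle \<open>\<Phi>s\<^sub>n\<^sub>+\<^sub>1 = \<Phi>s\<^sub>n (1 - \<alpha>\<^sub>n z b\<^sub>n)\<close> with the Blaschke product \<open>b\<^sub>n = \<Phi>\<^sub>n / \<Phi>s\<^sub>n\<close>. If
  \<open>\<alpha>\<close> vanishes on a gap of length \<open>g\<close> before \<open>n\<close>, then \<open>z b\<^sub>n\<close> is \<open>z\<^sup>g\<close> times a function bounded by one
  and analytic in the disc, so its primitive on the circle is at most \<open>1 / g\<close>. Integrating by parts,
  the integral of \<open>\<bar>\<Phi>s\<^sub>n\<bar>\<^bsup>2s\<^esup>\<close> grows at step \<open>n\<close> at most by a factor
  \<open>1 + C (\<bar>\<alpha>\<^sub>n\<bar> D\<^sub>n / g + \<bar>\<alpha>\<^sub>n\<bar>\<^sup>2)\<close>, where \<open>D\<^sub>n\<close> bounds the logarithmic derivative of \<open>\<Phi>s\<^sub>n\<close>.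
  Along a lacunary sequence with square-summable \<open>\<alpha>\<close> the quotients \<open>D\<^sub>n / n\<close> are square-summable, so
  these integrals stay bounded for every real \<open>s\<close>.

  The densities \<open>\<kappa>\<^sub>n / \<bar>\<Phi>s\<^sub>n\<bar>\<^sup>2\<close> of the Bernstein-Szego measures thus have bounded moments of all
  positive and negative orders, and these measures converge weakly to \<open>\<mu>\<close>. The tangent inequality
  \<open>(k + 1) y\<^sup>k x \<le> x\<^bsup>k+1\<^esup> + k y\<^bsup>k+1\<^esup>\<close> turns the bounds into inequalities between integrals of
  nonnegative test functions \<open>g\<close>, which survive the weak limit and extend to bounded Borel functions.
  Large multiples of indicators, truncations of \<open>w\<close> and the functions \<open>1 / (w + \<epsilon>)\<close> as test functions
  give the result.
\<close>

section \<open>The Szego recursion\<close>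

text \<open>Each recursion step needs both the monic polynomial and its reversal, hence the pair.
  The sequence \<open>a\<close> is arbitrary here; the link with a measure is made in
  \<open>monic_OP_eq_\<Phi>\<close>.\<close>

primrec szego :: "(nat \<Rightarrow> complex) \<Rightarrow> nat \<Rightarrow> complex poly \<times> complex poly" where
  "szego a 0 = (1, 1)"
| "szego a (Suc n) =
    (pCons 0 (fst (szego a n)) - smult (cnj (a n)) (snd (szego a n)),
     snd (szego a n) - smult (a n) (pCons 0 (fst (szego a n))))"

locale szego_recursion =
  fixes a :: "nat \<Rightarrow> complex"
begin

definition \<Phi> :: "nat \<Rightarrow> complex poly" where "\<Phi> n = fst (szego a n)"
definition \<Phi>s :: "nat \<Rightarrow> complex poly" where "\<Phi>s n = snd (szego a n)"

lemma \<Phi>_0 [simp]: "\<Phi> 0 = 1" and \<Phi>s_0 [simp]: "\<Phi>s 0 = 1"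
  by (simp_all add: \<Phi>_def \<Phi>s_def)

lemma \<Phi>_Suc: "\<Phi> (Suc n) = pCons 0 (\<Phi> n) - smult (cnj (a n)) (\<Phi>s n)"
  and \<Phi>s_Suc: "\<Phi>s (Suc n) = \<Phi>s n - smult (a n) (pCons 0 (\<Phi> n))"
  by (simp_all add: \<Phi>_def \<Phi>s_def)

text \<open>For \<open>\<Phi>s\<close> only an upper bound on the degree holds: at step
  \<open>n + 1\<close> its coefficient of index \<open>n + 1\<close> is \<open>- a n\<close>, which
  may vanish.\<close>

lemma degree_\<Phi>_\<Phi>s: "degree (\<Phi> n) = n \<and> lead_coeff (\<Phi> n) = 1 \<and> degree (\<Phi>s n) \<le> n"
proof (induction n)
  case (Suc n)
  then have nz: "\<Phi> n \<noteq> 0" by auto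
  have d: "degree (pCons 0 (\<Phi> n)) = Suc n" using Suc nz by simp
  have s: "degree (- smult (cnj (a n)) (\<Phi>s n)) < Suc n"
    using Suc by (metis degree_minus degree_smult_le le_imp_less_Suc le_trans)
  have "degree (pCons 0 (\<Phi> n) + - smult (cnj (a n)) (\<Phi>s n)) = Suc n"
    using degree_add_eq_left[of "- smult (cnj (a n)) (\<Phi>s n)" "pCons 0 (\<Phi> n)"] s d by simp
  then have d1: "degree (\<Phi> (Suc n)) = Suc n" by (simp add: \<Phi>_Suc)
  moreover have "lead_coeff (\<Phi> (Suc n)) = 1"
  proof -
    have "coeff (\<Phi>s n) (Suc n) = 0" "coeff (\<Phi> n) n = 1"
      using Suc coeff_eq_0[of "\<Phi>s n" "Suc n"] by auto
    then show ?thesis unfolding d1 by (simp add: \<Phi>_Suc)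
  qed
  moreover have "degree (\<Phi>s (Suc n)) \<le> Suc n"
    unfolding \<Phi>s_Suc using Suc d
    by (intro degree_diff_le) (auto intro: order_trans[OF degree_smult_le])
  ultimately show ?case by blast
qed simp

lemma degree_\<Phi>: "degree (\<Phi> n) = n" and lead_coeff_\<Phi>: "lead_coeff (\<Phi> n) = 1"
  and degree_\<Phi>s: "degree (\<Phi>s n) \<le> n"
  using degree_\<Phi>_\<Phi>s by blast+

lemma \<Phi>s_at_0 [simp]: "poly (\<Phi>s n) 0 = 1"
  by (induction n) (simp_all add: \<Phi>s_Suc)

text \<open>On the circle \<open>cnj z\<close> is the inverse of \<open>z\<close>, so this is the
  usual description of \<open>\<Phi>s\<close> as \<open>\<Phi>\<close> with coefficients reversed
  and conjugated.\<close>

lemma \<Phi>s_circle: "cmod z = 1 \<Longrightarrow> poly (\<Phi>s n) z = z ^ n * cnj (poly (\<Phi> n) z)"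
proof (induction n)
  case (Suc n)
  have zz: "cnj z * z = 1" using Suc.prems by (simp add: complex_norm_square[symmetric] mult.commute)
  have "cnj (poly (\<Phi>s n) z) * z ^ n = (cnj z ^ n * z ^ n) * poly (\<Phi> n) z"
    using Suc by simp
  also have "cnj z ^ n * z ^ n = 1" by (simp add: zz flip: power_mult_distrib)
  finally have 2: "cnj (poly (\<Phi>s n) z) * z ^ n = poly (\<Phi> n) z" by simp
  have "z ^ Suc n * cnj (poly (\<Phi> (Suc n)) z)
     = (cnj z * z) * (z ^ n * cnj (poly (\<Phi> n) z)) - a n * z * (cnj (poly (\<Phi>s n) z) * z ^ n)"
    by (simp add: \<Phi>_Suc algebra_simps)
  also have "\<dots> = poly (\<Phi>s n) z - a n * z * poly (\<Phi> n) z"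
    unfolding 2 zz using Suc by simp
  also have "\<dots> = poly (\<Phi>s (Suc n)) z" by (simp add: \<Phi>s_Suc algebra_simps)
  finally show ?case ..
qed simp

lemma norm_\<Phi>_circle: "cmod z = 1 \<Longrightarrow> cmod (poly (\<Phi> n) z) = cmod (poly (\<Phi>s n) z)"
  by (simp add: \<Phi>s_circle norm_mult norm_power)

end

text \<open>The squares of the two sides differ by \<open>(1 - |c|^2) (|p|^2 - |P|^2)\<close>. With
  \<open>P = z \<Phi> n\<close> and \<open>p = \<Phi>s n\<close> this carries the domination of
  \<open>\<Phi>\<close> by \<open>\<Phi>s\<close> through one recursion step.\<close>

lemma norm_step_le:
  assumes "cmod P \<le> cmod p" "cmod c < 1"
  shows "cmod (P - cnj c * p) \<le> cmod (p - c * P)"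
proof -
  have e: "complex_of_real ((cmod (p - c * P))\<^sup>2 - (cmod (P - cnj c * p))\<^sup>2)
     = complex_of_real ((1 - (cmod c)\<^sup>2) * ((cmod p)\<^sup>2 - (cmod P)\<^sup>2))"
    unfolding of_real_diff of_real_mult complex_norm_square of_real_1
    by (simp add: algebra_simps)
  have "(cmod c)\<^sup>2 \<le> 1" "(cmod P)\<^sup>2 \<le> (cmod p)\<^sup>2"
    using assms by (simp_all add: power_le_one power_mono)
  then have "0 \<le> (1 - (cmod c)\<^sup>2) * ((cmod p)\<^sup>2 - (cmod P)\<^sup>2)" by simp
  then have "(cmod (P - cnj c * p))\<^sup>2 \<le> (cmod (p - c * P))\<^sup>2"
    using e unfolding of_real_eq_iff by linarith
  then show ?thesis by (rule power2_le_imp_le) simp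
qed

locale verblunsky_seq = szego_recursion +
  assumes a_less: "cmod (a n) < 1"
begin

lemma norm_\<Phi>s_Suc_ge:
  assumes "cmod z \<le> 1" "cmod (poly (\<Phi> n) z) \<le> cmod (poly (\<Phi>s n) z)"
  shows "cmod (poly (\<Phi>s (Suc n)) z) \<ge> (1 - cmod (a n)) * cmod (poly (\<Phi>s n) z)"
proof -
  have "cmod (z * poly (\<Phi> n) z) \<le> 1 * cmod (poly (\<Phi>s n) z)"
    unfolding norm_mult using assms by (intro mult_mono) auto
  then have "cmod (a n * (z * poly (\<Phi> n) z)) \<le> cmod (a n) * cmod (poly (\<Phi>s n) z)"
    unfolding norm_mult[of "a n"] by (intro mult_left_mono) auto
  moreover have e: "poly (\<Phi>s (Suc n)) z = poly (\<Phi>s n) z - a n * (z * poly (\<Phi> n) z)"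
    by (simp add: \<Phi>s_Suc algebra_simps)
  ultimately show ?thesis
    using norm_triangle_ineq2[of "poly (\<Phi>s n) z" "a n * (z * poly (\<Phi> n) z)"]
    unfolding e left_diff_distrib mult_1_left by linarith
qed

text \<open>Both claims go through one induction: domination and \<open>|a n| < 1\<close> give the
  lower bound of \<open>norm_\<Phi>s_Suc_ge\<close>, which keeps the next \<open>\<Phi>s\<close>
  away from zero on the closed disc.\<close>

lemma norm_\<Phi>_le_aux:
  "cmod z \<le> 1 \<Longrightarrow> cmod (poly (\<Phi> n) z) \<le> cmod (poly (\<Phi>s n) z) \<and> poly (\<Phi>s n) z \<noteq> 0"
proof (induction n)
  case (Suc n)
  have "cmod (z * poly (\<Phi> n) z) \<le> 1 * cmod (poly (\<Phi>s n) z)"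
    unfolding norm_mult using Suc by (intro mult_mono) auto
  then have "cmod (poly (\<Phi> (Suc n)) z) \<le> cmod (poly (\<Phi>s (Suc n)) z)"
    using norm_step_le[of "z * poly (\<Phi> n) z" "poly (\<Phi>s n) z" "a n"] a_less[of n]
    by (simp add: \<Phi>_Suc \<Phi>s_Suc algebra_simps)
  moreover have "0 < (1 - cmod (a n)) * cmod (poly (\<Phi>s n) z)"
    using Suc a_less[of n] by simp
  then have "poly (\<Phi>s (Suc n)) z \<noteq> 0"
    using norm_\<Phi>s_Suc_ge[of z n] Suc by auto
  ultimately show ?case by blast
qed simp

lemma norm_\<Phi>_le: "cmod z \<le> 1 \<Longrightarrow> cmod (poly (\<Phi> n) z) \<le> cmod (poly (\<Phi>s n) z)"
  and \<Phi>s_nonzero: "cmod z \<le> 1 \<Longrightarrow> poly (\<Phi>s n) z \<noteq> 0"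
  using norm_\<Phi>_le_aux by blast+

lemma \<Phi>s_lower: "cmod z \<le> 1 \<Longrightarrow> (1 - cmod (a n)) * cmod (poly (\<Phi>s n) z) \<le> cmod (poly (\<Phi>s (Suc n)) z)"
  using norm_\<Phi>s_Suc_ge norm_\<Phi>_le by blast

text \<open>\<open>E n\<close> bounds the derivative of the Blaschke product \<open>z * \<Phi> n / \<Phi>s n\<close> and
  \<open>D n\<close> the logarithmic derivative of \<open>\<Phi>s n\<close> on the unit circle.\<close>

primrec E :: "nat \<Rightarrow> real" where
  "E 0 = 1"
| "E (Suc n) = 1 + (1 + cmod (a n)) / (1 - cmod (a n)) * E n"

primrec D :: "nat \<Rightarrow> real" where
  "D 0 = 0"
| "D (Suc n) = D n + cmod (a n) / (1 - cmod (a n)) * E n"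

text \<open>By the quotient rule, the numerator of the derivative of
  \<open>z \<Phi> n / \<Phi>s n\<close>, whose denominator is the square of
  \<open>\<Phi>s n\<close>.\<close>

definition V :: "nat \<Rightarrow> complex \<Rightarrow> complex" where
  "V n z = poly (pderiv (pCons 0 (\<Phi> n))) z * poly (\<Phi>s n) z
     - z * poly (\<Phi> n) z * poly (pderiv (\<Phi>s n)) z"

lemma E_ge_1: "E n \<ge> 1"
proof (induction n)
  case (Suc n)
  have "0 \<le> (1 + cmod (a n)) / (1 - cmod (a n)) * E n"
    using Suc a_less[of n] by (intro mult_nonneg_nonneg divide_nonneg_nonneg) auto
  then show ?case by simp
qed simp

lemma D_nonneg: "D n \<ge> 0"
proof (induction n)
  case (Suc n)
  have "0 \<le> cmod (a n) / (1 - cmod (a n)) * E n"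
    using E_ge_1[of n] a_less[of n] by (intro mult_nonneg_nonneg divide_nonneg_nonneg) auto
  then show ?case using Suc by simp
qed simp

text \<open>The first summand comes from differentiating the outer factor \<open>z\<close>. The
  second is \<open>z\<close> times the Wronskian of the new pair, which equals \<open>V n\<close>
  times the determinant \<open>1 - |a n|^2\<close> of the recursion.\<close>

lemma V_Suc:
  "V (Suc n) z = (z * poly (\<Phi> n) z - cnj (a n) * poly (\<Phi>s n) z) * poly (\<Phi>s (Suc n)) z
     + z * (1 - a n * cnj (a n)) * V n z"
  by (simp add: V_def \<Phi>_Suc \<Phi>s_Suc pderiv_pCons pderiv_diff pderiv_smult algebra_simps)

lemma norm_V_le: "cmod z = 1 \<Longrightarrow> cmod (V n z) \<le> E n * (cmod (poly (\<Phi>s n) z))\<^sup>2"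
proof (induction n)
  case 0
  then show ?case by (simp add: V_def pderiv_pCons pderiv_1)
next
  case (Suc n)
  define p where "p = cmod (poly (\<Phi>s n) z)"
  define q where "q = cmod (poly (\<Phi>s (Suc n)) z)"
  define b where "b = cmod (a n)"
  have b: "0 \<le> b" "b < 1" using a_less by (auto simp: b_def)
  have pq: "(1 - b) * p \<le> q" unfolding p_def q_def b_def using \<Phi>s_lower[of z n] Suc by simp
  have e: "z * poly (\<Phi> n) z - cnj (a n) * poly (\<Phi>s n) z = poly (\<Phi> (Suc n)) z"
    by (simp add: \<Phi>_Suc)
  have "cmod (V (Suc n) z) \<le> q * q + (1 - b\<^sup>2) * cmod (V n z)"
  proof -
    have "cmod (V (Suc n) z) \<le> cmod (poly (\<Phi> (Suc n)) z * poly (\<Phi>s (Suc n)) z)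
      + cmod (z * (1 - a n * cnj (a n)) * V n z)"
      unfolding V_Suc e by (rule norm_triangle_ineq)
    moreover have "1 - a n * cnj (a n) = complex_of_real (1 - b\<^sup>2)"
      unfolding b_def of_real_diff complex_norm_square by simp
    moreover have "\<bar>1 - b\<^sup>2\<bar> = 1 - b\<^sup>2" using b by (simp add: power_le_one)
    ultimately show ?thesis using Suc.prems
      by (simp add: norm_mult norm_\<Phi>_circle q_def del: of_real_diff)
  qed
  also have "\<dots> \<le> q * q + (1 - b\<^sup>2) * (E n * p\<^sup>2)"
    using Suc b by (intro add_left_mono mult_left_mono) (auto simp: p_def power_le_one)
  \<comment> \<open>Splitting \<open>1 - b^2\<close> into \<open>(1 + b) / (1 - b)\<close> and
    \<open>(1 - b)^2\<close> lets the square join \<open>p\<close>, so that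
    \<open>(1 - b) p \<le> q\<close> applies; the quotient is the growth factor in
    \<open>E\<close>.\<close>
  also have "\<dots> = q * q + (1 + b) / (1 - b) * E n * ((1 - b) * p)\<^sup>2"
    using b by (simp add: field_simps power2_eq_square)
  also have "\<dots> \<le> q * q + (1 + b) / (1 - b) * E n * q\<^sup>2"
    using b pq E_ge_1[of n] by (intro add_left_mono mult_left_mono power_mono) (auto simp: p_def)
  also have "\<dots> = E (Suc n) * q\<^sup>2" by (simp add: b_def algebra_simps power2_eq_square)
  finally show ?case by (simp add: q_def)
qed

text \<open>One recursion step subtracts \<open>a n V n / (\<Phi>s n \<Phi>s (n + 1))\<close> from
  the logarithmic derivative of \<open>\<Phi>s\<close>. The bound on \<open>V\<close> and the lower
  bound on \<open>\<Phi>s (n + 1)\<close> give the increment of \<open>D\<close>.\<close>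

lemma norm_pderiv_\<Phi>s_le: "cmod z = 1 \<Longrightarrow> cmod (poly (pderiv (\<Phi>s n)) z) \<le> D n * cmod (poly (\<Phi>s n) z)"
proof (induction n)
  case (Suc n)
  define p where "p = poly (\<Phi>s n) z"
  define q where "q = poly (\<Phi>s (Suc n)) z"
  define p' where "p' = poly (pderiv (\<Phi>s n)) z"
  define q' where "q' = poly (pderiv (\<Phi>s (Suc n))) z"
  define b where "b = cmod (a n)"
  have b: "0 \<le> b" "b < 1" using a_less by (auto simp: b_def)
  have p: "cmod p > 0" using \<Phi>s_nonzero Suc by (simp add: p_def)
  have pq: "(1 - b) * cmod p \<le> cmod q" unfolding p_def q_def b_def using \<Phi>s_lower[of z n] Suc by simp
  have "q' * p = p' * q - a n * V n z"
    by (simp add: p_def q_def p'_def q'_def V_def \<Phi>s_Suc pderiv_pCons pderiv_diff pderiv_smult algebra_simps)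
  then have "cmod q' * cmod p \<le> cmod p' * cmod q + b * cmod (V n z)"
    unfolding b_def by (metis norm_mult norm_triangle_ineq4)
  also have "\<dots> \<le> (D n * cmod p) * cmod q + b * (E n * (cmod p)\<^sup>2)"
    using Suc norm_V_le[of z n] b
    by (intro add_mono mult_right_mono mult_left_mono) (auto simp: p'_def p_def)
  also have "b * (E n * (cmod p)\<^sup>2) = b / (1 - b) * E n * ((1 - b) * cmod p) * cmod p"
    using b by (simp add: field_simps power2_eq_square)
  also have "(D n * cmod p) * cmod q + \<dots> \<le> (D n * cmod p) * cmod q + b / (1 - b) * E n * cmod q * cmod p"
    using b pq E_ge_1[of n] by (intro add_left_mono mult_right_mono mult_left_mono) auto
  also have "\<dots> = (D (Suc n) * cmod q) * cmod p" by (simp add: b_def algebra_simps)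
  finally have "cmod q' \<le> D (Suc n) * cmod q" using p by simp
  then show ?case by (simp add: q_def q'_def)
qed (simp add: pderiv_1)

end

section \<open>Oscillatory integrals and numerical estimates\<close>

text \<open>Normalize the primitive to vanish at the origin and integrate along the radius to
  \<open>z\<close>: the integrand is there at most \<open>B s ^ (g - 1)\<close>, whose integral over
  the unit interval is \<open>B / g\<close>.\<close>

lemma primitive_bound:
  fixes b :: "complex \<Rightarrow> complex"
  assumes b: "b holomorphic_on ball 0 R" and R: "R > 1"
    and B: "\<And>z. cmod z \<le> 1 \<Longrightarrow> cmod (b z) \<le> B" and g: "g > 0"
  obtains G where "\<And>z. z \<in> ball 0 R \<Longrightarrow> (G has_field_derivative z ^ (g - 1) * b z) (at z)"
    and "\<And>z. cmod z = 1 \<Longrightarrow> cmod (G z) \<le> B / g"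
proof -
  have "(\<lambda>z. z ^ (g - 1) * b z) holomorphic_on ball 0 R"
    by (intro holomorphic_intros b)
  then obtain G0 where G0: "\<And>z. z \<in> ball 0 R \<Longrightarrow> (G0 has_field_derivative z ^ (g - 1) * b z) (at z within ball 0 R)"
    using holomorphic_convex_primitive'[of "ball 0 R"] by (auto simp: convex_ball)
  define G where "G z = G0 z - G0 0" for z
  have G: "(G has_field_derivative z ^ (g - 1) * b z) (at z)" if "z \<in> ball 0 R" for z
  proof -
    have "(G0 has_field_derivative z ^ (g - 1) * b z) (at z)"
      using G0[OF that] at_within_open[OF that open_ball] by simp
    then show ?thesis unfolding G_def by (auto intro!: derivative_eq_intros)
  qed
  have "cmod (G z) \<le> B / g" if z: "cmod z = 1" for z
  proof -
    have in_ball: "of_real s * z \<in> ball 0 R" if "0 \<le> s" "s \<le> 1" for s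
      using that R z by (simp add: norm_mult)
    have der: "((\<lambda>s. G (of_real s * z)) has_vector_derivative z * ((of_real s * z) ^ (g - 1) * b (of_real s * z))) (at s)"
      if s: "0 \<le> s" "s \<le> 1" for s
    proof -
      have "((\<lambda>s. of_real s * z) has_vector_derivative z) (at s)"
        by (auto intro!: derivative_eq_intros simp: has_vector_derivative_def scaleR_conv_of_real)
      from field_vector_diff_chain_at[OF this G[OF in_ball[OF s]]] show ?thesis by (simp add: o_def)
    qed
    have "cmod (G (of_real 1 * z) - G (of_real 0 * z)) \<le> B * 1 ^ g / g - B * 0 ^ g / g"
    proof (rule differentiable_bound_general[where f' = "\<lambda>s. z * ((of_real s * z) ^ (g - 1) * b (of_real s * z))"
          and \<phi>' = "\<lambda>s. B * s ^ (g - 1)" and \<phi> = "\<lambda>s. B * s ^ g / g" and f = "\<lambda>s. G (of_real s * z)"])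
      show "continuous_on {0..1} (\<lambda>s. G (of_real s * z))"
        by (intro continuous_at_imp_continuous_on ballI has_vector_derivative_continuous[OF der]) auto
      show "continuous_on {0..1} (\<lambda>s. B * s ^ g / g)" by (intro continuous_intros) (use g in auto)
      show "((\<lambda>s. B * s ^ g / g) has_vector_derivative B * s ^ (g - 1)) (at s)" for s
        unfolding has_real_derivative_iff_has_vector_derivative[symmetric]
        using g by (auto intro!: derivative_eq_intros)
      show "cmod (z * ((of_real s * z) ^ (g - 1) * b (of_real s * z))) \<le> B * s ^ (g - 1)" if "0 < s" "s < 1" for s
        using that z B[of "of_real s * z"]
        by (simp add: norm_mult norm_power mult.commute[of B] mult_left_mono)
    qed (use der in auto)
    then show ?thesis using g by (simp add: G_def power_0_left)
  qed
  with G show ?thesis using that by blast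
qed

lemma cis_vector_derivative:
  assumes "(G has_field_derivative D) (at (cis t))"
  shows "((\<lambda>t. G (cis t)) has_vector_derivative \<i> * cis t * D) (at t)"
proof -
  have "(cis has_vector_derivative \<i> * cis t) (at t)"
    by (auto intro!: derivative_eq_intros simp: has_vector_derivative_def has_derivative_cis scaleR_conv_of_real)
  from field_vector_diff_chain_at[OF this assms] show ?thesis by (simp add: o_def)
qed

text \<open>Integration by parts against the primitive \<open>G\<close> of \<open>z ^ (g - 1) * b z\<close>: since \<open>b\<close> is analytic,
  the primitive gains the factor \<open>1 / g\<close> in the supremum norm.\<close>

lemma oscillatory_integral_bound:
  fixes b :: "complex \<Rightarrow> complex" and F F' :: "real \<Rightarrow> real"
  assumes b: "b holomorphic_on ball 0 R" and R: "R > 1"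
    and B: "\<And>z. cmod z \<le> 1 \<Longrightarrow> cmod (b z) \<le> B" and g: "g > 0"
    and F: "\<And>t. (F has_real_derivative F' t) (at t)"
    and F': "continuous_on {0..2*pi} F'" and per: "F (2*pi) = F 0"
  shows "cmod (integral {0..2*pi} (\<lambda>t. of_real (F t) * (cis t ^ g * b (cis t))))
     \<le> B / g * integral {0..2*pi} (\<lambda>t. \<bar>F' t\<bar>)"
proof -
  obtain G where G: "\<And>z. z \<in> ball 0 R \<Longrightarrow> (G has_field_derivative z ^ (g - 1) * b z) (at z)"
    and GB: "\<And>z. cmod z = 1 \<Longrightarrow> cmod (G z) \<le> B / g"
    using primitive_bound[OF b R B g] by blast
  have cis_in: "cis t \<in> ball 0 R" for t using R by simp
  have B0: "0 \<le> B" using B[of 0] by (smt (verit) norm_ge_zero norm_zero)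
  have pow: "cis t * cis t ^ (g - 1) = cis t ^ g" for t
    using g by (simp flip: power_Suc)
  have dG: "((\<lambda>t. G (cis t)) has_vector_derivative \<i> * (cis t ^ g * b (cis t))) (at t)" for t
    using cis_vector_derivative[OF G[OF cis_in]] by (simp only: mult.assoc[symmetric] pow[symmetric])
  have cG: "continuous_on S (\<lambda>t. G (cis t))" for S
    by (intro continuous_at_imp_continuous_on ballI has_vector_derivative_continuous[OF dG])
  have cF: "continuous_on S F" for S
    by (intro continuous_at_imp_continuous_on ballI DERIV_isCont[OF F])
  have cb: "continuous_on S (\<lambda>t. b (cis t))" for S
    by (rule continuous_on_compose2[OF holomorphic_on_imp_continuous_on[OF b]])
      (use R in \<open>auto intro!: continuous_intros\<close>)
  let ?I1 = "integral {0..2*pi} (\<lambda>t. of_real (F t) * (cis t ^ g * b (cis t)))"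
  let ?I2 = "integral {0..2*pi} (\<lambda>t. of_real (F' t) * G (cis t))"
  have dF: "((\<lambda>t. complex_of_real (F t)) has_vector_derivative of_real (F' t)) (at t)" for t
    using F[of t] by (auto intro!: derivative_eq_intros simp: has_real_derivative_iff_has_vector_derivative)
  have "((\<lambda>t. of_real (F t) * (\<i> * (cis t ^ g * b (cis t))) + of_real (F' t) * G (cis t))
      has_integral of_real (F (2*pi)) * G (cis (2*pi)) - of_real (F 0) * G (cis 0)) {0..2*pi}"
    by (rule fundamental_theorem_of_calculus, simp, rule has_vector_derivative_at_within,
        rule has_vector_derivative_mult[OF dF dG])
  \<comment> \<open>The boundary terms cancel because \<open>F\<close> and \<open>cis\<close> take
    equal values at both ends.\<close>
  then have A: "((\<lambda>t. of_real (F t) * (\<i> * (cis t ^ g * b (cis t))) + of_real (F' t) * G (cis t))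
      has_integral 0) {0..2*pi}" by (simp add: per)
  have "((\<lambda>t. of_real (F t) * (cis t ^ g * b (cis t))) has_integral ?I1) {0..2*pi}"
    by (intro integrable_integral integrable_continuous_real continuous_intros cF cb)
  then have "((\<lambda>t. \<i> * (of_real (F t) * (cis t ^ g * b (cis t)))) has_integral \<i> * ?I1) {0..2*pi}"
    by (rule has_integral_mult_right)
  then have I1: "((\<lambda>t. of_real (F t) * (\<i> * (cis t ^ g * b (cis t)))) has_integral \<i> * ?I1) {0..2*pi}"
    by (subst mult.left_commute)
  have I2: "((\<lambda>t. of_real (F' t) * G (cis t)) has_integral ?I2) {0..2*pi}"
    by (intro integrable_integral integrable_continuous_real continuous_intros F' cG)
  have "\<i> * ?I1 + ?I2 = 0"
    by (rule has_integral_unique[OF has_integral_add[OF I1 I2] A])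
  then have "\<i> * ?I1 = - ?I2" by (simp only: eq_neg_iff_add_eq_0)
  then have "cmod (\<i> * ?I1) = cmod (- ?I2)" by (rule arg_cong)
  then have "cmod ?I1 = cmod ?I2" unfolding norm_mult norm_minus_cancel by simp
  also have "\<dots> \<le> integral {0..2*pi} (\<lambda>t. B / g * \<bar>F' t\<bar>)"
  proof (rule integral_norm_bound_integral)
    show "cmod (of_real (F' t) * G (cis t)) \<le> B / g * \<bar>F' t\<bar>" for t
      using GB[of "cis t"] mult_left_mono[of "cmod (G (cis t))" "B / g" "\<bar>F' t\<bar>"]
      by (simp add: norm_mult mult.commute)
  qed (intro integrable_continuous_real continuous_intros F' cG)+
  finally show ?thesis by simp
qed

section \<open>Numerical estimates for powers, growth and contraction\<close>

lemma exp_le_quadratic: "\<bar>x\<bar> \<le> 1 \<Longrightarrow> exp x \<le> 1 + x + x\<^sup>2" for x :: real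
proof (cases "x \<ge> 0")
  case False
  assume "\<bar>x\<bar> \<le> 1"
  \<comment> \<open>For negative \<open>x = - y\<close>, the quadratic Taylor bound for
    \<open>exp y\<close> times \<open>1 - y + y^2\<close> is at least 1, which bounds
    \<open>exp (- y)\<close> from above.\<close>
  define y where "y = - x"
  have y: "0 \<le> y" using False by (simp add: y_def)
  have "1 + y + y\<^sup>2 / 2 \<le> exp y" using exp_lower_Taylor_quadratic[OF y] .
  moreover have "(1 - y + y\<^sup>2) * (1 + y + y\<^sup>2 / 2) = 1 + (y ^ 2 + y ^ 3 + y ^ 4) / 2"
    by (simp add: field_simps eval_nat_numeral)
  then have "1 \<le> (1 - y + y\<^sup>2) * (1 + y + y\<^sup>2 / 2)" using y by simp
  moreover have "0 \<le> 1 - y + y\<^sup>2"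
    using zero_le_power2[of "y - 1/2"] by (simp add: power2_eq_square algebra_simps)
  ultimately have "1 \<le> (1 - y + y\<^sup>2) * exp y"
    by (meson mult_left_mono order_trans)
  then have "exp (- y) \<le> 1 - y + y\<^sup>2" by (simp add: exp_minus field_simps)
  then show ?thesis by (simp add: y_def)
qed (use exp_bound in auto)

text \<open>Write the power as \<open>exp (s L)\<close> with \<open>L = ln (1 + u)\<close> and
  \<open>u = |\<zeta>|^2 - 2 Re \<zeta>\<close>. The linear term is kept exactly, because it will
  oscillate under the integral; the rest is of order \<open>|\<zeta>|^2\<close>. The smallness of
  \<open>\<zeta>\<close> ensures \<open>|u| \<le> 1/2\<close> for the logarithm and
  \<open>|s L| \<le> 1\<close> for the exponential.\<close>

lemma powr_le_quadratic:
  fixes s :: real and \<zeta> :: complex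
  assumes \<zeta>: "cmod \<zeta> \<le> 1 / (6 * (\<bar>s\<bar> + 1))"
  shows "(cmod (1 - \<zeta>))\<^sup>2 powr s \<le> 1 - 2 * s * Re \<zeta> + (19 * \<bar>s\<bar> + 36 * s\<^sup>2) * (cmod \<zeta>)\<^sup>2"
proof -
  define r where "r = cmod \<zeta>"
  define u where "u = r\<^sup>2 - 2 * Re \<zeta>"
  define L where "L = ln (1 + u)"
  have r0: "0 \<le> r" by (simp add: r_def)
  have r6: "6 * (\<bar>s\<bar> + 1) * r \<le> 1"
    using \<zeta> by (simp add: r_def pos_le_divide_eq mult.commute add_pos_nonneg)
  have "6 * (\<bar>s\<bar> * r) + 6 * r \<le> 1" using r6 by (simp add: algebra_simps)
  moreover have "0 \<le> \<bar>s\<bar> * r" using r0 by simp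
  ultimately have sr: "6 * (\<bar>s\<bar> * r) \<le> 1" "6 * r \<le> 1" using r0 by linarith+
  have eq: "(cmod (1 - \<zeta>))\<^sup>2 = 1 + u"
    unfolding u_def r_def cmod_power2 by (simp add: power2_eq_square algebra_simps)
  have "\<bar>Re \<zeta>\<bar> \<le> r" unfolding r_def by (rule abs_Re_le_cmod)
  moreover have "r\<^sup>2 \<le> r" using r0 sr by (simp add: power2_eq_square mult_left_le)
  ultimately have u3: "\<bar>u\<bar> \<le> 3 * r" unfolding u_def using zero_le_power2[of r] by linarith
  then have u12: "\<bar>u\<bar> \<le> 1/2" using sr by linarith
  have u2: "u\<^sup>2 \<le> 9 * r\<^sup>2" using power_mono[OF u3, of 2] by (simp add: power_mult_distrib)
  have Lu: "\<bar>L - u\<bar> \<le> 2 * u\<^sup>2" unfolding L_def by (rule abs_ln_one_plus_x_minus_x_bound[OF u12])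
  moreover have "2 * u\<^sup>2 \<le> \<bar>u\<bar>" using mult_left_mono[OF u12, of "2*\<bar>u\<bar>"] by (simp add: power2_eq_square flip: abs_mult)
  ultimately have L6: "\<bar>L\<bar> \<le> 6 * r" using u3 by linarith
  have "\<bar>s * L\<bar> \<le> \<bar>s\<bar> * (6 * r)" unfolding abs_mult by (intro mult_left_mono L6) simp
  then have sL: "\<bar>s * L\<bar> \<le> 1" using sr by linarith
  have "(cmod (1 - \<zeta>))\<^sup>2 powr s = exp (s * L)"
    unfolding eq L_def using u12 by (simp add: powr_def)
  also have "\<dots> \<le> 1 + s * L + (s * L)\<^sup>2" by (rule exp_le_quadratic[OF sL])
  \<comment> \<open>The constant 18 is 2 times 9, from \<open>|L - u| \<le> 2 u^2\<close> and
    \<open>|u| \<le> 3 r\<close>; 36 is the square of the 6 in \<open>|L| \<le> 6 r\<close>. The 19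
    of the statement also absorbs the \<open>r^2\<close> inside \<open>u\<close>.\<close>
  also have "1 + s * L + (s * L)\<^sup>2 \<le> 1 + (s * u + \<bar>s\<bar> * (18 * r\<^sup>2)) + s\<^sup>2 * (36 * r\<^sup>2)"
  proof -
    have "s * (L - u) \<le> \<bar>s\<bar> * \<bar>L - u\<bar>" by (metis abs_ge_self abs_mult)
    also have "\<dots> \<le> \<bar>s\<bar> * (18 * r\<^sup>2)" using Lu u2 by (intro mult_left_mono) auto
    finally have "s * L \<le> s * u + \<bar>s\<bar> * (18 * r\<^sup>2)" by (simp add: algebra_simps)
    moreover have "(s * L)\<^sup>2 \<le> s\<^sup>2 * (36 * r\<^sup>2)"
      unfolding power_mult_distrib using power_mono[OF L6, of 2]
      by (intro mult_left_mono) (auto simp: power_mult_distrib)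
    ultimately show ?thesis by linarith
  qed
  also have "s * u \<le> \<bar>s\<bar> * r\<^sup>2 - 2 * s * Re \<zeta>"
    unfolding u_def using mult_right_mono[OF abs_ge_self[of s], of "r\<^sup>2"] by (simp add: algebra_simps)
  finally show ?thesis by (simp add: r_def algebra_simps)
qed

text \<open>A discrete Gronwall estimate, from \<open>1 + x \<le> exp x\<close>. The summand 1 in
  the witness keeps the bound positive even if \<open>u 0 = 0\<close>.\<close>

lemma growth_bounded:
  fixes u e :: "nat \<Rightarrow> real"
  assumes "summable e" "\<And>n. 0 \<le> e n" "\<And>n. 0 \<le> u n" "\<And>n. u (Suc n) \<le> u n * (1 + e n)"
  shows "\<exists>K>0. \<forall>n. u n \<le> K"
proof (intro exI conjI allI)
  show "u n \<le> (u 0 + 1) * exp (suminf e)" for n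
  proof -
    have "u n \<le> u 0 * exp (\<Sum>i<n. e i)"
    proof (induction n)
      case (Suc n)
      have "u (Suc n) \<le> u n * (1 + e n)" by (rule assms)
      also have "\<dots> \<le> (u 0 * exp (\<Sum>i<n. e i)) * exp (e n)"
        using assms Suc by (intro mult_mono exp_ge_add_one_self) auto
      finally show ?case by (simp add: exp_add mult_ac)
    qed simp
    also have "\<dots> \<le> (u 0 + 1) * exp (suminf e)"
      using assms sum_le_suminf[OF assms(1), of "{..<n}"] by (intro mult_mono) auto
    finally show ?thesis .
  qed
  show "0 < (u 0 + 1) * exp (suminf e)" using assms(3)[of 0] by (intro mult_pos_pos) auto
qed

text \<open>Convexity of the square with weights \<open>\<rho>\<close> and \<open>1 - \<rho>\<close>
  turns the step into a contraction by \<open>\<rho>\<close> for the squares, up to a summable term.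
  After summation the partial sum on the right is absorbed on the left.\<close>

lemma contraction_square_summable:
  fixes x y :: "nat \<Rightarrow> real"
  assumes y: "summable (\<lambda>n. (y n)\<^sup>2)" and x0: "\<And>n. 0 \<le> x n"
    and \<rho>: "0 < \<rho>" "\<rho> < 1" and step: "\<And>n. x (Suc n) \<le> \<rho> * (x n + y n)"
  shows "summable (\<lambda>n. (x n)\<^sup>2)"
proof -
  define A where "A = suminf (\<lambda>n. (y n)\<^sup>2) / (1 - \<rho>)"
  have sq: "(x (Suc n))\<^sup>2 \<le> \<rho> * (x n)\<^sup>2 + (y n)\<^sup>2 / (1 - \<rho>)" for n
  proof -
    have "(x (Suc n))\<^sup>2 \<le> \<rho>\<^sup>2 * (x n + y n)\<^sup>2"
      using power_mono[OF step x0, of n 2] by (simp add: power_mult_distrib)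
    also have "(x n + y n)\<^sup>2 \<le> (x n)\<^sup>2 / \<rho> + (y n)\<^sup>2 / (1 - \<rho>)"
    proof -
      have "(x n)\<^sup>2 / \<rho> + (y n)\<^sup>2 / (1 - \<rho>) - (x n + y n)\<^sup>2 = ((1 - \<rho>) * x n - \<rho> * y n)\<^sup>2 / (\<rho> * (1 - \<rho>))"
        using \<rho> by (simp add: divide_simps) (simp add: power2_eq_square algebra_simps)
      also have "\<dots> \<ge> 0" using \<rho> by simp
      finally show ?thesis by simp
    qed
    also have "\<rho>\<^sup>2 * ((x n)\<^sup>2 / \<rho> + (y n)\<^sup>2 / (1 - \<rho>)) = \<rho> * (x n)\<^sup>2 + \<rho>\<^sup>2 * ((y n)\<^sup>2 / (1 - \<rho>))"
      using \<rho> by (simp add: field_simps power2_eq_square)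
    also have "\<rho>\<^sup>2 * ((y n)\<^sup>2 / (1 - \<rho>)) \<le> 1 * ((y n)\<^sup>2 / (1 - \<rho>))"
      using \<rho> by (intro mult_right_mono) (auto simp: power_le_one)
    finally show ?thesis using \<rho> by (simp add: mult_left_mono)
  qed
  show ?thesis
  proof (rule summableI_nonneg_bounded)
    fix n
    let ?S = "\<Sum>i<n. (x i)\<^sup>2"
    have "?S \<le> (\<Sum>i<Suc n. (x i)\<^sup>2)" by simp
    also have "\<dots> = (x 0)\<^sup>2 + (\<Sum>i<n. (x (Suc i))\<^sup>2)" by (rule sum.lessThan_Suc_shift)
    also have "\<dots> \<le> (x 0)\<^sup>2 + (\<Sum>i<n. \<rho> * (x i)\<^sup>2 + (y i)\<^sup>2 / (1 - \<rho>))"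
      by (intro add_left_mono sum_mono sq)
    also have "\<dots> = (x 0)\<^sup>2 + \<rho> * ?S + (\<Sum>i<n. (y i)\<^sup>2) / (1 - \<rho>)"
      by (simp add: sum.distrib sum_distrib_left sum_divide_distrib)
    also have "(\<Sum>i<n. (y i)\<^sup>2) / (1 - \<rho>) \<le> A"
      unfolding A_def using \<rho> sum_le_suminf[OF y, of "{..<n}"] by (intro divide_right_mono) auto
    finally have "(1 - \<rho>) * ?S \<le> (x 0)\<^sup>2 + A" by (simp add: algebra_simps)
    then show "?S \<le> ((x 0)\<^sup>2 + A) / (1 - \<rho>)" using \<rho> by (simp add: field_simps)
  qed simp
qed

section \<open>Growth of the integrals of powers\<close>

text \<open>There are finitely many zeros, so their smallest modulus exceeds 1; the inserted 2 keeps
  the minimum defined when there are none. The larger ball makes quotients by \<open>\<Phi>s\<close>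
  analytic across the unit circle.\<close>

lemma poly_nonzero_larger_ball:
  assumes "\<And>z. cmod z \<le> 1 \<Longrightarrow> poly p z \<noteq> 0"
  obtains R where "R > 1" "\<And>z. z \<in> ball 0 R \<Longrightarrow> poly p z \<noteq> 0"
proof -
  have "p \<noteq> 0" using assms[of 0] by auto
  then have fin: "finite (insert 2 (cmod ` {z. poly p z = 0}))" by (simp add: poly_roots_finite)
  define R where "R = Min (insert 2 (cmod ` {z. poly p z = 0}))"
  have "1 < x" if "x \<in> insert 2 (cmod ` {z. poly p z = 0})" for x
  proof (cases "x = 2")
    case False
    with that obtain z where "x = cmod z" "poly p z = 0" by auto
    with assms[of z] show ?thesis by (cases "cmod z \<le> 1") auto
  qed simp
  then have "R > 1" unfolding R_def using fin by simp
  moreover have "poly p z \<noteq> 0" if "z \<in> ball 0 R" for z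
  proof
    assume "poly p z = 0"
    then have "R \<le> cmod z" unfolding R_def using fin by (intro Min_le) auto
    with that show False by simp
  qed
  ultimately show ?thesis using that by blast
qed

context verblunsky_seq
begin

definition W :: "nat \<Rightarrow> real \<Rightarrow> real" where "W n t = (cmod (poly (\<Phi>s n) (cis t)))\<^sup>2"

definition W' :: "nat \<Rightarrow> real \<Rightarrow> real" where
  "W' n t = 2 * (poly (\<Phi>s n) (cis t) \<bullet> (\<i> * cis t * poly (pderiv (\<Phi>s n)) (cis t)))"

definition J :: "real \<Rightarrow> nat \<Rightarrow> real" where "J s n = integral {0..2*pi} (\<lambda>t. W n t powr s)"

lemma W_pos: "W n t > 0"
  unfolding W_def using \<Phi>s_nonzero[of "cis t" n] by simp

lemma W_deriv: "(W n has_real_derivative W' n t) (at t)"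
proof -
  have "((\<lambda>t. poly (\<Phi>s n) (cis t)) has_vector_derivative \<i> * cis t * poly (pderiv (\<Phi>s n)) (cis t)) (at t)"
    by (rule cis_vector_derivative[OF poly_DERIV])
  from bounded_bilinear.has_vector_derivative[OF bounded_bilinear_inner this this]
  have "((\<lambda>t. poly (\<Phi>s n) (cis t) \<bullet> poly (\<Phi>s n) (cis t)) has_vector_derivative
      (poly (\<Phi>s n) (cis t) \<bullet> (\<i> * cis t * poly (pderiv (\<Phi>s n)) (cis t))
       + (\<i> * cis t * poly (pderiv (\<Phi>s n)) (cis t)) \<bullet> poly (\<Phi>s n) (cis t))) (at t)" .
  then show ?thesis
    unfolding has_real_derivative_iff_has_vector_derivative W'_def W_def[abs_def] power2_norm_eq_inner
    by (simp add: inner_commute)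
qed

lemma W_continuous: "continuous_on S (W n)"
  by (intro continuous_at_imp_continuous_on ballI DERIV_isCont[OF W_deriv])

lemma W'_continuous: "continuous_on S (W' n)"
  unfolding W'_def[abs_def] by (intro continuous_intros)

lemma W'_bound: "\<bar>W' n t\<bar> \<le> 2 * D n * W n t"
proof -
  let ?p = "cmod (poly (\<Phi>s n) (cis t))"
  have "\<bar>W' n t\<bar> \<le> 2 * (?p * cmod (\<i> * cis t * poly (pderiv (\<Phi>s n)) (cis t)))"
    unfolding W'_def using Cauchy_Schwarz_ineq2 by (simp add: abs_mult)
  also have "\<dots> \<le> 2 * (?p * (D n * ?p))"
    using norm_pderiv_\<Phi>s_le[of "cis t" n] by (intro mult_left_mono) (auto simp: norm_mult)
  finally show ?thesis by (simp add: W_def power2_eq_square mult_ac)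
qed

lemma Wpowr_continuous: "continuous_on S (\<lambda>t. W n t powr s)"
proof (intro continuous_on_powr W_continuous continuous_on_const ballI)
  show "W n t \<noteq> 0" for t using W_pos[of n t] by simp
qed

lemma Wpowr_integrable: "(\<lambda>t. W n t powr s) integrable_on {0..2*pi}"
  by (intro integrable_continuous_real Wpowr_continuous)

lemma J_nonneg: "J s n \<ge> 0"
  unfolding J_def by (intro integral_nonneg Wpowr_integrable) auto

text \<open>On the circle \<open>W (Suc n) = W n |1 - \<zeta>|^2\<close> with
  \<open>\<zeta> = a n z ^ g b\<close> and \<open>b = Q / \<Phi>s n\<close>. After
  \<open>powr_le_quadratic\<close> the linear term is an oscillatory integral against
  \<open>F = W n powr s\<close>. One factor \<open>2 |s|\<close> of \<open>4 s^2\<close> is the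
  coefficient of that term, the other comes from \<open>|F'| \<le> 2 |s| D n F\<close>.\<close>

lemma J_step:
  assumes small: "cmod (a n) \<le> 1 / (6 * (\<bar>s\<bar> + 1))"
    and P: "\<And>z. z * poly (\<Phi> n) z = z ^ g * poly Q z" and g: "g > 0"
    and Q: "\<And>z. cmod z \<le> 1 \<Longrightarrow> cmod (poly Q z) \<le> cmod (poly (\<Phi>s n) z)"
  shows "J s (Suc n) \<le> J s n * (1 + (4 * s\<^sup>2 * D n / g * cmod (a n)
            + (19 * \<bar>s\<bar> + 36 * s\<^sup>2) * (cmod (a n))\<^sup>2))"
proof -
  define C where "C = 19 * \<bar>s\<bar> + 36 * s\<^sup>2"
  define b where "b z = poly Q z / poly (\<Phi>s n) z" for z
  define F where "F t = W n t powr s" for t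
  define F' where "F' t = s * W n t powr (s - 1) * W' n t" for t
  define h where "h t = of_real (F t) * (cis t ^ g * b (cis t))" for t
  have C0: "C \<ge> 0" by (simp add: C_def)
  obtain R where R: "R > 1" "\<And>z. z \<in> ball 0 R \<Longrightarrow> poly (\<Phi>s n) z \<noteq> 0"
    using poly_nonzero_larger_ball[of "\<Phi>s n"] \<Phi>s_nonzero by blast
  have hol: "b holomorphic_on ball 0 R"
    unfolding b_def[abs_def] using R by (intro holomorphic_intros) auto
  have b1: "cmod (b z) \<le> 1" if "cmod z \<le> 1" for z
    using Q[OF that] \<Phi>s_nonzero[OF that, of n] by (simp add: b_def norm_divide)
  have F'_deriv: "(F has_real_derivative F' t) (at t)" for t
    unfolding F_def[abs_def] F'_def using W_pos[of n t]
    by (auto intro!: derivative_eq_intros W_deriv simp: powr_diff)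
  have F'_cont: "continuous_on {0..2*pi} F'"
    unfolding F'_def[abs_def] by (intro continuous_intros Wpowr_continuous W'_continuous)
  have F'_bound: "\<bar>F' t\<bar> \<le> 2 * \<bar>s\<bar> * D n * F t" for t
  proof -
    have "\<bar>F' t\<bar> \<le> \<bar>s\<bar> * W n t powr (s - 1) * (2 * D n * W n t)"
      unfolding F'_def abs_mult using W'_bound by (intro mult_mono) auto
    also have "\<dots> = 2 * \<bar>s\<bar> * D n * F t"
      unfolding F_def using W_pos[of n t] by (simp add: powr_diff)
    finally show ?thesis .
  qed
  have cb: "continuous_on S (\<lambda>t. b (cis t))" for S
    by (rule continuous_on_compose2[OF holomorphic_on_imp_continuous_on[OF hol]])
      (use R in \<open>auto intro!: continuous_intros\<close>)
  have cF: "continuous_on S F" for S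
    unfolding F_def[abs_def] by (rule Wpowr_continuous)
  have h_int: "h integrable_on {0..2*pi}"
    unfolding h_def[abs_def] by (intro integrable_continuous_real continuous_intros cF cb)
  have "cmod (integral {0..2*pi} h) \<le> 1 / g * integral {0..2*pi} (\<lambda>t. \<bar>F' t\<bar>)"
    unfolding h_def
    by (rule oscillatory_integral_bound[OF hol R(1) b1 g F'_deriv F'_cont]) (simp_all add: F_def W_def)
  also have "\<dots> \<le> 1 / g * integral {0..2*pi} (\<lambda>t. 2 * \<bar>s\<bar> * D n * F t)"
    by (intro mult_left_mono integral_le integrable_continuous_real continuous_intros cF F'_cont F'_bound) auto
  also have "\<dots> = 2 * \<bar>s\<bar> * D n / g * J s n" by (simp add: J_def F_def[abs_def])
  finally have h_bound: "cmod (integral {0..2*pi} h) \<le> 2 * \<bar>s\<bar> * D n / g * J s n" .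
  have pt: "W (Suc n) t powr s \<le> (1 + C * (cmod (a n))\<^sup>2) * F t - 2 * s * Re (a n * h t)" for t
  proof -
    define \<zeta> where "\<zeta> = a n * (cis t ^ g * b (cis t))"
    have nz: "poly (\<Phi>s n) (cis t) \<noteq> 0" by (simp add: \<Phi>s_nonzero)
    have \<zeta>: "cmod \<zeta> \<le> cmod (a n)"
      unfolding \<zeta>_def using b1[of "cis t"] by (simp add: norm_mult norm_power mult_left_le)
    have "poly (\<Phi>s n) (cis t) * (1 - \<zeta>) = poly (\<Phi>s n) (cis t) - a n * (cis t ^ g * poly Q (cis t))"
      using nz by (simp add: \<zeta>_def b_def algebra_simps)
    also have "\<dots> = poly (\<Phi>s (Suc n)) (cis t)" by (simp add: \<Phi>s_Suc flip: P)
    finally have "W (Suc n) t = W n t * (cmod (1 - \<zeta>))\<^sup>2"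
      unfolding W_def power_mult_distrib[symmetric] norm_mult[symmetric] by simp
    then have "W (Suc n) t powr s = F t * (cmod (1 - \<zeta>))\<^sup>2 powr s"
      using W_pos[of n t] by (simp add: F_def powr_mult)
    also have "\<dots> \<le> F t * (1 - 2 * s * Re \<zeta> + C * (cmod \<zeta>)\<^sup>2)"
      unfolding C_def using \<zeta> small by (intro mult_left_mono powr_le_quadratic) (auto simp: F_def)
    also have "\<dots> \<le> F t * (1 - 2 * s * Re \<zeta> + C * (cmod (a n))\<^sup>2)"
      using \<zeta> C0 by (intro mult_left_mono add_left_mono power_mono) (auto simp: F_def)
    also have "a n * h t = of_real (F t) * \<zeta>" by (simp add: h_def \<zeta>_def mult_ac)
    then have e: "Re (a n * h t) = F t * Re \<zeta>" by simp
    have "F t * (1 - 2 * s * Re \<zeta> + C * (cmod (a n))\<^sup>2)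
       = (1 + C * (cmod (a n))\<^sup>2) * F t - 2 * s * Re (a n * h t)" unfolding e by (simp add: algebra_simps)
    finally show ?thesis .
  qed
  have FI: "(F has_integral J s n) {0..2*pi}"
    unfolding J_def F_def[abs_def] by (intro integrable_integral Wpowr_integrable)
  have "((\<lambda>t. Re (a n * h t)) has_integral Re (a n * integral {0..2*pi} h)) {0..2*pi}"
    by (rule has_integral_Re[OF has_integral_mult_right[OF integrable_integral[OF h_int]]])
  then have "((\<lambda>t. (1 + C * (cmod (a n))\<^sup>2) * F t - 2 * s * Re (a n * h t)) has_integral
      (1 + C * (cmod (a n))\<^sup>2) * J s n - 2 * s * Re (a n * integral {0..2*pi} h)) {0..2*pi}"
    by (rule has_integral_diff[OF has_integral_mult_right[OF FI] has_integral_mult_right])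
  moreover have "((\<lambda>t. W (Suc n) t powr s) has_integral J s (Suc n)) {0..2*pi}"
    unfolding J_def by (intro integrable_integral Wpowr_integrable)
  ultimately have up: "J s (Suc n) \<le> (1 + C * (cmod (a n))\<^sup>2) * J s n - 2 * s * Re (a n * integral {0..2*pi} h)"
    using pt by (auto intro: has_integral_le)
  have "- (2 * s * Re (a n * integral {0..2*pi} h)) \<le> 2 * \<bar>s\<bar> * (cmod (a n) * (2 * \<bar>s\<bar> * D n / g * J s n))"
  proof -
    have "- (2 * s * Re (a n * integral {0..2*pi} h)) \<le> \<bar>2 * s * Re (a n * integral {0..2*pi} h)\<bar>" by simp
    also have "\<dots> = 2 * \<bar>s\<bar> * \<bar>Re (a n * integral {0..2*pi} h)\<bar>" by (simp add: abs_mult)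
    also have "\<dots> \<le> 2 * \<bar>s\<bar> * cmod (a n * integral {0..2*pi} h)"
      by (intro mult_left_mono abs_Re_le_cmod) auto
    also have "\<dots> \<le> 2 * \<bar>s\<bar> * (cmod (a n) * (2 * \<bar>s\<bar> * D n / g * J s n))"
      unfolding norm_mult by (intro mult_left_mono h_bound) auto
    finally show ?thesis .
  qed
  then have "(1 + C * (cmod (a n))\<^sup>2) * J s n - 2 * s * Re (a n * integral {0..2*pi} h)
     \<le> J s n * (1 + (4 * s\<^sup>2 * D n / g * cmod (a n) + C * (cmod (a n))\<^sup>2))"
    by (simp add: algebra_simps power2_eq_square)
  with up show ?thesis unfolding C_def by linarith
qed

text \<open>While the coefficients vanish, the recursion only multiplies \<open>\<Phi>\<close> by
  \<open>z\<close>; a gap thus supplies the power of \<open>z\<close> that \<open>J_step\<close>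
  exploits.\<close>

lemma gap:
  assumes "\<And>j. m \<le> j \<Longrightarrow> j < m + k \<Longrightarrow> a j = 0"
  shows "\<Phi>s (m + k) = \<Phi>s m \<and> poly (\<Phi> (m + k)) z = z ^ k * poly (\<Phi> m) z
     \<and> E (m + k) = E m + k \<and> D (m + k) = D m"
  using assms
proof (induction k)
  case (Suc k)
  have z: "a (m + k) = 0" by (rule Suc.prems) simp_all
  have "\<Phi>s (m + k) = \<Phi>s m \<and> poly (\<Phi> (m + k)) z = z ^ k * poly (\<Phi> m) z
     \<and> E (m + k) = E m + k \<and> D (m + k) = D m"
    by (rule Suc.IH) (rule Suc.prems, simp_all)
  then show ?case by (simp add: z \<Phi>s_Suc \<Phi>_Suc)
qed simp

end

section \<open>Boundedness of the integrals along a lacunary sequence\<close>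

lemma lacunary_strict_mono:
  fixes N :: "nat \<Rightarrow> nat" and q :: real
  assumes N0: "0 < N 0" and q: "1 < q" and Nq: "\<And>l. q * N l \<le> N (Suc l)"
  shows "0 < N l" and "strict_mono N"
proof -
  have pos: "0 < N l" for l
  proof (induction l)
    case (Suc l)
    then have "0 < q * N l" using q by simp
    then have "0 < real (N (Suc l))" using Nq[of l] by linarith
    then show ?case by simp
  qed (rule N0)
  have "N l < N (Suc l)" for l
  proof -
    have "1 * real (N l) < q * N l" using q pos[of l] by (intro mult_strict_right_mono) auto
    then show ?thesis using Nq[of l] by linarith
  qed
  then show "strict_mono N" by (simp add: strict_mono_Suc_iff)
  show "0 < N l" by (rule pos)
qed

context verblunsky_seq
begin

text \<open>Along the sequence \<open>E\<close> grows at most like \<open>N\<close>, because its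
  factor per step stays below \<open>\<kappa> < q\<close>. Hence \<open>x = D / N\<close> obeys a
  contraction by \<open>1 / q\<close> driven by \<open>|a|\<close> and is square-summable. As the
  gaps are comparable to \<open>N\<close>, the growth factors of \<open>J_step\<close> are
  \<open>1 + e l\<close> with \<open>e\<close> summable.\<close>

lemma J_bounded_aux:
  fixes N :: "nat \<Rightarrow> nat" and q \<kappa> s :: real
  assumes N0: "0 < N 0" and q: "\<kappa> < q" and \<kappa>: "1 \<le> \<kappa>"
    and Nq: "\<And>l. q * N l \<le> N (Suc l)"
    and gaps: "\<And>j l. N l < j \<Longrightarrow> j < N (Suc l) \<Longrightarrow> a j = 0"
    and sq: "summable (\<lambda>l. (cmod (a (N l)))\<^sup>2)"
    and half: "\<And>l. cmod (a (N l)) \<le> 1/2"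
    and small: "\<And>l. cmod (a (N l)) \<le> 1 / (6 * (\<bar>s\<bar> + 1))"
    and near1: "\<And>l. (1 + cmod (a (N l))) / (1 - cmod (a (N l))) \<le> \<kappa>"
  shows "\<exists>K>0. \<forall>l. J s (Suc (N l)) \<le> K"
proof -
  define b where "b l = cmod (a (N l))" for l
  define r where "r l = real (N l)" for l
  have q1: "1 < q" using q \<kappa> by linarith
  note N_props = lacunary_strict_mono[where N = N and q = q, OF N0 q1 Nq]
  have Npos: "0 < N l" for l by (rule N_props(1))
  have Nless: "N l < N (Suc l)" for l using N_props(2) by (simp add: strict_mono_Suc_iff)
  have r_pos: "r l > 0" "r l \<ge> 1" for l using Npos[of l] by (auto simp: r_def)
  have rq: "q * r l \<le> r (Suc l)" for l using Nq by (simp add: r_def)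
  have b0: "0 \<le> b l" "b l \<le> 1/2" for l using half by (auto simp: b_def)
  have gapl: "\<Phi>s (N (Suc l)) = \<Phi>s (Suc (N l))
      \<and> poly (\<Phi> (N (Suc l))) z = z ^ (N (Suc l) - Suc (N l)) * poly (\<Phi> (Suc (N l))) z
      \<and> E (N (Suc l)) = E (Suc (N l)) + (r (Suc l) - r l - 1) \<and> D (N (Suc l)) = D (Suc (N l))" for l z
  proof -
    have e: "Suc (N l) + (N (Suc l) - Suc (N l)) = N (Suc l)" using Nless[of l] by simp
    have "\<Phi>s (Suc (N l) + (N (Suc l) - Suc (N l))) = \<Phi>s (Suc (N l))
      \<and> poly (\<Phi> (Suc (N l) + (N (Suc l) - Suc (N l)))) z = z ^ (N (Suc l) - Suc (N l)) * poly (\<Phi> (Suc (N l))) z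
      \<and> E (Suc (N l) + (N (Suc l) - Suc (N l))) = E (Suc (N l)) + real (N (Suc l) - Suc (N l))
      \<and> D (Suc (N l) + (N (Suc l) - Suc (N l))) = D (Suc (N l))"
      by (rule gap) (use gaps[of l] e in auto)
    then show ?thesis
      unfolding e r_def using Nless[of l] by (simp add: of_nat_diff)
  qed
  \<comment> \<open>The first entry of the maximum starts the induction for \<open>E_le\<close>; the
    second makes \<open>\<kappa> C / q + 1 \<le> C\<close>, which closes its step.\<close>
  define C where "C = max (E (N 0)) (1 / (1 - \<kappa> / q))"
  have kq: "0 < 1 - \<kappa> / q" using q q1 by simp
  have C1: "C \<ge> 1" using E_ge_1[of "N 0"] by (simp add: C_def)
  have C2: "\<kappa> * C / q + 1 \<le> C"
  proof -
    have "1 / (1 - \<kappa> / q) \<le> C" by (simp add: C_def)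
    then have "1 \<le> C * (1 - \<kappa> / q)" using kq pos_divide_le_eq by blast
    then show ?thesis by (simp add: algebra_simps)
  qed
  have E_le: "E (N l) \<le> C * r l" for l
  proof (induction l)
    case 0
    have "C * 1 \<le> C * r 0" using r_pos C1 by (intro mult_left_mono) auto
    then show ?case using C_def by linarith
  next
    case (Suc l)
    have "E (N (Suc l)) = (1 + b l) / (1 - b l) * E (N l) + r (Suc l) - r l"
      using gapl[of l] by (simp add: b_def)
    also have "\<dots> \<le> \<kappa> * (C * r l) + r (Suc l)"
    proof -
      have "(1 + b l) / (1 - b l) * E (N l) \<le> \<kappa> * (C * r l)"
        using near1[of l] Suc E_ge_1[of "N l"] \<kappa> by (intro mult_mono) (auto simp: b_def)
      then show ?thesis using r_pos[of l] by linarith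
    qed
    also have "\<kappa> * (C * r l) \<le> \<kappa> * (C * (r (Suc l) / q))"
      using rq[of l] \<kappa> C1 q1 by (intro mult_left_mono) (auto simp: field_simps)
    also have "\<kappa> * (C * (r (Suc l) / q)) + r (Suc l) = (\<kappa> * C / q + 1) * r (Suc l)"
      by (simp add: algebra_simps)
    also have "\<dots> \<le> C * r (Suc l)" using C2 r_pos[of "Suc l"] by (intro mult_right_mono) auto
    finally show ?case by simp
  qed
  define x where "x l = D (N l) / r l" for l
  have x0: "0 \<le> x l" for l using D_nonneg r_pos[of l] by (simp add: x_def)
  have sb: "summable (\<lambda>l. (b l)\<^sup>2)" using sq by (simp add: b_def)
  have "x (Suc l) \<le> 1 / q * (x l + 2 * C * b l)" for l
  proof -
    have "D (N (Suc l)) = D (N l) + b l / (1 - b l) * E (N l)"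
      using gapl[of l] by (simp add: b_def)
    also have "b l / (1 - b l) * E (N l) \<le> (2 * b l) * (C * r l)"
    proof (intro mult_mono E_le)
      show "b l / (1 - b l) \<le> 2 * b l"
      proof -
        have "b l * (2 * b l) \<le> b l * 1" using b0[of l] by (intro mult_left_mono) auto
        then show ?thesis using b0[of l] by (simp add: field_simps)
      qed
    qed (use b0[of l] E_ge_1[of "N l"] in auto)
    finally have "D (N (Suc l)) \<le> (x l + 2 * C * b l) * r l"
      using r_pos[of l] by (simp add: x_def algebra_simps)
    then have "x (Suc l) \<le> (x l + 2 * C * b l) * r l / r (Suc l)"
      unfolding x_def using r_pos[of "Suc l"] by (intro divide_right_mono) auto
    also have "\<dots> = (x l + 2 * C * b l) * (r l / r (Suc l))" by simp
    also have "\<dots> \<le> (x l + 2 * C * b l) * (1 / q)"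
      using rq[of l] r_pos[of "Suc l"] q1 x0[of l] b0[of l] C1
      by (intro mult_left_mono) (auto simp: field_simps)
    finally show ?thesis by (simp add: mult.commute)
  qed
  then have sx: "summable (\<lambda>l. (x l)\<^sup>2)"
    using contraction_square_summable[of "\<lambda>l. 2 * C * b l" x "1 / q"] sb q1 x0
    by (simp add: power_mult_distrib summable_mult)
  \<comment> \<open>\<open>G\<close> is the constant \<open>4 s^2\<close> of \<open>J_step\<close>
    over \<open>1 - 1 / q\<close>, since the gap length is at least
    \<open>(1 - 1 / q) N (Suc l)\<close>; \<open>H\<close> is the quadratic constant of
    \<open>J_step\<close>.\<close>
  define G where "G = 4 * s\<^sup>2 / (1 - 1 / q)"
  define H where "H = 19 * \<bar>s\<bar> + 36 * s\<^sup>2"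
  define e where "e l = G * (x (Suc l) * b (Suc l)) + H * (b (Suc l))\<^sup>2" for l
  have G0: "G \<ge> 0" and H0: "H \<ge> 0" using q1 by (simp_all add: G_def H_def)
  have step: "J s (Suc (N (Suc l))) \<le> J s (Suc (N l)) * (1 + e l)" for l
  proof -
    let ?n = "N (Suc l)"
    have g: "z * poly (\<Phi> ?n) z = z ^ (?n - N l) * poly (\<Phi> (Suc (N l))) z" for z
    proof -
      \<comment> \<open>The exponent is one more than the number of vanishing coefficients: the
        factor \<open>z\<close> in front of \<open>\<Phi>\<close> adds a power.\<close>
      have "?n - N l = Suc (?n - Suc (N l))" using Nless[of l] by simp
      then show ?thesis using gapl[of l z] by simp
    qed
    have "J s (Suc ?n) \<le> J s ?n * (1 + (4 * s\<^sup>2 * D ?n / real (?n - N l) * cmod (a ?n) + H * (cmod (a ?n))\<^sup>2))"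
      unfolding H_def
      by (rule J_step[OF small g]) (use Nless[of l] gapl[of l] norm_\<Phi>_le in auto)
    also have "J s ?n = J s (Suc (N l))" using gapl[of l] by (simp add: J_def W_def[abs_def])
    also have "J s (Suc (N l)) * (1 + (4 * s\<^sup>2 * D ?n / real (?n - N l) * cmod (a ?n) + H * (cmod (a ?n))\<^sup>2))
       \<le> J s (Suc (N l)) * (1 + e l)"
    proof (intro mult_left_mono J_nonneg add_left_mono)
      have "(1 - 1 / q) * r (Suc l) \<le> real (?n - N l)"
        using rq[of l] q1 Nless[of l] by (simp add: r_def of_nat_diff field_simps)
      then have "4 * s\<^sup>2 * D ?n / real (?n - N l) \<le> 4 * s\<^sup>2 * D ?n / ((1 - 1 / q) * r (Suc l))"
        using q1 r_pos[of "Suc l"] D_nonneg by (intro frac_le) auto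
      also have "\<dots> = G * x (Suc l)" by (simp add: G_def x_def)
      finally have "4 * s\<^sup>2 * D ?n / real (?n - N l) * b (Suc l) \<le> G * x (Suc l) * b (Suc l)"
        using b0 by (intro mult_right_mono) auto
      then show "4 * s\<^sup>2 * D ?n / real (?n - N l) * cmod (a ?n) + H * (cmod (a ?n))\<^sup>2 \<le> e l"
        by (simp add: e_def b_def)
    qed
    finally show ?thesis .
  qed
  have e0: "0 \<le> e l" for l using G0 H0 x0 b0 by (simp add: e_def)
  have "summable (\<lambda>l. G * ((x (Suc l))\<^sup>2 + (b (Suc l))\<^sup>2) + H * (b (Suc l))\<^sup>2)"
    using sx sb summable_Suc_iff[of "\<lambda>l. (x l)\<^sup>2"] summable_Suc_iff[of "\<lambda>l. (b l)\<^sup>2"]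
    by (intro summable_add summable_mult) simp_all
  then have "summable e"
  proof (rule summable_comparison_test')
    fix l
    \<comment> \<open>The mixed term \<open>x b\<close> is summable by the arithmetic-geometric mean
      inequality.\<close>
    have "0 \<le> (x (Suc l) - b (Suc l))\<^sup>2" by simp
    then have "2 * (x (Suc l) * b (Suc l)) \<le> (x (Suc l))\<^sup>2 + (b (Suc l))\<^sup>2"
      by (simp add: power2_eq_square algebra_simps)
    moreover have "0 \<le> x (Suc l) * b (Suc l)" using x0 b0 by simp
    ultimately have "G * (x (Suc l) * b (Suc l)) \<le> G * ((x (Suc l))\<^sup>2 + (b (Suc l))\<^sup>2)"
      using G0 by (intro mult_left_mono) linarith+
    then show "norm (e l) \<le> G * ((x (Suc l))\<^sup>2 + (b (Suc l))\<^sup>2) + H * (b (Suc l))\<^sup>2"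
      using e0[of l] by (simp add: e_def)
  qed
  from growth_bounded[OF this e0 _ step] show ?thesis using J_nonneg by blast
qed

text \<open>Square summability sends \<open>a (N l)\<close> to zero, so the smallness conditions of
  \<open>J_bounded_aux\<close> hold from some \<open>l0\<close> on, and that lemma is applied to the
  shifted sequence. An eventual bound suffices for the weak limit.\<close>

lemma J_bounded:
  fixes N :: "nat \<Rightarrow> nat" and q s :: real
  assumes N0: "0 < N 0" and q: "1 < q"
    and Nq: "\<And>l. q * N l \<le> N (Suc l)"
    and gaps: "\<And>j l. N l < j \<Longrightarrow> j < N (Suc l) \<Longrightarrow> a j = 0"
    and sq: "summable (\<lambda>j. (cmod (a j))\<^sup>2)"
  shows "\<exists>K>0. \<forall>\<^sub>F l in sequentially. J s (Suc (N l)) \<le> K"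
proof -
  note N_pos = lacunary_strict_mono(1)[where N = N and q = q, OF N0 q Nq]
  note mono = lacunary_strict_mono(2)[where N = N and q = q, OF N0 q Nq]
  have sqN: "summable (\<lambda>l. (cmod (a (N (l + l0))))\<^sup>2)" for l0
  proof -
    have "inj (\<lambda>l. N (l + l0))" by (auto simp: inj_on_def strict_mono_eq[OF mono])
    from summable_reindex[OF sq this] show ?thesis by (simp add: o_def)
  qed
  \<comment> \<open>The midpoint lies above 1, the limit of the growth factors of \<open>E\<close>,
    and still below \<open>q\<close>.\<close>
  define \<kappa> where "\<kappa> = (1 + q) / 2"
  have "(\<lambda>l. sqrt ((cmod (a (N (l + 0))))\<^sup>2)) \<longlonglongrightarrow> sqrt 0"
    by (intro tendsto_real_sqrt summable_LIMSEQ_zero sqN)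
  then have lim: "(\<lambda>l. cmod (a (N l))) \<longlonglongrightarrow> 0" by simp
  have "(\<lambda>l. (1 + cmod (a (N l))) / (1 - cmod (a (N l)))) \<longlonglongrightarrow> (1 + 0) / (1 - 0)"
    by (intro tendsto_intros lim) auto
  then have "\<forall>\<^sub>F l in sequentially. (1 + cmod (a (N l))) / (1 - cmod (a (N l))) < \<kappa>"
    using q by (auto simp: \<kappa>_def dest: order_tendstoD(2)[where a = "\<kappa>"] intro: order_tendstoD(2))
  moreover have "\<forall>\<^sub>F l in sequentially. cmod (a (N l)) < 1/2"
    using lim by (rule order_tendstoD(2)) simp
  moreover have "\<forall>\<^sub>F l in sequentially. cmod (a (N l)) < 1 / (6 * (\<bar>s\<bar> + 1))"
    using lim by (rule order_tendstoD(2)) (simp add: add_nonneg_pos)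
  ultimately have "\<forall>\<^sub>F l in sequentially. (1 + cmod (a (N l))) / (1 - cmod (a (N l))) < \<kappa>
      \<and> cmod (a (N l)) < 1/2 \<and> cmod (a (N l)) < 1 / (6 * (\<bar>s\<bar> + 1))"
    by eventually_elim blast
  then obtain l0 where l0: "\<And>l. l \<ge> l0 \<Longrightarrow> (1 + cmod (a (N l))) / (1 - cmod (a (N l))) < \<kappa>
      \<and> cmod (a (N l)) < 1/2 \<and> cmod (a (N l)) < 1 / (6 * (\<bar>s\<bar> + 1))"
    unfolding eventually_sequentially by blast
  have "\<exists>K>0. \<forall>l. J s (Suc (N (l + l0))) \<le> K"
  proof (rule J_bounded_aux[of "\<lambda>l. N (l + l0)" \<kappa> q s])
    show "\<kappa> < q" "1 \<le> \<kappa>" using q by (simp_all add: \<kappa>_def)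
    show "a j = 0" if "N (l + l0) < j" "j < N (Suc l + l0)" for j l
      using gaps[of "l + l0" j] that by simp
    show "q * N (l + l0) \<le> N (Suc l + l0)" for l using Nq[of "l + l0"] by simp
  qed (use N_pos sqN l0 in \<open>auto intro: less_imp_le\<close>)
  then obtain K where K: "K > 0" "\<And>l. J s (Suc (N (l + l0))) \<le> K" by blast
  have "\<forall>\<^sub>F l in sequentially. J s (Suc (N l)) \<le> K"
    unfolding eventually_sequentially using K(2)[of "l - l0" for l] by (intro exI[of _ l0]) (metis le_add_diff_inverse2)
  with K(1) show ?thesis by blast
qed

end

section \<open>Integration on the circle and orthogonality\<close>

lemma space_circle: "sets N = sets circle_borel \<Longrightarrow> space N = unit_circle"
  by (drule sets_eq_imp_space_eq) (simp add: space_restrict_space)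

lemma circle_measurable:
  fixes f :: "complex \<Rightarrow> 'b::topological_space"
  assumes "sets N = sets circle_borel" "continuous_on unit_circle f"
  shows "f \<in> borel_measurable N"
  unfolding measurable_cong_sets[OF assms(1) refl]
  by (intro borel_measurable_continuous_on_restrict assms)

lemma circle_integrable:
  fixes f :: "complex \<Rightarrow> 'b::{banach, second_countable_topology}"
  assumes "finite_measure N" "sets N = sets circle_borel" "continuous_on unit_circle f"
  shows "integrable N f"
proof -
  interpret finite_measure N by fact
  have "bounded (f ` unit_circle)"
    by (intro compact_imp_bounded compact_continuous_image assms compact_sphere)
  then obtain B where B: "\<And>z. z \<in> unit_circle \<Longrightarrow> norm (f z) \<le> B"
    unfolding bounded_iff by blast
  show ?thesis
    by (rule integrable_const_bound[where B = B, OF _ circle_measurable])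
      (use B assms space_circle[OF assms(2)] in auto)
qed

lemma sets_arc [simp]: "sets arc_measure = sets circle_borel"
  by (simp add: arc_measure_def)

lemma finite_arc: "finite_measure arc_measure"
  using prob_space_arc_measure by (simp add: prob_space_def)

lemma cis_measurable: "cis \<in> measurable (uniform_measure lborel {0..<2*pi}) circle_borel"
  by (rule measurable_restrict_space2)
    (simp_all add: borel_measurable_continuous_onI continuous_on_cis cong: measurable_cong_sets)

text \<open>Translates integrals against \<open>arc_measure\<close> into integrals over an interval,
  where integration by parts was carried out.\<close>

lemma arc_integral:
  fixes f :: "complex \<Rightarrow> 'b::euclidean_space"
  assumes f: "continuous_on unit_circle f"
  shows "(LINT z|arc_measure. f z) = integral {0..2*pi} (\<lambda>t. f (cis t)) /\<^sub>R (2*pi)"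
proof -
  have c: "continuous_on S (\<lambda>t. f (cis t))" for S
    by (rule continuous_on_compose2[OF f]) (auto intro!: continuous_intros)
  have [measurable]: "(\<lambda>t. f (cis t)) \<in> borel_measurable borel"
    by (rule borel_measurable_continuous_onI[OF c])
  have "(LINT z|arc_measure. f z) = (LINT t|uniform_measure lborel {0..<2*pi}. f (cis t))"
    unfolding arc_measure_def
    by (rule integral_distr[OF cis_measurable circle_measurable[OF refl f]])
  also have "uniform_measure lborel {0..<2*pi} = density lborel (\<lambda>t. ennreal (indicator {0..<2*pi} t / (2*pi)))"
    unfolding uniform_measure_def
    by (intro density_cong) (auto simp: divide_ennreal ennreal_indicator[symmetric] split: split_indicator)
  also have "(LINT t|density lborel (\<lambda>t. ennreal (indicator {0..<2*pi} t / (2*pi))). f (cis t))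
     = (LINT t|lborel. (indicator {0..<2*pi} t / (2*pi)) *\<^sub>R f (cis t))"
    by (intro integral_density borel_measurable_continuous_onI c) auto
  \<comment> \<open>Closing the interval at \<open>2*pi\<close> adds only a null set.\<close>
  also have "\<dots> = (LINT t|lborel. (indicator {0..2*pi} t *\<^sub>R f (cis t)) /\<^sub>R (2*pi))"
  proof (rule integral_cong_AE)
    have "AE t in lborel. t \<noteq> 2*pi" by (rule AE_lborel_singleton)
    then show "AE t in lborel. (indicator {0..<2*pi} t / (2*pi)) *\<^sub>R f (cis t)
       = (indicator {0..2*pi} t *\<^sub>R f (cis t)) /\<^sub>R (2*pi)"
      by eventually_elim (auto split: split_indicator simp: inverse_eq_divide)
  qed measurable
  also have "\<dots> = (LINT t:{0..2*pi}|lborel. f (cis t)) /\<^sub>R (2*pi)"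
    by (simp only: set_lebesgue_integral_def Bochner_Integration.integral_scaleR_right)
  also have "(LINT t:{0..2*pi}|lborel. f (cis t)) = integral {0..2*pi} (\<lambda>t. f (cis t))"
    by (rule set_borel_integral_eq_integral(2)[OF borel_integrable_atLeastAtMost'[OF c]])
  finally show ?thesis .
qed

text \<open>The inner product of \<open>z ^ k\<close> with \<open>P\<close>. Its vanishing for all
  \<open>k < n\<close> is orthogonality to every polynomial of degree below \<open>n\<close>; see
  \<open>is_monic_OP_iff_moment\<close>.\<close>

definition moment :: "complex measure \<Rightarrow> nat \<Rightarrow> complex poly \<Rightarrow> complex" where
  "moment N k P = (LINT z|N. cnj (z ^ k) * poly P z)"

lemma cnj_mult_circle: "z \<in> unit_circle \<Longrightarrow> cnj z * z = 1"
  by (simp add: mult.commute flip: complex_norm_square)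

context
  fixes N :: "complex measure"
  assumes N: "finite_measure N" "sets N = sets circle_borel"
begin

lemma poly_mult_integrable: "integrable N (\<lambda>z. cnj (z ^ k) * poly P z)"
  by (intro circle_integrable N continuous_intros)

lemma moment_diff: "moment N k (P - Q) = moment N k P - moment N k Q"
  unfolding moment_def using poly_mult_integrable by (simp add: right_diff_distrib)

lemma moment_add: "moment N k (P + Q) = moment N k P + moment N k Q"
  unfolding moment_def using poly_mult_integrable by (simp add: distrib_left)

lemma moment_smult: "moment N k (smult c P) = c * moment N k P"
  unfolding moment_def by (simp add: mult.left_commute)

text \<open>Multiplication by \<open>z\<close> preserves inner products on the circle, since
  \<open>cnj z\<close> times \<open>z\<close> is 1 there.\<close>

lemma moment_pCons: "moment N (Suc k) (pCons 0 P) = moment N k P"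
  unfolding moment_def
proof (rule Bochner_Integration.integral_cong[OF refl])
  fix z assume "z \<in> space N"
  then have "cnj z * z = 1" using cnj_mult_circle space_circle[OF N(2)] by blast
  then have "cnj (z ^ k) * ((cnj z * z) * poly P z) = cnj (z ^ k) * poly P z" by simp
  then show "cnj (z ^ Suc k) * poly (pCons 0 P) z = cnj (z ^ k) * poly P z"
    by (simp add: mult_ac)
qed

lemma integral_cnj_poly:
  "(LINT z|N. cnj (poly Q z) * poly P z) = (\<Sum>i\<le>degree Q. cnj (coeff Q i) * moment N i P)"
proof -
  have "(LINT z|N. cnj (poly Q z) * poly P z)
     = (LINT z|N. (\<Sum>i\<le>degree Q. cnj (coeff Q i) * (cnj (z ^ i) * poly P z)))"
    by (simp add: poly_altdef[of Q] sum_distrib_right mult.assoc)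
  also have "\<dots> = (\<Sum>i\<le>degree Q. cnj (coeff Q i) * moment N i P)"
    unfolding moment_def using poly_mult_integrable by simp
  finally show ?thesis .
qed

lemma is_monic_OP_iff_moment:
  "is_monic_OP N n P \<longleftrightarrow> degree P = n \<and> lead_coeff P = 1 \<and> (\<forall>k<n. moment N k P = 0)"
proof -
  have "(\<forall>Q. degree Q < n \<longrightarrow> (LINT z|N. cnj (poly Q z) * poly P z) = 0) \<longleftrightarrow> (\<forall>k<n. moment N k P = 0)"
  proof (intro iffI allI impI)
    fix k assume *: "\<forall>Q. degree Q < n \<longrightarrow> (LINT z|N. cnj (poly Q z) * poly P z) = 0" "k < n"
    have "degree (monom (1::complex) k) < n" using *(2) by (simp add: degree_monom_eq)
    with *(1) show "moment N k P = 0" by (fastforce simp: moment_def poly_monom)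
  next
    fix Q :: "complex poly" assume "\<forall>k<n. moment N k P = 0" "degree Q < n"
    then show "(LINT z|N. cnj (poly Q z) * poly P z) = 0"
      unfolding integral_cnj_poly by (intro sum.neutral) auto
  qed
  then show ?thesis unfolding is_monic_OP_def by blast
qed

end

context szego_recursion
begin

text \<open>By \<open>\<Phi>s_circle\<close>, the integrand is on the circle the conjugate of
  \<open>cnj (z ^ (n - k)) \<Phi> n\<close>. So if \<open>\<Phi> n\<close> is orthogonal to all
  powers below \<open>n\<close>, then \<open>\<Phi>s n\<close> is orthogonal to
  \<open>z, ..., z ^ n\<close>.\<close>

lemma moment_\<Phi>s:
  assumes "finite_measure N" "sets N = sets circle_borel" "k \<le> n"
  shows "moment N k (\<Phi>s n) = cnj (moment N (n - k) (\<Phi> n))"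
proof -
  have "moment N k (\<Phi>s n) = (LINT z|N. cnj (cnj (z ^ (n - k)) * poly (\<Phi> n) z))"
    unfolding moment_def
  proof (rule Bochner_Integration.integral_cong[OF refl])
    fix z assume "z \<in> space N"
    then have z: "z \<in> unit_circle" using space_circle[OF assms(2)] by blast
    have "cnj (z ^ k) * z ^ n = (cnj z * z) ^ k * z ^ (n - k)"
      using assms(3) by (simp add: power_mult_distrib mult.assoc flip: power_add)
    also have "\<dots> = z ^ (n - k)" by (simp only: cnj_mult_circle[OF z]) simp
    finally have "cnj (z ^ k) * z ^ n = z ^ (n - k)" .
    then show "cnj (z ^ k) * poly (\<Phi>s n) z = cnj (cnj (z ^ (n - k)) * poly (\<Phi> n) z)"
      using \<Phi>s_circle[of z n] z by (simp add: mult.assoc[symmetric])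
  qed
  then show ?thesis by (simp only: moment_def Bochner_Integration.integral_cnj)
qed

text \<open>The squared norm of \<open>\<Phi> n\<close> for the measure that \<open>a\<close> comes
  from, as the proof of \<open>monic_OP_eq_\<Phi>\<close> shows; it also normalizes the
  Bernstein-Szego densities.\<close>

definition \<kappa> :: "nat \<Rightarrow> real" where "\<kappa> n = (\<Prod>j<n. 1 - (cmod (a j))\<^sup>2)"

lemma \<kappa>_Suc: "\<kappa> (Suc n) = \<kappa> n * (1 - (cmod (a n))\<^sup>2)" and \<kappa>_0 [simp]: "\<kappa> 0 = 1"
  by (simp_all add: \<kappa>_def)

end

text \<open>One induction proves orthogonality, the norm formula and \<open>|a j| < 1\<close>
  together. Subtracting a multiple of \<open>\<Phi>s n\<close> from \<open>z \<Phi> n\<close> makes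
  it orthogonal to 1 without spoiling orthogonality to \<open>z, ..., z ^ n\<close>, and uniqueness
  identifies the result with the next orthogonal polynomial.\<close>

theorem monic_OP_eq_\<Phi>:
  assumes M: "prob_space M" "sets M = sets circle_borel" "nontrivial_measure M"
  shows "verblunsky_seq (verblunsky M)" and "monic_OP M n = szego_recursion.\<Phi> (verblunsky M) n"
proof -
  define a where "a = verblunsky M"
  interpret szego_recursion a .
  interpret prob_space M by fact
  note fin = finite_measure_axioms
  note mlin = moment_diff[OF fin M(2)] moment_smult[OF fin M(2)] moment_pCons[OF fin M(2)]
  have monic_eq: "monic_OP M n = P" if "is_monic_OP M n P" for n P
    unfolding monic_OP_def using ex1_monic_OP[OF M] that by (rule the1_equality)
  \<comment> \<open>Only the leading coefficient of \<open>P\<close> survives when its squared norm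
    is expanded, so the top moment is this norm and hence real and positive.\<close>
  have norm_pos: "moment M n P \<noteq> 0 \<and> Im (moment M n P) = 0 \<and> 0 \<le> Re (moment M n P)" if P: "is_monic_OP M n P" for n P
  proof -
    have "(LINT z|M. cnj (poly P z) * poly P z) = (\<Sum>i\<le>n. cnj (coeff P i) * moment M i P)"
      using integral_cnj_poly[OF fin M(2), of P P] P by (simp add: is_monic_OP_def)
    also have "\<dots> = (\<Sum>i\<in>{n}. cnj (coeff P i) * moment M i P)"
      using P unfolding is_monic_OP_iff_moment[OF fin M(2)] by (intro sum.mono_neutral_right) auto
    also have "\<dots> = moment M n P" using P by (auto simp: is_monic_OP_def)
    finally have e: "moment M n P = (LINT z|M. cnj (poly P z) * poly P z)" ..
    have "P \<noteq> 0" using P by (auto simp: is_monic_OP_def)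
    then have "moment M n P \<noteq> 0" unfolding e using poly_norm_zero[OF M] by blast
    moreover have "(LINT z|M. cnj (poly P z) * poly P z) = of_real (LINT z|M. (cmod (poly P z))\<^sup>2)"
      unfolding integral_complex_of_real[symmetric] complex_norm_square by (simp add: mult.commute)
    then have "Im (moment M n P) = 0 \<and> 0 \<le> Re (moment M n P)" unfolding e by simp
    ultimately show ?thesis by blast
  qed
  have main: "is_monic_OP M n (\<Phi> n) \<and> moment M n (\<Phi> n) = \<kappa> n \<and> (\<forall>j<n. cmod (a j) < 1)" for n
  proof (induction n)
    case 0
    show ?case using prob_space
      by (simp add: is_monic_OP_iff_moment[OF fin M(2)] moment_def)
  next
    case (Suc n)
    then have orth: "\<And>k. k < n \<Longrightarrow> moment M k (\<Phi> n) = 0" and mom: "moment M n (\<Phi> n) = \<kappa> n"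
      unfolding is_monic_OP_iff_moment[OF fin M(2)] by blast+
    have \<kappa>0: "\<kappa> n \<noteq> 0" "0 \<le> \<kappa> n" using norm_pos[of n "\<Phi> n"] Suc mom by auto
    \<comment> \<open>The zeroth moment of \<open>\<Phi>s n\<close> is \<open>\<kappa> n\<close>, so
      this choice of \<open>c\<close> makes the zeroth moment of \<open>P\<close> vanish.\<close>
    define c where "c = moment M 0 (pCons 0 (\<Phi> n)) / \<kappa> n"
    define P where "P = pCons 0 (\<Phi> n) - smult c (\<Phi>s n)"
    have ms: "moment M k (\<Phi>s n) = cnj (moment M (n - k) (\<Phi> n))" if "k \<le> n" for k
      using moment_\<Phi>s[OF fin M(2) that] .
    have "moment M k P = 0" if k: "k < Suc n" for k
    proof (cases k)
      case 0
      then show ?thesis using ms[of 0] \<kappa>0 mom by (simp add: P_def mlin c_def)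
    next
      case (Suc k')
      then show ?thesis using ms[of k] k orth[of k'] orth[of "n - k"] by (simp add: P_def mlin)
    qed
    moreover have "degree P = Suc n \<and> lead_coeff P = 1"
    proof -
      have nz: "\<Phi> n \<noteq> 0" using lead_coeff_\<Phi>[of n] by auto
      have s: "degree (smult c (\<Phi>s n)) < degree (pCons 0 (\<Phi> n))"
        using degree_smult_le[of c "\<Phi>s n"] degree_\<Phi>s[of n] degree_\<Phi>[of n] nz by simp
      have d: "degree P = Suc n"
        using degree_add_eq_left[of "- smult c (\<Phi>s n)" "pCons 0 (\<Phi> n)"] s nz degree_\<Phi>[of n]
        by (simp add: P_def)
      have "coeff (\<Phi>s n) (Suc n) = 0" using degree_\<Phi>s[of n] by (intro coeff_eq_0) simp
      then have "lead_coeff P = 1" unfolding d using lead_coeff_\<Phi>[of n] degree_\<Phi>[of n] by (simp add: P_def)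
      with d show ?thesis by blast
    qed
    ultimately have Pm: "is_monic_OP M (Suc n) P"
      unfolding is_monic_OP_iff_moment[OF fin M(2)] by blast
    \<comment> \<open>\<open>P\<close> takes the value \<open>- c\<close> at 0, because
      \<open>\<Phi>s n\<close> is 1 there.\<close>
    have "a n = cnj c" unfolding a_def verblunsky_def monic_eq[OF Pm] by (simp add: P_def)
    then have P: "P = \<Phi> (Suc n)" by (simp add: P_def \<Phi>_Suc)
    have "moment M (Suc n) (\<Phi> (Suc n)) = \<kappa> n - c * moment M (Suc n) (\<Phi>s n)"
      unfolding P[symmetric] P_def by (simp add: mlin mom)
    \<comment> \<open>The index \<open>Suc n\<close> lies outside the range of
      \<open>moment_\<Phi>s\<close>; the same reflection now leaves a factor \<open>cnj z\<close>,
      which turns \<open>\<Phi> n\<close> into \<open>z \<Phi> n\<close> under the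
      conjugation.\<close>
    also have "moment M (Suc n) (\<Phi>s n) = cnj (moment M 0 (pCons 0 (\<Phi> n)))"
    proof -
      have "moment M (Suc n) (\<Phi>s n) = (LINT z|M. cnj (cnj (z ^ 0) * poly (pCons 0 (\<Phi> n)) z))"
        unfolding moment_def
      proof (rule Bochner_Integration.integral_cong[OF refl])
        fix z assume "z \<in> space M"
        then have z: "z \<in> unit_circle" using space_circle[OF M(2)] by blast
        have "cnj (z ^ n) * z ^ n = (cnj z * z) ^ n" by (simp add: power_mult_distrib)
        then have zn: "cnj (z ^ n) * z ^ n = 1" by (simp only: cnj_mult_circle[OF z]) simp
        have "cnj (z ^ Suc n) * poly (\<Phi>s n) z = cnj z * (cnj (z ^ n) * z ^ n) * cnj (poly (\<Phi> n) z)"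
          using \<Phi>s_circle[of z n] z by (simp add: mult_ac)
        also have "\<dots> = cnj z * cnj (poly (\<Phi> n) z)" by (simp only: zn) simp
        finally show "cnj (z ^ Suc n) * poly (\<Phi>s n) z = cnj (cnj (z ^ 0) * poly (pCons 0 (\<Phi> n)) z)"
          by simp
      qed
      then show ?thesis by (simp only: moment_def Bochner_Integration.integral_cnj)
    qed
    also have "moment M 0 (pCons 0 (\<Phi> n)) = c * \<kappa> n" using \<kappa>0 by (simp add: c_def)
    also have "\<kappa> n - c * cnj (c * \<kappa> n) = \<kappa> n * (1 - c * cnj c)" by (simp add: algebra_simps)
    also have "c * cnj c = of_real ((cmod (a n))\<^sup>2)"
      unfolding \<open>a n = cnj c\<close> complex_mod_cnj by (rule complex_norm_square[symmetric])
    finally have k: "moment M (Suc n) (\<Phi> (Suc n)) = \<kappa> (Suc n)" by (simp add: \<kappa>_Suc)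
    \<comment> \<open>The new squared norm is positive and carries the factor
      \<open>1 - |a n|^2\<close>, which forces \<open>|a n| < 1\<close>.\<close>
    have "\<kappa> (Suc n) \<noteq> 0" "0 \<le> \<kappa> (Suc n)" using norm_pos[OF Pm] unfolding P k by simp_all
    then have "0 < \<kappa> n * (1 - (cmod (a n))\<^sup>2)" unfolding \<kappa>_Suc by linarith
    then have "(cmod (a n))\<^sup>2 < 1" using \<kappa>0 by (simp add: zero_less_mult_iff)
    then have "cmod (a n) < 1" by (simp add: power_less_one_iff abs_square_less_1)
    then show ?case using Pm P k Suc less_Suc_eq by auto
  qed
  show "verblunsky_seq (verblunsky M)"
    using main unfolding verblunsky_seq_def a_def by blast
  show "monic_OP M n = szego_recursion.\<Phi> (verblunsky M) n"
    using main monic_eq unfolding a_def by blast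
qed

section \<open>Bernstein-Szego approximation\<close>

text \<open>The mean value property for a function vanishing at the origin. It is the oscillatory
  bound with constant \<open>F = 1\<close>, whose derivative is 0.\<close>

lemma arc_integral_holomorphic:
  assumes b: "b holomorphic_on ball 0 R" and R: "R > 1" and g: "g > 0"
  shows "(LINT z|arc_measure. z ^ g * b z) = 0"
proof -
  have cb: "continuous_on (cball 0 1) b"
    by (rule continuous_on_subset[OF holomorphic_on_imp_continuous_on[OF b]]) (use R in auto)
  then have "bounded (b ` cball 0 1)"
    by (intro compact_imp_bounded compact_continuous_image compact_cball)
  then obtain B where "\<forall>y\<in>b ` cball 0 1. cmod y \<le> B"
    unfolding bounded_iff by blast
  then have B: "\<And>z. cmod z \<le> 1 \<Longrightarrow> cmod (b z) \<le> B" by simp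
  have cc: "continuous_on unit_circle (\<lambda>z. z ^ g * b z)"
    by (intro continuous_intros continuous_on_subset[OF cb]) auto
  have "cmod (integral {0..2*pi} (\<lambda>t. of_real 1 * (cis t ^ g * b (cis t))))
     \<le> B / g * integral {0..2*pi} (\<lambda>t. \<bar>0\<bar>)"
    by (rule oscillatory_integral_bound[OF b R B g, of "\<lambda>_. 1" "\<lambda>_. 0"]) auto
  then show ?thesis by (simp add: arc_integral[OF cc])
qed

context verblunsky_seq
begin

lemma one_minus_pos: "0 < 1 - (cmod (a n))\<^sup>2" "1 - (cmod (a n))\<^sup>2 \<le> 1"
  using a_less[of n] by (simp_all add: abs_square_less_1)

lemma \<kappa>_pos: "0 < \<kappa> n"
  unfolding \<kappa>_def using one_minus_pos by (intro prod_pos) auto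

lemma \<kappa>_le_1: "\<kappa> n \<le> 1"
  unfolding \<kappa>_def using one_minus_pos by (intro prod_le_1) (auto intro: less_imp_le)

text \<open>On the circle \<open>|\<Phi>s n| = |\<Phi> n|\<close>, so this is the reciprocal squared
  modulus of the normalized orthogonal polynomial.\<close>

definition bs_weight :: "nat \<Rightarrow> complex \<Rightarrow> real" where
  "bs_weight n z = \<kappa> n / (cmod (poly (\<Phi>s n) z))\<^sup>2"

definition bs_measure :: "nat \<Rightarrow> complex measure" where
  "bs_measure n = density arc_measure (\<lambda>z. ennreal (bs_weight n z))"

lemma bs_weight_continuous: "continuous_on unit_circle (bs_weight n)"
  unfolding bs_weight_def[abs_def] using \<Phi>s_nonzero by (intro continuous_intros) auto

lemma bs_weight_pos: "z \<in> unit_circle \<Longrightarrow> 0 < bs_weight n z"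
  unfolding bs_weight_def using \<Phi>s_nonzero[of z n] \<kappa>_pos by simp

lemma bs_weight_nonneg: "0 \<le> bs_weight n z"
  unfolding bs_weight_def using \<kappa>_pos[of n] by simp

lemma sets_bs [simp]: "sets (bs_measure n) = sets circle_borel"
  by (simp add: bs_measure_def)

lemma finite_bs: "finite_measure (bs_measure n)"
proof (rule finite_measureI)
  have int: "integrable arc_measure (bs_weight n)"
    by (intro circle_integrable finite_arc bs_weight_continuous) simp
  have [measurable]: "bs_weight n \<in> borel_measurable arc_measure" using int by simp
  have "emeasure (bs_measure n) (space (bs_measure n)) = (\<integral>\<^sup>+z. ennreal (bs_weight n z) \<partial>arc_measure)"
    unfolding bs_measure_def space_density by (subst emeasure_density) (auto intro!: nn_integral_cong simp del: sets_arc)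
  also have "\<dots> = ennreal (LINT z|arc_measure. bs_weight n z)"
    by (rule nn_integral_eq_integral[OF int]) (simp add: bs_weight_nonneg)
  finally show "emeasure (bs_measure n) (space (bs_measure n)) \<noteq> \<infinity>" by simp
qed

lemma bs_integral:
  fixes f :: "complex \<Rightarrow> 'b::{banach, second_countable_topology}"
  assumes f: "continuous_on unit_circle f"
  shows "(LINT z|bs_measure n. f z) = (LINT z|arc_measure. bs_weight n z *\<^sub>R f z)"
  unfolding bs_measure_def
  by (rule integral_density) (auto intro!: circle_measurable f bs_weight_continuous bs_weight_nonneg)

lemma \<Phi>_circle:
  assumes z: "z \<in> unit_circle"
  shows "poly (\<Phi> n) z = z ^ n * cnj (poly (\<Phi>s n) z)"
proof -
  have "z ^ n * cnj (poly (\<Phi>s n) z) = (cnj z * z) ^ n * poly (\<Phi> n) z"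
    using z \<Phi>s_circle[of z n] by (simp add: power_mult_distrib)
  then show ?thesis by (simp only: cnj_mult_circle[OF z]) simp
qed

text \<open>On the circle one factor of \<open>|\<Phi>s n|^2\<close> cancels against
  \<open>\<Phi> n\<close>. What remains is \<open>\<kappa> n z ^ (n - k) / \<Phi>s n\<close>,
  analytic past the closed disc, and its mean is its value at 0.\<close>

lemma moment_bs_top:
  assumes k: "k \<le> n"
  shows "moment (bs_measure n) k (\<Phi> n) = (if k = n then of_real (\<kappa> n) else 0)"
proof -
  let ?p = "\<Phi>s n"
  obtain R where R: "R > 1" "\<And>z. z \<in> ball 0 R \<Longrightarrow> poly ?p z \<noteq> 0"
    using poly_nonzero_larger_ball[of ?p] \<Phi>s_nonzero by blast
  have nz: "poly ?p z \<noteq> 0" if "z \<in> unit_circle" for z using that \<Phi>s_nonzero by auto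
  have sp: "space arc_measure = unit_circle" by (rule space_circle) simp
  have "moment (bs_measure n) k (\<Phi> n)
     = (LINT z|arc_measure. bs_weight n z *\<^sub>R (cnj (z ^ k) * poly (\<Phi> n) z))"
    unfolding moment_def by (intro bs_integral continuous_intros)
  also have "\<dots> = (LINT z|arc_measure. of_real (\<kappa> n) * (z ^ (n - k) * inverse (poly ?p z)))"
  proof (rule Bochner_Integration.integral_cong[OF refl])
    fix z assume "z \<in> space arc_measure"
    then have z: "z \<in> unit_circle" by (simp add: sp)
    have "cnj (z ^ k) * z ^ n = (cnj z * z) ^ k * z ^ (n - k)"
      using k by (simp add: power_mult_distrib mult.assoc flip: power_add)
    then have zk: "cnj (z ^ k) * z ^ n = z ^ (n - k)" by (simp only: cnj_mult_circle[OF z]) simp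
    have pp: "complex_of_real ((cmod (poly ?p z))\<^sup>2) = poly ?p z * cnj (poly ?p z)"
      by (rule complex_norm_square)
    have "bs_weight n z *\<^sub>R (cnj (z ^ k) * poly (\<Phi> n) z)
      = of_real (\<kappa> n) / (poly ?p z * cnj (poly ?p z)) * ((cnj (z ^ k) * z ^ n) * cnj (poly ?p z))"
      unfolding bs_weight_def scaleR_conv_of_real of_real_divide pp \<Phi>_circle[OF z] by (simp add: mult_ac)
    also have "\<dots> = of_real (\<kappa> n) * (z ^ (n - k) * inverse (poly ?p z))"
      unfolding zk using nz[OF z] by (simp add: field_simps)
    finally show "bs_weight n z *\<^sub>R (cnj (z ^ k) * poly (\<Phi> n) z)
      = of_real (\<kappa> n) * (z ^ (n - k) * inverse (poly ?p z))" .
  qed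
  also have "\<dots> = of_real (\<kappa> n) * (LINT z|arc_measure. z ^ (n - k) * inverse (poly ?p z))" by simp
  also have "(LINT z|arc_measure. z ^ (n - k) * inverse (poly ?p z)) = (if k = n then 1 else 0)"
  proof (cases "k = n")
    case False
    have "(\<lambda>z. inverse (poly ?p z)) holomorphic_on ball 0 R"
      using R by (intro holomorphic_intros) auto
    from arc_integral_holomorphic[OF this R(1), of "n - k"] False k show ?thesis by simp
  next
    case True
    \<comment> \<open>Writing \<open>\<Phi>s n\<close> as \<open>1 - z Q\<close> exhibits its
      reciprocal as 1 plus an analytic function vanishing at 0.\<close>
    obtain c Q where Q: "1 - ?p = pCons c Q" by (cases "1 - ?p")
    have "poly (1 - ?p) 0 = 0" by simp
    then have "c = 0" unfolding Q by simp
    then have pQ: "poly ?p z = 1 - z * poly Q z" for z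
      using arg_cong[OF Q, of "\<lambda>p. poly p z"] by (simp add: algebra_simps)
    let ?h = "\<lambda>z. z ^ 1 * (poly Q z * inverse (poly ?p z))"
    have "(LINT z|arc_measure. z ^ (n - k) * inverse (poly ?p z)) = (LINT z|arc_measure. 1 + ?h z)"
    proof (rule Bochner_Integration.integral_cong[OF refl])
      fix z assume "z \<in> space arc_measure"
      then have z: "z \<in> unit_circle" by (simp add: sp)
      have "inverse (poly ?p z) = (poly ?p z + z * poly Q z) * inverse (poly ?p z)" by (simp add: pQ)
      also have "\<dots> = 1 + ?h z" using nz[OF z] by (simp add: field_simps)
      finally show "z ^ (n - k) * inverse (poly ?p z) = 1 + ?h z" using True by simp
    qed
    also have "\<dots> = (LINT z|arc_measure. 1) + (LINT z|arc_measure. ?h z)"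
      by (intro Bochner_Integration.integral_add circle_integrable finite_arc continuous_intros)
        (use nz in auto)
    also have "(LINT z|arc_measure. ?h z) = 0"
      by (rule arc_integral_holomorphic[OF _ R(1)]) (use R in \<open>auto intro!: holomorphic_intros\<close>)
    also have "(LINT z|arc_measure. (1::complex)) = 1"
      by (simp add: prob_space.prob_space[OF prob_space_arc_measure])
    finally show ?thesis using True by simp
  qed
  finally show ?thesis by simp
qed

text \<open>Up to index \<open>n\<close> the \<open>\<Phi> j\<close> are orthogonal polynomials also
  for the \<open>n\<close>-th Bernstein-Szego measure. The induction descends from
  \<open>j = n\<close>, running the recursion backwards.\<close>

lemma moment_bs:
  assumes "j \<le> n"
  shows "(\<forall>k<j. moment (bs_measure n) k (\<Phi> j) = 0) \<and> moment (bs_measure n) j (\<Phi> j) = of_real (\<kappa> j)"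
  using assms
proof (induction rule: inc_induct)
  case base
  show ?case by (simp add: moment_bs_top)
next
  case (step j)
  let ?m = "moment (bs_measure n)"
  note mlin = moment_add[OF finite_bs sets_bs] moment_smult[OF finite_bs sets_bs] moment_pCons[OF finite_bs sets_bs]
  \<comment> \<open>The inverse recursion: \<open>z \<Phi> j\<close>, times the determinant, in
    terms of the polynomials of index \<open>Suc j\<close>.\<close>
  have e: "smult (of_real (1 - (cmod (a j))\<^sup>2)) (pCons 0 (\<Phi> j)) = \<Phi> (Suc j) + smult (cnj (a j)) (\<Phi>s (Suc j))"
    unfolding of_real_diff complex_norm_square
    by (simp add: \<Phi>_Suc \<Phi>s_Suc smult_diff_right smult_diff_left mult.commute)
  have m: "of_real (1 - (cmod (a j))\<^sup>2) * ?m k (\<Phi> j) = ?m (Suc k) (\<Phi> (Suc j)) + cnj (a j) * cnj (?m (j - k) (\<Phi> (Suc j)))"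
    if "k \<le> j" for k
  proof -
    have "of_real (1 - (cmod (a j))\<^sup>2) * ?m k (\<Phi> j) = ?m (Suc k) (smult (of_real (1 - (cmod (a j))\<^sup>2)) (pCons 0 (\<Phi> j)))"
      by (simp add: mlin)
    also have "\<dots> = ?m (Suc k) (\<Phi> (Suc j)) + cnj (a j) * ?m (Suc k) (\<Phi>s (Suc j))"
      unfolding e by (simp add: mlin)
    finally show ?thesis using moment_\<Phi>s[OF finite_bs sets_bs, of "Suc k" "Suc j"] that by simp
  qed
  have nz: "complex_of_real (1 - (cmod (a j))\<^sup>2) \<noteq> 0"
    using one_minus_pos(1)[of j] by (simp only: of_real_eq_0_iff)
  have IH: "\<And>k. k < Suc j \<Longrightarrow> ?m k (\<Phi> (Suc j)) = 0" "?m (Suc j) (\<Phi> (Suc j)) = of_real (\<kappa> (Suc j))"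
    using step.IH by blast+
  have "?m k (\<Phi> j) = 0" if "k < j" for k
    using m[of k] IH(1)[of "Suc k"] IH(1)[of "j - k"] that nz by simp
  moreover have "of_real (1 - (cmod (a j))\<^sup>2) * ?m j (\<Phi> j) = of_real (1 - (cmod (a j))\<^sup>2) * of_real (\<kappa> j)"
    using m[of j] IH(1)[of 0] IH(2) by (simp add: \<kappa>_Suc mult.commute)
  then have "?m j (\<Phi> j) = of_real (\<kappa> j)" using nz by simp
  ultimately show ?case by blast
qed

text \<open>\<open>\<Phi> 0, ..., \<Phi> n\<close> form a basis of the polynomials of degree at most
  \<open>n\<close>; subtracting the multiple that matches the leading coefficient lowers the
  degree.\<close>

lemma moment_eqI:
  assumes N: "finite_measure N" "sets N = sets circle_borel"
    and N': "finite_measure N'" "sets N' = sets circle_borel"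
    and eq: "\<And>j. j \<le> n \<Longrightarrow> moment N 0 (\<Phi> j) = moment N' 0 (\<Phi> j)"
  shows "degree P \<le> n \<Longrightarrow> moment N 0 P = moment N' 0 P"
proof (induction "degree P" arbitrary: P rule: less_induct)
  case less
  define c where "c = lead_coeff P"
  define Q where "Q = P - smult c (\<Phi> (degree P))"
  have P: "P = Q + smult c (\<Phi> (degree P))" by (simp add: Q_def)
  have "moment N 0 Q = moment N' 0 Q"
  proof (cases "degree P")
    case 0
    then obtain b where "P = [:b:]" by (rule degree_eq_zeroE)
    then have "Q = 0" by (simp add: Q_def c_def)
    then show ?thesis by (simp add: moment_def)
  next
    case (Suc d)
    have "degree Q \<le> Suc d" unfolding Q_def using degree_smult_le[of c "\<Phi> (degree P)"] degree_\<Phi>[of "degree P"] Suc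
      by (intro degree_diff_le) auto
    moreover have "coeff Q (Suc d) = 0"
      using lead_coeff_\<Phi>[of "degree P"] degree_\<Phi>[of "degree P"] Suc by (simp add: Q_def c_def)
    ultimately have "degree Q < Suc d" by (rule degree_drop)
    then show ?thesis using less Suc by simp
  qed
  then show ?case
    using eq[OF less.prems] by (subst (1 2) P) (simp add: moment_add[OF N] moment_add[OF N'] moment_smult[OF N] moment_smult[OF N'])
qed

end

section \<open>Trigonometric polynomials and weak convergence of the Bernstein-Szego
  measures\<close>

lemma trig_product:
  "\<exists>R. \<forall>z\<in>unit_circle. Re (poly P z * cnj (poly Q z)) = Re (poly R z)"
proof (induction P arbitrary: Q rule: pCons_induct)
  case 0
  show ?case by (intro exI[of _ 0]) simp
next
  case (pCons p P)
  obtain q Q' where Q: "Q = pCons q Q'" by (cases Q)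
  obtain R where R: "\<And>z. z \<in> unit_circle \<Longrightarrow> Re (poly P z * cnj (poly Q' z)) = Re (poly R z)"
    using pCons.IH[of Q'] by blast
  show ?case
  proof (intro exI ballI)
    fix z assume z: "z \<in> unit_circle"
    \<comment> \<open>The last product drops in degree because \<open>cnj z\<close> times
      \<open>z\<close> is 1; the mixed term with a conjugated polynomial is replaced by its
      conjugate, which has the same real part.\<close>
    have "poly (pCons p P) z * cnj (poly Q z)
      = p * cnj q + p * cnj (z * poly Q' z) + cnj q * (z * poly P z) + (cnj z * z) * (poly P z * cnj (poly Q' z))"
      by (simp add: Q algebra_simps)
    also have "Re \<dots> = Re (p * cnj q) + Re (p * cnj (z * poly Q' z)) + Re (cnj q * (z * poly P z)) + Re (poly R z)"
      by (simp only: cnj_mult_circle[OF z] mult_1_left R[OF z] plus_complex.sel)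
    also have "Re (p * cnj (z * poly Q' z)) = Re (cnj p * (z * poly Q' z))"
      by (metis complex_cnj complex_cnj_cnj complex_cnj_mult cnj.sel(1))
    also have "Re (p * cnj q) + Re (cnj p * (z * poly Q' z)) + Re (cnj q * (z * poly P z)) + Re (poly R z)
       = Re (poly ([:p * cnj q:] + pCons 0 (smult (cnj p) Q') + pCons 0 (smult (cnj q) P) + R) z)"
      by (simp add: algebra_simps)
    finally show "Re (poly (pCons p P) z * cnj (poly Q z))
       = Re (poly ([:p * cnj q:] + pCons 0 (smult (cnj p) Q') + pCons 0 (smult (cnj q) P) + R) z)" .
  qed
qed

text \<open>Real parts of polynomials are closed under products on the circle:
  \<open>Re p Re q\<close> is half of \<open>Re (p q) + Re (p cnj q)\<close>, and
  \<open>trig_product\<close> handles the second term. Stone-Weierstrass thus makes such real parts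
  dense.\<close>

lemma real_polynomial_function_trig:
  fixes f :: "complex \<Rightarrow> real"
  assumes "real_polynomial_function f"
  shows "\<exists>R. \<forall>z\<in>unit_circle. f z = Re (poly R z)"
  using assms
proof (induction rule: real_polynomial_function.induct)
  case (linear f)
  interpret bounded_linear f by fact
  have "f z = Re (poly [:0, Complex (f 1) (- f \<i>):] z)" for z
  proof -
    have "z = Re z *\<^sub>R 1 + Im z *\<^sub>R \<i>" by (simp add: complex_eq_iff)
    then have "f z = Re z * f 1 + Im z * f \<i>" by (metis add scale real_scaleR_def)
    then show ?thesis by simp
  qed
  then show ?case by blast
next
  case (const c)
  show ?case by (intro exI[of _ "[:of_real c:]"]) simp
next
  case (add f g)
  then obtain P Q where "\<forall>z\<in>unit_circle. f z = Re (poly P z)" "\<forall>z\<in>unit_circle. g z = Re (poly Q z)" by blast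
  then show ?case by (intro exI[of _ "P + Q"]) simp
next
  case (mult f g)
  then obtain P Q where P: "\<And>z. z\<in>unit_circle \<Longrightarrow> f z = Re (poly P z)"
    and Q: "\<And>z. z\<in>unit_circle \<Longrightarrow> g z = Re (poly Q z)" by blast
  obtain R1 where R1: "\<And>z. z\<in>unit_circle \<Longrightarrow> Re (poly P z * cnj (poly Q z)) = Re (poly R1 z)"
    using trig_product[of P Q] by blast
  have "f z * g z = Re (poly (smult (1/2) (P * Q + R1)) z)" if "z \<in> unit_circle" for z
    unfolding P[OF that] Q[OF that] using R1[OF that] by (simp add: field_simps)
  then show ?case by blast
qed

context verblunsky_seq
begin

text \<open>Once \<open>n\<close> reaches the degree of \<open>P\<close>, both measures give
  \<open>P\<close> the same integral by \<open>moment_eqI\<close>. Uniform approximation of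
  \<open>g\<close> by real parts of polynomials does the rest, as all measures have mass 1.\<close>

lemma bs_integral_tendsto:
  fixes g :: "complex \<Rightarrow> real"
  assumes M: "finite_measure M" "sets M = sets circle_borel"
    and mom: "\<And>j. moment M 0 (\<Phi> j) = (if j = 0 then 1 else 0)"
    and g: "continuous_on unit_circle g"
  shows "(\<lambda>n. LINT z|arc_measure. bs_weight n z * g z) \<longlonglongrightarrow> (LINT z|M. g z)"
proof -
  have mom_bs: "moment (bs_measure n) 0 (\<Phi> j) = (if j = 0 then 1 else 0)" if "j \<le> n" for j n
    using moment_bs[OF that] by auto
  have poly_eq: "(LINT z|M. poly P z) = (LINT z|bs_measure n. poly P z)" if "degree P \<le> n" for P n
    using moment_eqI[OF M finite_bs sets_bs, of n n P] mom mom_bs that by (simp add: moment_def)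
  have one: "measure (bs_measure n) (space (bs_measure n)) = 1" "measure M (space M) = 1" for n
    using mom_bs[of 0 n] mom[of 0] by (simp_all add: moment_def scaleR_conv_of_real)
  have approx: "\<bar>(LINT z|N. g z) - (LINT z|N. Re (poly P z))\<bar> \<le> e"
    if N: "finite_measure N" "sets N = sets circle_borel" "measure N (space N) = 1"
      and P: "\<And>z. z \<in> unit_circle \<Longrightarrow> \<bar>g z - Re (poly P z)\<bar> < e" for N P e
  proof -
    interpret finite_measure N by fact
    have i: "integrable N g" "integrable N (\<lambda>z. Re (poly P z))"
      by (intro circle_integrable N g continuous_intros)+
    have "(LINT z|N. g z) - (LINT z|N. Re (poly P z)) = (LINT z|N. g z - Re (poly P z))" using i by simp
    also have "\<bar>\<dots>\<bar> \<le> (LINT z|N. \<bar>g z - Re (poly P z)\<bar>)"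
      using integral_norm_bound[of N "\<lambda>z. g z - Re (poly P z)"] by simp
    also have "\<dots> \<le> (LINT z|N. e)"
      using i P space_circle[OF N(2)] by (intro integral_mono) (auto intro: less_imp_le)
    finally show ?thesis using N(3) by simp
  qed
  have "(\<lambda>n. LINT z|bs_measure n. g z) \<longlonglongrightarrow> (LINT z|M. g z)"
  proof (rule LIMSEQ_I)
    fix r :: real assume r: "0 < r"
    obtain f where f: "real_polynomial_function f" "\<And>z. z \<in> unit_circle \<Longrightarrow> \<bar>g z - f z\<bar> < r / 3"
      using Stone_Weierstrass_real_polynomial_function[OF compact_sphere g, of "r / 3"] r by auto
    obtain P where "\<And>z. z \<in> unit_circle \<Longrightarrow> f z = Re (poly P z)"
      using real_polynomial_function_trig[OF f(1)] by blast
    with f have P: "\<And>z. z \<in> unit_circle \<Longrightarrow> \<bar>g z - Re (poly P z)\<bar> < r / 3" by simp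
    show "\<exists>n0. \<forall>n\<ge>n0. norm ((LINT z|bs_measure n. g z) - (LINT z|M. g z)) < r"
    proof (intro exI[of _ "degree P"] allI impI)
      fix n assume n: "n \<ge> degree P"
      have "Re (LINT z|N. poly P z) = (LINT z|N. Re (poly P z))"
        if "finite_measure N" "sets N = sets circle_borel" for N
        by (rule integral_Re[symmetric]) (intro circle_integrable that continuous_intros)
      then have "(LINT z|bs_measure n. Re (poly P z)) = (LINT z|M. Re (poly P z))"
        using poly_eq[OF n] M finite_bs sets_bs by metis
      moreover have "\<bar>(LINT z|bs_measure n. g z) - (LINT z|bs_measure n. Re (poly P z))\<bar> \<le> r / 3"
        by (rule approx[OF finite_bs sets_bs one(1) P])
      moreover have "\<bar>(LINT z|M. g z) - (LINT z|M. Re (poly P z))\<bar> \<le> r / 3"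
        by (rule approx[OF M one(2) P])
      ultimately show "norm ((LINT z|bs_measure n. g z) - (LINT z|M. g z)) < r"
        using r unfolding real_norm_def by linarith
    qed
  qed
  then show ?thesis by (simp add: bs_integral[OF g])
qed

end

section \<open>Approximation of Borel functions\<close>

text \<open>Regularity is applied to the image of \<open>N\<close> on the Borel sets of the whole
  plane, because \<open>N\<close> itself lives on a subspace.\<close>

lemma circle_regular:
  assumes N: "finite_measure N" "sets N = sets circle_borel" and A: "A \<in> sets circle_borel" and e: "0 < e"
  obtains K U where "compact K" "open U" "K \<subseteq> A" "A \<subseteq> U" "measure N ((U - K) \<inter> unit_circle) < e"
proof -
  interpret finite_measure N by fact
  define N' where "N' = distr N borel (\<lambda>x. x)"
  have m: "(\<lambda>x. x) \<in> measurable N borel"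
    unfolding measurable_cong_sets[OF N(2) refl] by (rule measurable_restrict_space1) simp
  have sp: "space N = unit_circle" by (rule space_circle[OF N(2)])
  interpret N': finite_measure N' unfolding N'_def by (rule finite_measure_distr[OF m])
  have sb: "sets N' = sets borel" by (simp add: N'_def)
  have Ab: "A \<in> sets borel" using A by (simp add: sets_restrict_space_iff)
  have fin: "emeasure N' X \<noteq> \<infinity>" for X using N'.emeasure_finite by simp
  obtain K where K: "K \<subseteq> A" "compact K" "emeasure N' A < emeasure N' K + ennreal (e / 2)"
  proof -
    have "{K. K \<subseteq> A \<and> compact K} \<noteq> {}" by (auto intro: exI[of _ "{}"])
    from SUP_approx_ennreal[OF _ this inner_regular[OF sb fin Ab] fin, of "e / 2"] e that
    show ?thesis by auto
  qed
  obtain U where U: "A \<subseteq> U" "open U" "emeasure N' U < emeasure N' A + ennreal (e / 2)"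
    using INF_approx_ennreal[OF _ outer_regular[OF sb fin Ab] fin, of "e / 2"] e by auto
  have 1: "measure N' A < measure N' K + e / 2"
    using K(3) e unfolding N'.emeasure_eq_measure by (simp flip: ennreal_plus add: ennreal_less_iff)
  have 2: "measure N' U < measure N' A + e / 2"
    using U(3) e unfolding N'.emeasure_eq_measure by (simp flip: ennreal_plus add: ennreal_less_iff)
  have Ks: "K \<in> sets N'" "U \<in> sets N'" using K U sb by (auto intro: borel_compact)
  have "measure N' (U - K) = measure N' U - measure N' K"
    using Ks K U by (intro N'.finite_measure_Diff) auto
  also have "\<dots> < e" using 1 2 by simp
  also have "measure N' (U - K) = measure N ((U - K) \<inter> unit_circle)"
    using Ks sb by (simp add: N'_def measure_distr[OF m] sp vimage_def)
  finally show ?thesis using that K U by blast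
qed

text \<open>One function must serve both measures: the Urysohn function is 1 on both compact sets
  and 0 off the intersection of the open ones, so its error is confined to each of the differences
  \<open>U1 - K1\<close> and \<open>U2 - K2\<close>.\<close>

lemma indicator_approx:
  fixes e :: real
  assumes N1: "finite_measure N1" "sets N1 = sets circle_borel"
    and N2: "finite_measure N2" "sets N2 = sets circle_borel"
    and A: "A \<in> sets circle_borel" and e: "0 < e"
  shows "\<exists>h. continuous_on unit_circle h \<and> (LINT z|N1. \<bar>indicator A z - h z\<bar>) < e
     \<and> (LINT z|N2. \<bar>indicator A z - h z\<bar>) < e"
proof -
  obtain K1 U1 where 1: "compact K1" "open U1" "K1 \<subseteq> A" "A \<subseteq> U1" "measure N1 ((U1 - K1) \<inter> unit_circle) < e"
    using circle_regular[OF N1 A e] .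
  obtain K2 U2 where 2: "compact K2" "open U2" "K2 \<subseteq> A" "A \<subseteq> U2" "measure N2 ((U2 - K2) \<inter> unit_circle) < e"
    using circle_regular[OF N2 A e] .
  have "closed (K1 \<union> K2)" "closed (- (U1 \<inter> U2))" "(K1 \<union> K2) \<inter> - (U1 \<inter> U2) = {}"
    using 1 2 by (auto intro: compact_imp_closed)
  then obtain h :: "complex \<Rightarrow> real" where h: "continuous_on UNIV h" "\<And>x. h x \<in> closed_segment 1 0"
    "\<And>x. x \<in> K1 \<union> K2 \<Longrightarrow> h x = 1" "\<And>x. x \<in> - (U1 \<inter> U2) \<Longrightarrow> h x = 0"
    using Urysohn[of "K1 \<union> K2" "- (U1 \<inter> U2)" 1 0] by blast
  have h01: "0 \<le> h x \<and> h x \<le> 1" for x using h(2)[of x] by (simp add: closed_segment_eq_real_ivl)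
  have hc: "continuous_on unit_circle h" using h(1) continuous_on_subset by blast
  have bound: "(LINT z|N. \<bar>indicator A z - h z\<bar>) \<le> measure N ((U - K) \<inter> unit_circle)"
    if N: "finite_measure N" "sets N = sets circle_borel" and KU: "compact K" "open U" "K \<subseteq> A" "A \<subseteq> U"
      and h: "\<And>x. x \<in> K \<Longrightarrow> h x = 1" "\<And>x. x \<notin> U \<Longrightarrow> h x = 0" for N K U
  proof -
    interpret finite_measure N by fact
    have [measurable]: "A \<in> sets N" "h \<in> borel_measurable N"
      using A N circle_measurable[OF N(2) hc] by auto
    have "U - K \<in> sets borel" using KU by (auto intro: borel_compact)
    then have UK: "(U - K) \<inter> unit_circle \<in> sets N"
      unfolding N(2) by (auto simp: sets_restrict_space_iff)
    have "(LINT z|N. \<bar>indicator A z - h z\<bar>) \<le> (LINT z|N. indicator ((U - K) \<inter> unit_circle) z)"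
    proof (rule integral_mono)
      show "integrable N (\<lambda>z. \<bar>indicator A z - h z\<bar>)"
      proof (rule integrable_const_bound[where B = 1])
        show "AE z in N. norm \<bar>indicator A z - h z\<bar> \<le> 1"
          using h01 by (auto split: split_indicator intro!: AE_I2)
      qed measurable
      show "integrable N (indicator ((U - K) \<inter> unit_circle) :: complex \<Rightarrow> real)"
        by (rule integrable_const_bound[where B = 1]) (use UK in \<open>auto split: split_indicator\<close>)
      fix z assume "z \<in> space N"
      then have "z \<in> unit_circle" by (simp add: space_circle[OF N(2)])
      then show "\<bar>indicator A z - h z\<bar> \<le> indicator ((U - K) \<inter> unit_circle) z"
        using h01[of z] h(1)[of z] h(2)[of z] KU by (auto split: split_indicator)
    qed
    also have "\<dots> = measure N ((U - K) \<inter> unit_circle)" using UK by simp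
    finally show ?thesis .
  qed
  have "(LINT z|N1. \<bar>indicator A z - h z\<bar>) < e"
    using bound[OF N1 1(1-4)] h(3,4) 1(5) by (meson ComplI IntD1 UnI1 order_le_less_trans)
  moreover have "(LINT z|N2. \<bar>indicator A z - h z\<bar>) < e"
    using bound[OF N2 2(1-4)] h(3,4) 2(5) by (meson ComplI IntD2 UnI2 order_le_less_trans)
  ultimately show ?thesis using hc by blast
qed

lemma bounded_circle_integrable:
  fixes u :: "complex \<Rightarrow> real"
  assumes N: "finite_measure N" "sets N = sets circle_borel"
    and u: "u \<in> borel_measurable circle_borel" "\<And>z. z \<in> unit_circle \<Longrightarrow> \<bar>u z\<bar> \<le> B"
  shows "integrable N u"
proof -
  interpret finite_measure N by fact
  show ?thesis
    by (rule integrable_const_bound[where B = B])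
      (use u N space_circle[OF N(2)] measurable_cong_sets[OF N(2) refl] in auto)
qed

text \<open>Simultaneous approximation in mean for both measures, by induction over nonnegative
  Borel functions. Monotone limits are handled by dominated convergence with majorant
  \<open>B\<close>.\<close>

lemma bounded_approx:
  fixes u :: "complex \<Rightarrow> real"
  assumes N1: "finite_measure N1" "sets N1 = sets circle_borel"
    and N2: "finite_measure N2" "sets N2 = sets circle_borel"
    and u: "u \<in> borel_measurable circle_borel" "\<And>z. 0 \<le> u z"
    and "\<And>z. z \<in> unit_circle \<Longrightarrow> u z \<le> B" and "0 < e"
  shows "\<exists>h. continuous_on unit_circle h \<and> (LINT z|N1. \<bar>u z - h z\<bar>) < e \<and> (LINT z|N2. \<bar>u z - h z\<bar>) < e"
  using assms(5-)
proof (induction arbitrary: B e rule: borel_measurable_induct_real)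
  case (set A)
  then show ?case using indicator_approx[OF N1 N2] by blast
next
  case (mult u c)
  show ?case
  proof (cases "c = 0")
    case True
    then show ?thesis using mult.prems by (intro exI[of _ "\<lambda>_. 0"]) simp
  next
    case False
    with mult have c: "0 < c" by simp
    obtain h where h: "continuous_on unit_circle h" "(LINT z|N1. \<bar>u z - h z\<bar>) < e / c" "(LINT z|N2. \<bar>u z - h z\<bar>) < e / c"
      using mult.IH[of "B / c" "e / c"] mult.prems c by (auto simp: pos_le_divide_eq mult.commute)
    have "\<bar>c * u z - c * h z\<bar> = c * \<bar>u z - h z\<bar>" for z
      using c by (simp add: abs_mult flip: right_diff_distrib)
    then show ?thesis using h c
      by (intro exI[of _ "\<lambda>z. c * h z"]) (auto simp: pos_less_divide_eq mult.commute intro!: continuous_intros)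
  qed
next
  case (add u v)
  have uB: "u z \<le> B" "v z \<le> B" if "z \<in> unit_circle" for z
    using add.prems(1)[OF that] add.hyps(2)[of z] add.hyps(4)[of z] by auto
  obtain h where h: "continuous_on unit_circle h" "(LINT z|N1. \<bar>u z - h z\<bar>) < e / 2" "(LINT z|N2. \<bar>u z - h z\<bar>) < e / 2"
    using add.IH(1)[of B "e / 2"] uB add.prems by auto
  obtain k where k: "continuous_on unit_circle k" "(LINT z|N1. \<bar>v z - k z\<bar>) < e / 2" "(LINT z|N2. \<bar>v z - k z\<bar>) < e / 2"
    using add.IH(2)[of B "e / 2"] uB add.prems by auto
  have tri: "(LINT z|N. \<bar>(v z + u z) - (k z + h z)\<bar>) \<le> (LINT z|N. \<bar>u z - h z\<bar>) + (LINT z|N. \<bar>v z - k z\<bar>)"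
    if N: "finite_measure N" "sets N = sets circle_borel" for N
  proof -
    have "integrable N u"
      by (rule bounded_circle_integrable[OF N add.hyps(1), of B]) (use add.hyps(2) uB in \<open>simp add: abs_of_nonneg\<close>)
    moreover have "integrable N v"
      by (rule bounded_circle_integrable[OF N add.hyps(3), of B]) (use add.hyps(4) uB in \<open>simp add: abs_of_nonneg\<close>)
    moreover have "integrable N h" by (rule circle_integrable[OF N h(1)])
    moreover have "integrable N k" by (rule circle_integrable[OF N k(1)])
    ultimately have i: "integrable N u" "integrable N v" "integrable N h" "integrable N k" .
    have "(LINT z|N. \<bar>(v z + u z) - (k z + h z)\<bar>) \<le> (LINT z|N. \<bar>u z - h z\<bar> + \<bar>v z - k z\<bar>)"
      using i by (intro integral_mono) auto
    also have "\<dots> = (LINT z|N. \<bar>u z - h z\<bar>) + (LINT z|N. \<bar>v z - k z\<bar>)" using i by simp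
    finally show ?thesis .
  qed
  show ?case
    using tri[OF N1] tri[OF N2] h k by (intro exI[of _ "\<lambda>z. k z + h z"]) (auto intro!: continuous_intros)
next
  case (seq U)
  have sp: "space circle_borel = unit_circle" by (rule space_circle) simp
  have U_le: "U i z \<le> u z" if "z \<in> unit_circle" for i z
    using seq that by (intro incseq_le[of "\<lambda>i. U i z"]) (auto simp: incseq_def le_fun_def sp)
  have UB: "U i z \<le> B" if "z \<in> unit_circle" for i z
    using U_le[OF that, of i] seq.prems(1)[OF that] by simp
  have um: "u \<in> borel_measurable circle_borel"
    by (rule borel_measurable_LIMSEQ_real[of _ U]) (use seq in auto)
  have u0: "0 \<le> u z" if "z \<in> unit_circle" for z
    using U_le[OF that, of 0] seq.hyps(2)[of 0 z] by linarith
  have conv: "(\<lambda>i. LINT z|N. \<bar>u z - U i z\<bar>) \<longlonglongrightarrow> 0"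
    if N: "finite_measure N" "sets N = sets circle_borel" for N
  proof -
    interpret finite_measure N by fact
    have spN: "space N = unit_circle" by (rule space_circle[OF N(2)])
    have [measurable]: "u \<in> borel_measurable N" "U i \<in> borel_measurable N" for i
      using um seq.hyps(1) unfolding measurable_cong_sets[OF N(2) refl] by auto
    have "(\<lambda>i. LINT z|N. \<bar>u z - U i z\<bar>) \<longlonglongrightarrow> (LINT z|N. 0)"
    proof (rule integral_dominated_convergence[where w = "\<lambda>_. B"])
      show "AE z in N. (\<lambda>i. \<bar>u z - U i z\<bar>) \<longlonglongrightarrow> 0"
      proof (rule AE_I2)
        fix z assume "z \<in> space N"
        then have "(\<lambda>i. U i z) \<longlonglongrightarrow> u z" using seq.hyps by (simp add: sp spN)
        then have "(\<lambda>i. \<bar>u z - U i z\<bar>) \<longlonglongrightarrow> \<bar>u z - u z\<bar>" by (intro tendsto_intros)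
        then show "(\<lambda>i. \<bar>u z - U i z\<bar>) \<longlonglongrightarrow> 0" by simp
      qed
      show "AE z in N. norm \<bar>u z - U i z\<bar> \<le> B" for i
      proof (rule AE_I2)
        fix z assume "z \<in> space N"
        then have z: "z \<in> unit_circle" by (simp add: spN)
        then show "norm \<bar>u z - U i z\<bar> \<le> B"
          using U_le[OF z, of i] seq.prems(1)[OF z] seq.hyps(2)[of i z] by simp
      qed
    qed (auto intro: integrable_const)
    then show ?thesis by simp
  qed
  have "\<forall>\<^sub>F i in sequentially. (LINT z|N1. \<bar>u z - U i z\<bar>) < e / 2 \<and> (LINT z|N2. \<bar>u z - U i z\<bar>) < e / 2"
    using order_tendstoD(2)[OF conv[OF N1], of "e/2"] order_tendstoD(2)[OF conv[OF N2], of "e/2"] seq.prems(2)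
    by (auto intro: eventually_conj)
  then obtain i where i: "(LINT z|N1. \<bar>u z - U i z\<bar>) < e / 2" "(LINT z|N2. \<bar>u z - U i z\<bar>) < e / 2"
    unfolding eventually_sequentially by blast
  obtain h where h: "continuous_on unit_circle h" "(LINT z|N1. \<bar>U i z - h z\<bar>) < e / 2" "(LINT z|N2. \<bar>U i z - h z\<bar>) < e / 2"
    using seq.IH[of i B "e / 2"] UB seq.prems by auto
  have tri: "(LINT z|N. \<bar>u z - h z\<bar>) \<le> (LINT z|N. \<bar>u z - U i z\<bar>) + (LINT z|N. \<bar>U i z - h z\<bar>)"
    if N: "finite_measure N" "sets N = sets circle_borel" for N
  proof -
    have "integrable N u"
      by (rule bounded_circle_integrable[OF N um, of B]) (use u0 seq.prems(1) in \<open>simp add: abs_of_nonneg\<close>)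
    moreover have "integrable N (U i)"
      by (rule bounded_circle_integrable[OF N seq.hyps(1), of _ B]) (use UB seq.hyps(2) in \<open>simp add: abs_of_nonneg\<close>)
    moreover have "integrable N h" by (rule circle_integrable[OF N h(1)])
    ultimately have j: "integrable N u" "integrable N (U i)" "integrable N h" .
    have "(LINT z|N. \<bar>u z - h z\<bar>) \<le> (LINT z|N. \<bar>u z - U i z\<bar> + \<bar>U i z - h z\<bar>)"
      using j by (intro integral_mono) auto
    also have "\<dots> = (LINT z|N. \<bar>u z - U i z\<bar>) + (LINT z|N. \<bar>U i z - h z\<bar>)" using j by simp
    finally show ?thesis .
  qed
  show ?case using tri[OF N1] tri[OF N2] h i by (intro exI[of _ h]) auto
qed

lemma power_lipschitz:
  fixes B :: real
  assumes "0 \<le> B"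
  shows "\<exists>L\<ge>0. \<forall>x y. 0 \<le> x \<and> x \<le> B \<and> 0 \<le> y \<and> y \<le> B \<longrightarrow> \<bar>x ^ k - y ^ k\<bar> \<le> L * \<bar>x - y\<bar>"
proof (induction k)
  case (Suc k)
  then obtain L where L: "L \<ge> 0" "\<And>x y. 0 \<le> x \<Longrightarrow> x \<le> B \<Longrightarrow> 0 \<le> y \<Longrightarrow> y \<le> B \<Longrightarrow> \<bar>x ^ k - y ^ k\<bar> \<le> L * \<bar>x - y\<bar>"
    by blast
  have "\<bar>x ^ Suc k - y ^ Suc k\<bar> \<le> (B * L + B ^ k) * \<bar>x - y\<bar>"
    if xy: "0 \<le> x" "x \<le> B" "0 \<le> y" "y \<le> B" for x y
  proof -
    have "x ^ Suc k - y ^ Suc k = x * (x ^ k - y ^ k) + y ^ k * (x - y)" by (simp add: algebra_simps)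
    then have "\<bar>x ^ Suc k - y ^ Suc k\<bar> \<le> x * \<bar>x ^ k - y ^ k\<bar> + y ^ k * \<bar>x - y\<bar>"
      using xy by (metis abs_mult abs_of_nonneg abs_triangle_ineq zero_le_power)
    also have "\<dots> \<le> B * (L * \<bar>x - y\<bar>) + B ^ k * \<bar>x - y\<bar>"
      using xy L by (intro add_mono mult_mono power_mono) auto
    finally show ?thesis by (simp add: algebra_simps)
  qed
  moreover have "0 \<le> B * L + B ^ k" using L assms by simp
  ultimately show ?case by blast
qed (intro exI[of _ 0], simp)

text \<open>The inequality involves two measures, hence the common approximation \<open>h0\<close>.
  Clipping it to \<open>[0, B]\<close> makes it admissible without increasing its distance to
  \<open>g\<close>; powers are Lipschitz there, so each side changes by a multiple of
  \<open>e\<close>.\<close>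

lemma continuous_to_borel_inequality:
  fixes c d K B :: real and g :: "complex \<Rightarrow> real"
  assumes N1: "finite_measure N1" "sets N1 = sets circle_borel"
    and N2: "finite_measure N2" "sets N2 = sets circle_borel"
    and cd: "0 \<le> c" "0 \<le> d"
    and ineq: "\<And>h. continuous_on unit_circle h \<Longrightarrow> (\<And>z. 0 \<le> h z) \<Longrightarrow>
        c * (LINT z|N1. h z ^ i) \<le> K + d * (LINT z|N2. h z ^ j)"
    and g: "g \<in> borel_measurable circle_borel" "\<And>z. 0 \<le> g z" "\<And>z. z \<in> unit_circle \<Longrightarrow> g z \<le> B"
  shows "c * (LINT z|N1. g z ^ i) \<le> K + d * (LINT z|N2. g z ^ j)"
proof -
  have B: "0 \<le> B" using g(2)[of 1] g(3)[of 1] by simp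
  obtain L1 where L1: "L1 \<ge> 0" "\<And>x y. 0 \<le> x \<Longrightarrow> x \<le> B \<Longrightarrow> 0 \<le> y \<Longrightarrow> y \<le> B \<Longrightarrow> \<bar>x ^ i - y ^ i\<bar> \<le> L1 * \<bar>x - y\<bar>"
    using power_lipschitz[OF B, of i] by blast
  obtain L2 where L2: "L2 \<ge> 0" "\<And>x y. 0 \<le> x \<Longrightarrow> x \<le> B \<Longrightarrow> 0 \<le> y \<Longrightarrow> y \<le> B \<Longrightarrow> \<bar>x ^ j - y ^ j\<bar> \<le> L2 * \<bar>x - y\<bar>"
    using power_lipschitz[OF B, of j] by blast
  define C where "C = c * L1 + d * L2"
  have C: "0 \<le> C" using cd L1 L2 by (simp add: C_def)
  have main: "c * (LINT z|N1. g z ^ i) \<le> K + d * (LINT z|N2. g z ^ j) + C * e" if e: "0 < e" for e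
  proof -
    obtain h0 where h0: "continuous_on unit_circle h0" "(LINT z|N1. \<bar>g z - h0 z\<bar>) < e" "(LINT z|N2. \<bar>g z - h0 z\<bar>) < e"
      using bounded_approx[OF N1 N2 g e] by blast
    define h where "h z = max 0 (min B (h0 z))" for z
    have hc: "continuous_on unit_circle h"
      unfolding h_def[abs_def] by (intro continuous_intros h0)
    have h01: "0 \<le> h z" "h z \<le> B" for z using B by (auto simp: h_def)
    have close: "\<bar>(LINT z|N. g z ^ k) - (LINT z|N. h z ^ k)\<bar> \<le> L * e"
      if N: "finite_measure N" "sets N = sets circle_borel" and he: "(LINT z|N. \<bar>g z - h0 z\<bar>) < e"
        and L: "L \<ge> 0" "\<And>x y. 0 \<le> x \<Longrightarrow> x \<le> B \<Longrightarrow> 0 \<le> y \<Longrightarrow> y \<le> B \<Longrightarrow> \<bar>x ^ k - y ^ k\<bar> \<le> L * \<bar>x - y\<bar>"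
      for N k L
    proof -
      have gk: "integrable N (\<lambda>z. g z ^ k)"
        by (rule bounded_circle_integrable[OF N, of _ "B ^ k"])
          (use g in \<open>simp_all add: abs_of_nonneg power_mono\<close>)
      have "integrable N g"
        by (rule bounded_circle_integrable[OF N g(1), of B]) (use g in \<open>simp add: abs_of_nonneg\<close>)
      moreover have "integrable N h0" by (rule circle_integrable[OF N h0(1)])
      ultimately have g1: "integrable N g" "integrable N h0" .
      have hk: "integrable N (\<lambda>z. h z ^ k)" by (intro circle_integrable[OF N] continuous_intros hc)
      have "(LINT z|N. g z ^ k) - (LINT z|N. h z ^ k) = (LINT z|N. g z ^ k - h z ^ k)" using gk hk by simp
      also have "\<bar>\<dots>\<bar> \<le> (LINT z|N. \<bar>g z ^ k - h z ^ k\<bar>)"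
        using integral_norm_bound[of N "\<lambda>z. g z ^ k - h z ^ k"] by simp
      also have "\<dots> \<le> (LINT z|N. L * \<bar>g z - h0 z\<bar>)"
      proof (rule integral_mono)
        fix z assume "z \<in> space N"
        then have z: "z \<in> unit_circle" by (simp add: space_circle[OF N(2)])
        have "\<bar>g z ^ k - h z ^ k\<bar> \<le> L * \<bar>g z - h z\<bar>" using g(2,3) z h01 by (intro L) auto
        also have "\<bar>g z - h z\<bar> \<le> \<bar>g z - h0 z\<bar>" using g(2)[of z] g(3)[OF z] by (auto simp: h_def)
        finally show "\<bar>g z ^ k - h z ^ k\<bar> \<le> L * \<bar>g z - h0 z\<bar>" using L by (simp add: mult_left_mono)
      qed (use gk hk g1 in auto)
      also have "\<dots> = L * (LINT z|N. \<bar>g z - h0 z\<bar>)" by simp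
      also have "\<dots> \<le> L * e" using he L by (intro mult_left_mono) auto
      finally show ?thesis .
    qed
    have "c * \<bar>(LINT z|N1. g z ^ i) - (LINT z|N1. h z ^ i)\<bar> \<le> c * (L1 * e)"
      using close[OF N1 h0(2) L1] cd by (intro mult_left_mono) auto
    moreover have "c * ((LINT z|N1. g z ^ i) - (LINT z|N1. h z ^ i)) \<le> c * \<bar>(LINT z|N1. g z ^ i) - (LINT z|N1. h z ^ i)\<bar>"
      using cd by (intro mult_left_mono) auto
    moreover have "d * \<bar>(LINT z|N2. g z ^ j) - (LINT z|N2. h z ^ j)\<bar> \<le> d * (L2 * e)"
      using close[OF N2 h0(3) L2] cd by (intro mult_left_mono) auto
    moreover have "d * ((LINT z|N2. h z ^ j) - (LINT z|N2. g z ^ j)) \<le> d * \<bar>(LINT z|N2. g z ^ j) - (LINT z|N2. h z ^ j)\<bar>"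
      using cd by (intro mult_left_mono) auto
    moreover have "c * (LINT z|N1. h z ^ i) \<le> K + d * (LINT z|N2. h z ^ j)"
      by (rule ineq[OF hc h01(1)])
    ultimately show ?thesis by (simp add: C_def algebra_simps)
  qed
  show ?thesis
  proof (rule field_le_epsilon)
    fix e :: real assume e: "0 < e"
    have "C * (e / (C + 1)) \<le> e" using C e by (simp add: field_simps)
    moreover have "0 < e / (C + 1)" using C e by simp
    ultimately show "c * (LINT z|N1. g z ^ i) \<le> K + d * (LINT z|N2. g z ^ j) + e"
      using main[of "e / (C + 1)"] by linarith
  qed
qed

text \<open>The tangent at \<open>y\<close> to the convex function \<open>x ^ (k + 1)\<close> lies
  below its graph.\<close>

lemma tangent_inequality:
  fixes x y :: real
  assumes "0 \<le> x" "0 \<le> y"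
  shows "(real k + 1) * y ^ k * x \<le> x ^ Suc k + k * y ^ Suc k"
proof (induction k)
  case (Suc k)
  have "x * ((real k + 1) * y ^ k * x) \<le> x * (x ^ Suc k + k * y ^ Suc k)"
    using Suc assms by (intro mult_left_mono) auto
  moreover have "0 \<le> (real k + 1) * y ^ k * (x - y)\<^sup>2" using assms by simp
  ultimately show ?case by (simp add: algebra_simps power2_eq_square)
qed simp

text \<open>Fatou's lemma carries the uniform bound on the integrals to the limit.\<close>

lemma integrable_limit_nonneg:
  fixes u :: "nat \<Rightarrow> 'a \<Rightarrow> real"
  assumes u: "\<And>m. integrable N (u m)" "\<And>m x. x \<in> space N \<Longrightarrow> 0 \<le> u m x"
    and f: "f \<in> borel_measurable N" and lim: "AE x in N. (\<lambda>m. u m x) \<longlonglongrightarrow> f x"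
    and K: "\<And>m. (LINT x|N. u m x) \<le> K"
  shows "integrable N f"
proof (rule integrableI_nonneg[OF f])
  show "AE x in N. 0 \<le> f x"
    using lim AE_space by eventually_elim (rule LIMSEQ_le_const, auto intro: u)
  have "(\<integral>\<^sup>+x. ennreal (f x) \<partial>N) = (\<integral>\<^sup>+x. liminf (\<lambda>m. ennreal (u m x)) \<partial>N)"
  proof (rule nn_integral_cong_AE)
    show "AE x in N. ennreal (f x) = liminf (\<lambda>m. ennreal (u m x))"
      using lim
    proof eventually_elim
      case (elim x)
      then have "(\<lambda>m. ennreal (u m x)) \<longlonglongrightarrow> ennreal (f x)" by (rule tendsto_ennrealI)
      then show ?case by (intro lim_imp_Liminf[symmetric]) auto
    qed
  qed
  also have "\<dots> \<le> liminf (\<lambda>m. \<integral>\<^sup>+x. ennreal (u m x) \<partial>N)"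
    using u by (intro nn_integral_liminf) auto
  also have "\<dots> \<le> ennreal K"
  proof (rule Liminf_le)
    have "(\<integral>\<^sup>+x. ennreal (u m x) \<partial>N) = ennreal (LINT x|N. u m x)" for m
      using u by (intro nn_integral_eq_integral) auto
    then show "\<forall>\<^sub>F m in sequentially. (\<integral>\<^sup>+x. ennreal (u m x) \<partial>N) \<le> ennreal K"
      using K by (auto intro!: always_eventually ennreal_leI)
  qed simp
  also have "\<dots> < \<infinity>" by simp
  finally show "(\<integral>\<^sup>+x. ennreal (f x) \<partial>N) < \<infinity>" .
qed

section \<open>Inequalities in the weak limit\<close>

context verblunsky_seq
begin

lemma weight_powr_continuous: "continuous_on unit_circle (\<lambda>z. (cmod (poly (\<Phi>s n) z))\<^sup>2 powr s)"
  using \<Phi>s_nonzero by (intro continuous_intros) auto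

lemma arc_integral_powr: "(LINT z|arc_measure. (cmod (poly (\<Phi>s n) z))\<^sup>2 powr s) = J s n / (2 * pi)"
  unfolding arc_integral[OF weight_powr_continuous] J_def W_def real_scaleR_def
  by (simp only: divide_inverse mult.commute)

text \<open>Each step multiplies \<open>1 / \<kappa>\<close> by \<open>1 + x / (1 - x)\<close> with
  \<open>x = |a n|^2\<close>, and these increments are summable.\<close>

lemma \<kappa>_bounded_below:
  assumes sq: "summable (\<lambda>j. (cmod (a j))\<^sup>2)"
  shows "\<exists>K>0. \<forall>n. 1 / \<kappa> n \<le> K"
proof (rule growth_bounded)
  let ?x = "\<lambda>n. (cmod (a n))\<^sup>2"
  have "\<forall>\<^sub>F n in sequentially. ?x n < 1/2"
    using summable_LIMSEQ_zero[OF sq] by (rule order_tendstoD(2)) simp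
  then have "\<forall>\<^sub>F n in sequentially. norm (?x n / (1 - ?x n)) \<le> 2 * ?x n"
  proof eventually_elim
    case (elim n)
    have "?x n / (1 - ?x n) \<le> ?x n / (1 / 2)" using elim by (intro divide_left_mono) auto
    then show ?case using elim one_minus_pos(1)[of n] by simp
  qed
  then show "summable (\<lambda>n. ?x n / (1 - ?x n))"
    by (rule summable_comparison_test_ev) (intro summable_mult sq)
  show "0 \<le> ?x n / (1 - ?x n)" "0 \<le> 1 / \<kappa> n" for n
    using one_minus_pos(1)[of n] \<kappa>_pos[of n] by simp_all
  show "1 / \<kappa> (Suc n) \<le> 1 / \<kappa> n * (1 + ?x n / (1 - ?x n))" for n
    using one_minus_pos(1)[of n] \<kappa>_pos[of n] by (simp add: \<kappa>_Suc field_simps)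
qed

text \<open>The tangent inequality, with \<open>x\<close> the Bernstein-Szego weight and
  \<open>y = h\<close>, is integrated over the circle. The power \<open>k + 1\<close> of the weight
  is controlled by \<open>J\<close> with the negative exponent, since
  \<open>\<kappa> \<le> 1\<close>; then the weak limit is taken.\<close>

lemma measure_le_arc_inequality:
  fixes N :: "nat \<Rightarrow> nat"
  assumes M: "finite_measure M" "sets M = sets circle_borel"
    and mom: "\<And>j. moment M 0 (\<Phi> j) = (if j = 0 then 1 else 0)"
    and N: "filterlim N at_top sequentially"
    and J: "\<forall>\<^sub>F l in sequentially. J (- real (Suc k)) (N l) \<le> K"
    and g: "g \<in> borel_measurable circle_borel" "\<And>z. 0 \<le> g z" "\<And>z. z \<in> unit_circle \<Longrightarrow> g z \<le> B"
  shows "(real k + 1) * (LINT z|M. g z ^ k) \<le> K / (2 * pi) + k * (LINT z|arc_measure. g z ^ Suc k)"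
proof (rule continuous_to_borel_inequality[OF M finite_arc sets_arc _ _ _ g])
  fix h :: "complex \<Rightarrow> real" assume h: "continuous_on unit_circle h" and h0: "\<And>z. 0 \<le> h z"
  have lim: "(\<lambda>l. (real k + 1) * (LINT z|arc_measure. bs_weight (N l) z * h z ^ k)) \<longlonglongrightarrow> (real k + 1) * (LINT z|M. h z ^ k)"
    by (intro tendsto_mult_left filterlim_compose[OF bs_integral_tendsto[OF M mom] N] continuous_intros h)
  have ev: "\<forall>\<^sub>F l in sequentially. (real k + 1) * (LINT z|arc_measure. bs_weight (N l) z * h z ^ k)
      \<le> K / (2 * pi) + k * (LINT z|arc_measure. h z ^ Suc k)"
    using J
  proof eventually_elim
    case (elim l)
    let ?w = "bs_weight (N l)" and ?W = "\<lambda>z. (cmod (poly (\<Phi>s (N l)) z))\<^sup>2 powr (- real (Suc k))"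
    have i: "integrable arc_measure (\<lambda>z. ?w z * h z ^ k)" "integrable arc_measure ?W"
      "integrable arc_measure (\<lambda>z. h z ^ Suc k)"
      by (intro circle_integrable finite_arc sets_arc continuous_intros bs_weight_continuous h weight_powr_continuous)+
    have "(real k + 1) * (LINT z|arc_measure. ?w z * h z ^ k) = (LINT z|arc_measure. (real k + 1) * (?w z * h z ^ k))"
      by simp
    also have "\<dots> \<le> (LINT z|arc_measure. ?W z + k * h z ^ Suc k)"
    proof (rule integral_mono)
      fix z assume "z \<in> space arc_measure"
      then have z: "z \<in> unit_circle" using space_circle[OF sets_arc] by simp
      then have W: "0 < (cmod (poly (\<Phi>s (N l)) z))\<^sup>2" using \<Phi>s_nonzero[of z "N l"] by simp
      have "(real k + 1) * (?w z * h z ^ k) \<le> ?w z ^ Suc k + k * h z ^ Suc k"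
        using tangent_inequality[of "?w z" "h z" k] bs_weight_nonneg h0 by (simp only: mult_ac)
      also have "?w z ^ Suc k = \<kappa> (N l) ^ Suc k * ?W z"
        unfolding powr_minus powr_realpow[OF W] by (simp only: bs_weight_def divide_inverse power_mult_distrib power_inverse)
      also have "\<dots> \<le> 1 * ?W z"
        using \<kappa>_pos[of "N l"] \<kappa>_le_1[of "N l"] by (intro mult_right_mono power_le_one) auto
      finally show "(real k + 1) * (?w z * h z ^ k) \<le> ?W z + k * h z ^ Suc k" by simp
    qed (use i in auto)
    also have "\<dots> = J (- real (Suc k)) (N l) / (2 * pi) + k * (LINT z|arc_measure. h z ^ Suc k)"
      unfolding arc_integral_powr[symmetric] using i by simp
    also have "J (- real (Suc k)) (N l) / (2 * pi) \<le> K / (2 * pi)"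
      using elim by (intro divide_right_mono) auto
    finally show ?case by simp
  qed
  show "(real k + 1) * (LINT z|M. h z ^ k) \<le> K / (2 * pi) + k * (LINT z|arc_measure. h z ^ Suc k)"
    by (rule tendsto_upperbound[OF lim ev]) simp
qed auto

text \<open>Here \<open>x\<close> is the reciprocal weight and the tangent inequality is multiplied
  by the weight, which moves the weight to the right-hand side. The reciprocal brings in a power of
  \<open>1 / \<kappa>\<close>, whence \<open>K'\<close>.\<close>

lemma arc_le_measure_inequality:
  fixes N :: "nat \<Rightarrow> nat"
  assumes M: "finite_measure M" "sets M = sets circle_borel"
    and mom: "\<And>j. moment M 0 (\<Phi> j) = (if j = 0 then 1 else 0)"
    and N: "filterlim N at_top sequentially"
    and J: "\<forall>\<^sub>F l in sequentially. J (real k) (N l) \<le> K"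
    and \<kappa>K: "\<And>n. 1 / \<kappa> n \<le> K'"
    and g: "g \<in> borel_measurable circle_borel" "\<And>z. 0 \<le> g z" "\<And>z. z \<in> unit_circle \<Longrightarrow> g z \<le> B"
  shows "(real k + 1) * (LINT z|arc_measure. g z ^ k) \<le> K' ^ k * (K / (2 * pi)) + k * (LINT z|M. g z ^ Suc k)"
proof (rule continuous_to_borel_inequality[OF finite_arc sets_arc M _ _ _ g])
  fix h :: "complex \<Rightarrow> real" assume h: "continuous_on unit_circle h" and h0: "\<And>z. 0 \<le> h z"
  have K': "0 \<le> K'" using \<kappa>K[of 0] by simp
  have lim: "(\<lambda>l. K' ^ k * (K / (2 * pi)) + k * (LINT z|arc_measure. bs_weight (N l) z * h z ^ Suc k))
      \<longlonglongrightarrow> K' ^ k * (K / (2 * pi)) + k * (LINT z|M. h z ^ Suc k)"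
    by (intro tendsto_add tendsto_const tendsto_mult_left filterlim_compose[OF bs_integral_tendsto[OF M mom] N] continuous_intros h)
  have ev: "\<forall>\<^sub>F l in sequentially. (real k + 1) * (LINT z|arc_measure. h z ^ k)
      \<le> K' ^ k * (K / (2 * pi)) + k * (LINT z|arc_measure. bs_weight (N l) z * h z ^ Suc k)"
    using J
  proof eventually_elim
    case (elim l)
    let ?w = "bs_weight (N l)" and ?W = "\<lambda>z. (cmod (poly (\<Phi>s (N l)) z))\<^sup>2 powr (real k)"
    have i: "integrable arc_measure (\<lambda>z. ?w z * h z ^ Suc k)" "integrable arc_measure ?W"
      "integrable arc_measure (\<lambda>z. h z ^ k)"
      by (intro circle_integrable finite_arc sets_arc continuous_intros bs_weight_continuous h weight_powr_continuous)+
    have "(real k + 1) * (LINT z|arc_measure. h z ^ k) = (LINT z|arc_measure. (real k + 1) * h z ^ k)"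
      by simp
    also have "\<dots> \<le> (LINT z|arc_measure. K' ^ k * ?W z + k * (?w z * h z ^ Suc k))"
    proof (rule integral_mono)
      fix z assume "z \<in> space arc_measure"
      then have z: "z \<in> unit_circle" using space_circle[OF sets_arc] by simp
      then have W: "0 < (cmod (poly (\<Phi>s (N l)) z))\<^sup>2" using \<Phi>s_nonzero[of z "N l"] by simp
      have w: "0 < ?w z" by (rule bs_weight_pos[OF z])
      have "(real k + 1) * h z ^ k = (real k + 1) * h z ^ k * inverse (?w z) * ?w z" using w by simp
      also have "\<dots> \<le> (inverse (?w z) ^ Suc k + k * h z ^ Suc k) * ?w z"
        using w by (intro mult_right_mono tangent_inequality h0) auto
      also have "\<dots> = inverse (?w z) ^ k + k * (?w z * h z ^ Suc k)"
        using w by (simp add: field_simps)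
      also have "inverse (?w z) ^ k = (1 / \<kappa> (N l)) ^ k * ?W z"
        unfolding powr_realpow[OF W] bs_weight_def by (simp add: power_divide field_simps)
      also have "\<dots> \<le> K' ^ k * ?W z"
        using \<kappa>_pos[of "N l"] \<kappa>K[of "N l"] by (intro mult_right_mono power_mono) auto
      finally show "(real k + 1) * h z ^ k \<le> K' ^ k * ?W z + k * (?w z * h z ^ Suc k)" by simp
    qed (use i in auto)
    also have "\<dots> = K' ^ k * (J (real k) (N l) / (2 * pi)) + k * (LINT z|arc_measure. ?w z * h z ^ Suc k)"
      unfolding arc_integral_powr[symmetric] using i by simp
    also have "K' ^ k * (J (real k) (N l) / (2 * pi)) \<le> K' ^ k * (K / (2 * pi))"
      using elim K' by (intro mult_left_mono divide_right_mono) auto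
    finally show ?case by simp
  qed
  show "(real k + 1) * (LINT z|arc_measure. h z ^ k) \<le> K' ^ k * (K / (2 * pi)) + k * (LINT z|M. h z ^ Suc k)"
    by (rule tendsto_lowerbound[OF lim ev]) simp
qed auto

end

section \<open>Consequences of the two-sided bounds\<close>

text \<open>The preimage under \<open>cis\<close> contains an interval from \<open>t\<close> to
  \<open>s\<close> within one period, and this has positive length.\<close>

lemma arc_measure_open_pos:
  assumes U: "open U" and z: "z \<in> unit_circle" "z \<in> U"
  shows "0 < emeasure arc_measure (U \<inter> unit_circle)"
proof -
  obtain t where t: "0 \<le> t" "t < 2 * pi" "z = cis t"
    using Arg2pi[of z] z(1) by (auto simp: is_Arg_def cis_conv_exp)
  have "open (cis -` U)" by (rule open_vimage[OF U]) (intro continuous_intros)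
  moreover have "t \<in> cis -` U" using z t by simp
  ultimately obtain d where d: "0 < d" "ball t d \<subseteq> cis -` U" using open_contains_ball by blast
  define s where "s = min (t + d) (2 * pi)"
  have s: "t < s" "s \<le> 2 * pi" using t d by (auto simp: s_def)
  have sub: "{t..<s} \<subseteq> {0..<2*pi} \<inter> cis -` (U \<inter> unit_circle)"
  proof
    fix x assume "x \<in> {t..<s}"
    then have "x \<in> ball t d" "0 \<le> x" "x < 2 * pi" using t by (auto simp: s_def dist_real_def)
    then show "x \<in> {0..<2*pi} \<inter> cis -` (U \<inter> unit_circle)" using d by auto
  qed
  have UC: "U \<inter> unit_circle \<in> sets circle_borel" using U by (auto simp: sets_restrict_space_iff)
  have vm: "cis -` (U \<inter> unit_circle) \<in> sets borel"
    using measurable_sets[OF cis_measurable UC] by simp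
  have "0 < ennreal (s - t)" using s by simp
  also have "ennreal (s - t) = emeasure lborel {t..<s}" using s by simp
  also have "\<dots> \<le> emeasure lborel ({0..<2*pi} \<inter> cis -` (U \<inter> unit_circle))"
    using vm by (intro emeasure_mono sub) auto
  finally have pos: "0 < emeasure lborel ({0..<2*pi} \<inter> cis -` (U \<inter> unit_circle))" .
  have "emeasure arc_measure (U \<inter> unit_circle) = emeasure (uniform_measure lborel {0..<2*pi}) (cis -` (U \<inter> unit_circle))"
    unfolding arc_measure_def by (subst emeasure_distr[OF cis_measurable UC]) simp
  also have "\<dots> = emeasure lborel ({0..<2*pi} \<inter> cis -` (U \<inter> unit_circle)) / emeasure lborel {0..<2*pi}"
    using vm by (intro emeasure_uniform_measure) auto
  also have "\<dots> > 0" using pos by (simp add: ennreal_zero_less_divide)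
  finally show ?thesis .
qed

text \<open>Retains only the inequalities for test functions. \<open>K\<close> depends on
  \<open>k\<close> but not on \<open>g\<close> or its bound \<open>B\<close>; large multiples and
  truncations rely on this uniformity.\<close>

locale two_sided_bounds =
  fixes M :: "complex measure"
  assumes M: "prob_space M" "sets M = sets circle_borel"
    and upper: "\<And>k. \<exists>K. \<forall>g B. g \<in> borel_measurable circle_borel \<longrightarrow> (\<forall>z. 0 \<le> g z) \<longrightarrow>
      (\<forall>z\<in>unit_circle. g z \<le> (B::real)) \<longrightarrow>
      (real k + 1) * (LINT z|M. g z ^ k) \<le> K + k * (LINT z|arc_measure. g z ^ Suc k)"
    and lower: "\<And>k. \<exists>K. \<forall>g B. g \<in> borel_measurable circle_borel \<longrightarrow> (\<forall>z. 0 \<le> g z) \<longrightarrow>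
      (\<forall>z\<in>unit_circle. g z \<le> (B::real)) \<longrightarrow>
      (real k + 1) * (LINT z|arc_measure. g z ^ k) \<le> K + k * (LINT z|M. g z ^ Suc k)"
begin

text \<open>Take \<open>k = 1\<close> and \<open>g\<close> the multiple \<open>T\<close> of the
  indicator of \<open>S\<close>: the quadratic term vanishes, so \<open>2 T\<close> times the
  measure of \<open>S\<close> stays bounded as \<open>T\<close> grows.\<close>

lemma absolutely_continuous_arc:
  assumes S: "S \<in> sets circle_borel" "emeasure arc_measure S = 0"
  shows "emeasure M S = 0"
proof -
  interpret prob_space M by (rule M)
  obtain K where K: "\<And>g B. g \<in> borel_measurable circle_borel \<Longrightarrow> (\<And>z. 0 \<le> g z) \<Longrightarrow>
      (\<And>z. z\<in>unit_circle \<Longrightarrow> g z \<le> (B::real)) \<Longrightarrow>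
      (real 1 + 1) * (LINT z|M. g z ^ 1) \<le> K + real 1 * (LINT z|arc_measure. g z ^ Suc 1)"
    using upper[of 1] by blast
  have "2 * T * measure M S \<le> K" if T: "0 \<le> T" for T
  proof -
    have eq: "(T * indicator S z) ^ 2 = T ^ 2 * indicator S z" for z :: complex
      by (auto split: split_indicator)
    have "(LINT z|arc_measure. (T * indicator S z) ^ 2) = T ^ 2 * measure arc_measure S"
      unfolding eq using S by simp
    also have "\<dots> = 0" using S by (simp add: measure_def)
    finally have "(LINT z|arc_measure. (T * indicator S z) ^ 2) = 0" .
    moreover have "(LINT z|M. T * indicator S z) = T * measure M S" using S M by simp
    moreover have "(real 1 + 1) * (LINT z|M. (T * indicator S z) ^ 1) \<le> K + real 1 * (LINT z|arc_measure. (T * indicator S z) ^ Suc 1)"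
      by (rule K[of _ T]) (use S T in \<open>auto split: split_indicator\<close>)
    then have "2 * (LINT z|M. T * indicator S z) \<le> K + (LINT z|arc_measure. (T * indicator S z) ^ 2)"
      by (simp only: of_nat_1 one_add_one power_one_right Suc_1 mult_1_left)
    ultimately show ?thesis by (auto simp: mult.assoc)
  qed
  \<comment> \<open>If the measure were positive, this \<open>T\<close> would give
    \<open>|K| + 1 \<le> K\<close>.\<close>
  from this[of "(\<bar>K\<bar> + 1) / (2 * measure M S)"] have "measure M S = 0"
    by (cases "measure M S = 0") auto
  then show ?thesis by (simp add: emeasure_eq_measure)
qed

text \<open>As in \<open>absolutely_continuous_arc\<close>, from \<open>lower\<close>. This
  direction yields the full support and the nonvanishing of the density.\<close>

lemma arc_absolutely_continuous:
  assumes S: "S \<in> sets circle_borel" "emeasure M S = 0"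
  shows "emeasure arc_measure S = 0"
proof -
  interpret arc: prob_space arc_measure by (rule prob_space_arc_measure)
  obtain K where K: "\<And>g B. g \<in> borel_measurable circle_borel \<Longrightarrow> (\<And>z. 0 \<le> g z) \<Longrightarrow>
      (\<And>z. z\<in>unit_circle \<Longrightarrow> g z \<le> (B::real)) \<Longrightarrow>
      (real 1 + 1) * (LINT z|arc_measure. g z ^ 1) \<le> K + real 1 * (LINT z|M. g z ^ Suc 1)"
    using lower[of 1] by blast
  have "2 * T * measure arc_measure S \<le> K" if T: "0 \<le> T" for T
  proof -
    have eq: "(T * indicator S z) ^ 2 = T ^ 2 * indicator S z" for z :: complex
      by (auto split: split_indicator)
    have "(LINT z|M. (T * indicator S z) ^ 2) = T ^ 2 * measure M S"
      unfolding eq using S M by simp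
    also have "\<dots> = 0" using S by (simp add: measure_def)
    finally have "(LINT z|M. (T * indicator S z) ^ 2) = 0" .
    moreover have "(LINT z|arc_measure. T * indicator S z) = T * measure arc_measure S" using S by simp
    moreover have "(real 1 + 1) * (LINT z|arc_measure. (T * indicator S z) ^ 1) \<le> K + real 1 * (LINT z|M. (T * indicator S z) ^ Suc 1)"
      by (rule K[of _ T]) (use S T in \<open>auto split: split_indicator\<close>)
    then have "2 * (LINT z|arc_measure. T * indicator S z) \<le> K + (LINT z|M. (T * indicator S z) ^ 2)"
      by (simp only: of_nat_1 one_add_one power_one_right Suc_1 mult_1_left)
    ultimately show ?thesis by (auto simp: mult.assoc)
  qed
  from this[of "(\<bar>K\<bar> + 1) / (2 * measure arc_measure S)"] have "measure arc_measure S = 0"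
    by (cases "measure arc_measure S = 0") auto
  then show ?thesis by (simp add: arc.emeasure_eq_measure)
qed

lemma measure_supp_eq: "measure_supp M = unit_circle"
proof -
  have sp: "space M = unit_circle" by (rule space_circle[OF M(2)])
  have "0 < emeasure M (U \<inter> unit_circle)" if "open U" "z \<in> U" "z \<in> unit_circle" for U z
  proof -
    have "U \<inter> unit_circle \<in> sets circle_borel" using that by (auto simp: sets_restrict_space_iff)
    then show ?thesis
      using arc_absolutely_continuous arc_measure_open_pos[OF that(1,3,2)]
      by (metis zero_less_iff_neq_zero)
  qed
  then show ?thesis unfolding measure_supp_def sp by auto
qed

context
  fixes w :: "complex \<Rightarrow> real"
  assumes w: "w \<in> borel_measurable circle_borel" "\<And>z. 0 \<le> w z"
    and dens: "M = density arc_measure (\<lambda>z. ennreal (w z))"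
begin

lemma w_integral:
  assumes "f \<in> borel_measurable circle_borel"
  shows "(LINT z|M. f z) = (LINT z|arc_measure. w z * f z)"
    and "integrable M f \<longleftrightarrow> integrable arc_measure (\<lambda>z. w z * (f z :: real))"
proof -
  have m: "w \<in> borel_measurable arc_measure" "f \<in> borel_measurable arc_measure"
    using w assms by (simp_all cong: measurable_cong_sets)
  show "(LINT z|M. f z) = (LINT z|arc_measure. w z * f z)"
    unfolding dens using m w by (subst integral_density) auto
  show "integrable M f \<longleftrightarrow> integrable arc_measure (\<lambda>z. w z * f z)"
    unfolding dens using m w by (subst integrable_density) auto
qed

text \<open>\<open>M\<close> gives no mass to the zero set of its density, so neither does arc
  length.\<close>

lemma w_nonzero: "AE z in arc_measure. w z \<noteq> 0"
proof -
  define Z where "Z = {z \<in> unit_circle. w z = 0}"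
  have sp: "space circle_borel = unit_circle" by (rule space_circle) simp
  have Z: "Z \<in> sets circle_borel"
    using measurable_sets[OF w(1), of "{0}"] by (simp add: sp Z_def vimage_def Int_def conj_commute)
  have "emeasure M Z = (\<integral>\<^sup>+z. ennreal (w z) * indicator Z z \<partial>arc_measure)"
    unfolding dens using w Z by (intro emeasure_density) (simp_all cong: measurable_cong_sets)
  also have "\<dots> = (\<integral>\<^sup>+z. 0 \<partial>arc_measure)"
    by (intro nn_integral_cong) (auto simp: Z_def split: split_indicator)
  finally have "emeasure M Z = 0" by simp
  then have "emeasure arc_measure Z = 0" by (rule arc_absolutely_continuous[OF Z])
  then show ?thesis
    using Z space_circle[OF sets_arc] by (intro AE_I[of _ _ Z]) (auto simp: Z_def)
qed

text \<open>For the truncation \<open>g = min w m\<close>, \<open>g ^ (k + 1) \<le> w g ^ k\<close>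
  bounds the arc integral of the left side by the integral of \<open>g ^ k\<close> for
  \<open>M\<close>. Inserted in \<open>upper\<close>, the coefficients \<open>k + 1\<close> and
  \<open>k\<close> leave a bound \<open>K\<close> independent of \<open>m\<close>, and Fatou's lemma
  finishes.\<close>

lemma w_power_integrable: "integrable arc_measure (\<lambda>z. w z ^ Suc k)"
proof -
  interpret prob_space M by (rule M)
  obtain K where K: "\<And>g B. g \<in> borel_measurable circle_borel \<Longrightarrow> (\<And>z. 0 \<le> g z) \<Longrightarrow>
      (\<And>z. z\<in>unit_circle \<Longrightarrow> g z \<le> (B::real)) \<Longrightarrow>
      (real k + 1) * (LINT z|M. g z ^ k) \<le> K + k * (LINT z|arc_measure. g z ^ Suc k)"
    using upper[of k] by blast
  define g where "g m z = min (w z) (real m)" for m z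
  have gm: "g m \<in> borel_measurable circle_borel" for m
    unfolding g_def[abs_def] using w by measurable
  have g0: "0 \<le> g m z" "g m z \<le> m" "g m z \<le> w z" for m z using w by (auto simp: g_def)
  have gi: "integrable N (\<lambda>z. g m z ^ j)" if "finite_measure N" "sets N = sets circle_borel" for m j N
    by (rule bounded_circle_integrable[OF that, of _ "real m ^ j"])
      (use gm g0 in \<open>auto intro!: power_mono\<close>)
  have le: "(LINT z|arc_measure. g m z ^ Suc k) \<le> K" for m
  proof -
    have i1: "integrable arc_measure (\<lambda>z. w z * g m z ^ k)"
      using w_integral(2)[of "\<lambda>z. g m z ^ k"] gi[OF finite_measure_axioms M(2)] gm by simp
    have "(LINT z|arc_measure. g m z ^ Suc k) \<le> (LINT z|arc_measure. w z * g m z ^ k)"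
      by (intro integral_mono gi finite_arc sets_arc i1) (simp add: g0 mult_right_mono)
    also have "\<dots> = (LINT z|M. g m z ^ k)" using gm by (subst w_integral(1)) auto
    finally have "(real k + 1) * (LINT z|arc_measure. g m z ^ Suc k) \<le> (real k + 1) * (LINT z|M. g m z ^ k)"
      by (intro mult_left_mono) auto
    also have "\<dots> \<le> K + k * (LINT z|arc_measure. g m z ^ Suc k)"
      by (rule K[OF gm g0(1) g0(2)])
    finally show ?thesis by (simp add: algebra_simps)
  qed
  show ?thesis
  proof (rule integrable_limit_nonneg[OF gi[OF finite_arc sets_arc] _ _ _ le])
    show "0 \<le> g m z ^ Suc k" for m z using g0 by simp
    show "(\<lambda>z. w z ^ Suc k) \<in> borel_measurable arc_measure"
      using w by (simp cong: measurable_cong_sets)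
    have "(\<lambda>m. g m z ^ Suc k) \<longlonglongrightarrow> w z ^ Suc k" for z
    proof (rule tendsto_eventually)
      obtain m0 :: nat where "w z \<le> m0" using real_arch_simple by blast
      then show "\<forall>\<^sub>F m in sequentially. g m z ^ Suc k = w z ^ Suc k"
        by (intro eventually_sequentiallyI[of m0]) (simp add: g_def min_def)
    qed
    then show "AE z in arc_measure. (\<lambda>m. g m z ^ Suc k) \<longlonglongrightarrow> w z ^ Suc k" by simp
  qed
qed

text \<open>Here \<open>g\<close> regularizes \<open>1 / w\<close>, and \<open>w g \<le> 1\<close>
  bounds the integral of \<open>g ^ (k + 1)\<close> for \<open>M\<close> by that of
  \<open>g ^ k\<close> for arc length; \<open>lower\<close> then gives a bound independent of
  \<open>m\<close>.\<close>

lemma w_inverse_power_integrable: "integrable arc_measure (\<lambda>z. inverse (w z) ^ k)"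
proof -
  interpret prob_space M by (rule M)
  obtain K where K: "\<And>g B. g \<in> borel_measurable circle_borel \<Longrightarrow> (\<And>z. 0 \<le> g z) \<Longrightarrow>
      (\<And>z. z\<in>unit_circle \<Longrightarrow> g z \<le> (B::real)) \<Longrightarrow>
      (real k + 1) * (LINT z|arc_measure. g z ^ k) \<le> K + k * (LINT z|M. g z ^ Suc k)"
    using lower[of k] by blast
  define g where "g m z = inverse (w z + inverse (real (Suc m)))" for m z
  have gm: "g m \<in> borel_measurable circle_borel" for m
    unfolding g_def[abs_def] using w by measurable
  have g0: "0 \<le> g m z" "g m z \<le> real (Suc m)" "w z * g m z \<le> 1" for m z
  proof -
    have p: "0 < inverse (real (Suc m))" by simp
    have q: "0 < w z + inverse (real (Suc m))" using w(2)[of z] p by linarith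
    show "0 \<le> g m z" using q unfolding g_def by (intro less_imp_le positive_imp_inverse_positive)
    have "g m z \<le> inverse (inverse (real (Suc m)))"
      unfolding g_def using p w(2)[of z] by (intro le_imp_inverse_le) linarith+
    then show "g m z \<le> real (Suc m)" by simp
    show "w z * g m z \<le> 1" unfolding g_def using q p
      by (simp only: divide_inverse[symmetric] pos_divide_le_eq[OF q] mult_1_left)
  qed
  have gi: "integrable N (\<lambda>z. g m z ^ j)" if "finite_measure N" "sets N = sets circle_borel" for m j N
    by (rule bounded_circle_integrable[OF that, of _ "real (Suc m) ^ j"])
      (use gm g0 in \<open>auto intro!: power_mono simp del: of_nat_Suc\<close>)
  have le: "(LINT z|arc_measure. g m z ^ k) \<le> K" for m
  proof -
    have i1: "integrable arc_measure (\<lambda>z. w z * g m z ^ Suc k)"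
      using w_integral(2)[of "\<lambda>z. g m z ^ Suc k"] gi[OF finite_measure_axioms M(2), of m "Suc k"] gm by simp
    have "(LINT z|M. g m z ^ Suc k) = (LINT z|arc_measure. w z * g m z ^ Suc k)"
      using gm by (intro w_integral(1)) auto
    also have "\<dots> \<le> (LINT z|arc_measure. g m z ^ k)"
    proof (intro integral_mono gi finite_arc sets_arc i1)
      show "w z * g m z ^ Suc k \<le> g m z ^ k" for z
        using mult_right_mono[OF g0(3)[of z m], of "g m z ^ k"] g0(1)[of m z] by (simp add: mult_ac)
    qed
    finally have "k * (LINT z|M. g m z ^ Suc k) \<le> k * (LINT z|arc_measure. g m z ^ k)"
      by (intro mult_left_mono) auto
    moreover have "(real k + 1) * (LINT z|arc_measure. g m z ^ k) \<le> K + k * (LINT z|M. g m z ^ Suc k)"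
      by (rule K[OF gm g0(1) g0(2)])
    ultimately show ?thesis by (simp add: algebra_simps)
  qed
  show ?thesis
  proof (rule integrable_limit_nonneg[OF gi[OF finite_arc sets_arc] _ _ _ le])
    show "0 \<le> g m z ^ k" for m z using g0 by simp
    show "(\<lambda>z. inverse (w z) ^ k) \<in> borel_measurable arc_measure"
      using w by (simp cong: measurable_cong_sets)
    \<comment> \<open>At a zero of \<open>w\<close> the regularizations diverge although
      \<open>inverse 0 = 0\<close>, so the convergence relies on \<open>w_nonzero\<close>.\<close>
    show "AE z in arc_measure. (\<lambda>m. g m z ^ k) \<longlonglongrightarrow> inverse (w z) ^ k"
      using w_nonzero
    proof eventually_elim
      case (elim z)
      have "(\<lambda>m. inverse (w z + inverse (real (Suc m))) ^ k) \<longlonglongrightarrow> inverse (w z + 0) ^ k"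
        using elim by (intro tendsto_intros LIMSEQ_inverse_real_of_nat) auto
      then show ?case by (simp add: g_def)
    qed
  qed
qed

end

end

section \<open>Real exponents, the lacunary ratio and the final assembly\<close>

lemma powr_integrable_of_power:
  fixes f :: "'a \<Rightarrow> real"
  assumes "finite_measure N" and f: "f \<in> borel_measurable N" and p: "0 < p" "p \<le> real k"
    and i: "integrable N (\<lambda>z. \<bar>f z\<bar> ^ k)"
  shows "integrable N (\<lambda>z. \<bar>f z\<bar> powr p)"
proof -
  interpret finite_measure N by fact
  have k: "0 < k" using p by (cases k) auto
  show ?thesis
  proof (rule Bochner_Integration.integrable_bound[of N "\<lambda>z. 1 + \<bar>f z\<bar> ^ k"])
    show "integrable N (\<lambda>z. 1 + \<bar>f z\<bar> ^ k)" using i by simp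
    show "AE z in N. norm (\<bar>f z\<bar> powr p) \<le> norm (1 + \<bar>f z\<bar> ^ k)"
    proof (rule AE_I2)
      fix z
      \<comment> \<open>Where \<open>|f z|\<close> is at most 1 the constant dominates, elsewhere
        the integer power does.\<close>
      have "\<bar>f z\<bar> powr p \<le> 1 + \<bar>f z\<bar> ^ k"
      proof (cases "\<bar>f z\<bar> \<le> 1")
        case True
        then have "\<bar>f z\<bar> powr p \<le> 1" using p by (intro powr_le1) auto
        then show ?thesis using zero_le_power[of "\<bar>f z\<bar>" k] by linarith
      next
        case False
        then have "\<bar>f z\<bar> powr p \<le> \<bar>f z\<bar> powr (real k)" using p by (intro powr_mono) auto
        also have "\<dots> = \<bar>f z\<bar> ^ k" using False by (intro powr_realpow) auto
        finally show ?thesis by linarith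
      qed
      then show "norm (\<bar>f z\<bar> powr p) \<le> norm (1 + \<bar>f z\<bar> ^ k)" by simp
    qed
  qed (use f in measurable)
qed

text \<open>Any \<open>q\<close> strictly between 1 and the limes inferior works from some index on;
  \<open>l1\<close> is at least 1 because positivity of \<open>n\<close> is known only from
  there.\<close>

lemma lacunary_ratio:
  fixes n :: "nat \<Rightarrow> nat"
  assumes pos: "\<forall>l\<ge>1. 0 < n l"
    and lim: "liminf (\<lambda>l. ereal (real (n (Suc l)) / real (n l))) > 1"
  obtains q l1 where "1 < q" "1 \<le> l1" "\<And>l. l1 \<le> l \<Longrightarrow> q * real (n l) \<le> real (n (Suc l))"
proof -
  obtain q where q: "1 < ereal q" "ereal q < liminf (\<lambda>l. ereal (real (n (Suc l)) / real (n l)))"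
    using ereal_dense2[OF lim] by auto
  from less_LiminfD[OF q(2)] obtain l0 where l0: "\<And>l. l0 \<le> l \<Longrightarrow> q < real (n (Suc l)) / real (n l)"
    unfolding eventually_sequentially by auto
  show ?thesis
  proof (rule that[of q "max l0 1"])
    fix l assume l: "max l0 1 \<le> l"
    then have "0 < real (n l)" using pos by simp
    then show "q * real (n l) \<le> real (n (Suc l))" using l0[of l] l by (simp add: pos_less_divide_eq)
  qed (use q in \<open>simp_all add: one_ereal_def\<close>)
qed

theorem theorem6p1:
  fixes M Ms :: "complex measure" and w :: "complex \<Rightarrow> real" and n :: "nat \<Rightarrow> nat"
  assumes "prob_space M" and "sets M = sets circle_borel" and "nontrivial_measure M"
    and "w \<in> borel_measurable arc_measure" and "AE z in arc_measure. 0 \<le> w z"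
    and "sets Ms = sets circle_borel" and "mutually_singular Ms arc_measure"
    and "\<forall>A\<in>sets M. emeasure M A = (\<integral>\<^sup>+ z\<in>A. ennreal (w z) \<partial>arc_measure) + emeasure Ms A"
    and "mono_on {1..} n" and "\<forall>l\<ge>1. 0 < n l"
    and "liminf (\<lambda>l. ereal (real (n (Suc l)) / real (n l))) > 1"
    and "\<forall>j. j \<notin> n ` {1..} \<longrightarrow> verblunsky M j = 0"
    and "summable (\<lambda>j. (cmod (verblunsky M j))\<^sup>2)"
  shows "Ms = null_measure circle_borel \<and>
    measure_supp M = unit_circle \<and>
    (\<forall>p\<ge>1. in_Lp arc_measure p w \<and> inverse_in_Lp arc_measure p w)"
proof -
  note M = assms(1,2)
  interpret prob_space M by (rule M)
  note fin = finite_measure_axioms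
  have spM: "space M = unit_circle" by (rule space_circle[OF M(2)])
  have spA: "space arc_measure = unit_circle" by (rule space_circle[OF sets_arc])
  interpret verblunsky_seq "verblunsky M" by (rule monic_OP_eq_\<Phi>(1)[OF assms(1-3)])
  \<comment> \<open>Orthogonality of \<open>\<Phi> j\<close> to the constants, the input for weak
    convergence.\<close>
  have mom: "moment M 0 (\<Phi> j) = (if j = 0 then 1 else 0)" for j
  proof (cases "j = 0")
    case True
    then show ?thesis using prob_space by (simp add: moment_def)
  next
    case False
    have "is_monic_OP M j (monic_OP M j)"
      unfolding monic_OP_def by (rule theI'[OF ex1_monic_OP[OF assms(1-3)]])
    then show ?thesis
      using False unfolding monic_OP_eq_\<Phi>(2)[OF assms(1-3)] is_monic_OP_iff_moment[OF fin M(2)] by simp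
  qed
  obtain q :: real and l1 where q: "1 < q" "1 \<le> l1" "\<And>l. l1 \<le> l \<Longrightarrow> q * real (n l) \<le> real (n (Suc l))"
    using lacunary_ratio[OF assms(10,11)] by blast
  \<comment> \<open>Dropping the first terms makes the ratio condition hold from index 0 on.\<close>
  define N where "N l = n (l + l1)" for l
  have N0: "0 < N l" for l using assms(10) q(2) by (simp add: N_def)
  have Nq: "q * N l \<le> N (Suc l)" for l using q(3)[of "l + l1"] by (simp add: N_def)
  have "strict_mono N" by (rule lacunary_strict_mono(2)[where N = N and q = q, OF N0 q(1) Nq])
  then have "l \<le> Suc (N l)" for l using seq_suble[of N l] by simp
  then have lim: "filterlim (\<lambda>l. Suc (N l)) at_top sequentially"
    by (intro filterlim_at_top_mono[OF filterlim_ident] always_eventually) auto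
  have gaps: "verblunsky M j = 0" if j: "N l < j" "j < N (Suc l)" for j l
  proof -
    \<comment> \<open>By monotonicity the earlier terms of \<open>n\<close> are at most
      \<open>N l\<close> and the later ones at least \<open>N (Suc l)\<close>.\<close>
    have "j \<noteq> n i" if "1 \<le> i" for i
    proof (cases "i \<le> l + l1")
      case True
      then have "n i \<le> N l" unfolding N_def using assms(9) q(2) \<open>1 \<le> i\<close> by (auto intro: mono_onD)
      then show ?thesis using j by simp
    next
      case False
      then have "N (Suc l) \<le> n i" unfolding N_def using assms(9) q(2) \<open>1 \<le> i\<close> by (auto intro: mono_onD)
      then show ?thesis using j by simp
    qed
    then show ?thesis using assms(12) by auto
  qed
  have J: "\<exists>K>0. \<forall>\<^sub>F l in sequentially. J s (Suc (N l)) \<le> K" for s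
    by (rule J_bounded[where N = N and q = q, OF N0 q(1) Nq gaps assms(13)])
  obtain K' where K': "\<And>n. 1 / \<kappa> n \<le> K'" using \<kappa>_bounded_below[OF assms(13)] by blast
  interpret two_sided_bounds M
  proof
    fix k
    obtain K where "\<forall>\<^sub>F l in sequentially. J (- real (Suc k)) (Suc (N l)) \<le> K" using J by blast
    from measure_le_arc_inequality[OF fin M(2) mom lim this]
    show "\<exists>K. \<forall>g B. g \<in> borel_measurable circle_borel \<longrightarrow> (\<forall>z. 0 \<le> g z) \<longrightarrow>
      (\<forall>z\<in>unit_circle. g z \<le> (B::real)) \<longrightarrow>
      (real k + 1) * (LINT z|M. g z ^ k) \<le> K + k * (LINT z|arc_measure. g z ^ Suc k)"
      by (intro exI[of _ "K / (2 * pi)"]) blast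
    obtain K where "\<forall>\<^sub>F l in sequentially. J (real k) (Suc (N l)) \<le> K" using J by blast
    from arc_le_measure_inequality[OF fin M(2) mom lim this K']
    show "\<exists>K. \<forall>g B. g \<in> borel_measurable circle_borel \<longrightarrow> (\<forall>z. 0 \<le> g z) \<longrightarrow>
      (\<forall>z\<in>unit_circle. g z \<le> (B::real)) \<longrightarrow>
      (real k + 1) * (LINT z|arc_measure. g z ^ k) \<le> K + k * (LINT z|M. g z ^ Suc k)"
      by (intro exI[of _ "K' ^ k * (K / (2 * pi))"]) blast
  qed (rule M)+
  have Ms0: "emeasure Ms X = 0" for X
  proof -
    have spMs: "space Ms = unit_circle" by (rule space_circle[OF assms(6)])
    \<comment> \<open>\<open>A\<close> has no mass for \<open>Ms\<close>. Its complement is null for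
      arc length, hence for \<open>M\<close> by absolute continuity, hence for \<open>Ms\<close>,
      which \<open>M\<close> dominates.\<close>
    obtain A where A: "A \<in> sets circle_borel" "emeasure Ms A = 0" "emeasure arc_measure (unit_circle - A) = 0"
      using assms(6,7) unfolding mutually_singular_def spA by auto
    have S: "unit_circle - A \<in> sets circle_borel"
      using sets.compl_sets[of A Ms] A(1) unfolding assms(6) spMs by simp
    have "emeasure Ms (unit_circle - A) \<le> emeasure M (unit_circle - A)"
      using assms(8) S M by simp
    also have "\<dots> = 0" by (rule absolutely_continuous_arc[OF S A(3)])
    finally have "emeasure Ms (unit_circle - A) = 0" by simp
    then have "emeasure Ms (A \<union> (unit_circle - A)) \<le> 0"
      using emeasure_subadditive[of A Ms "unit_circle - A"] A S assms(6) by simp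
    moreover have "emeasure Ms X \<le> emeasure Ms (space Ms)" by (rule emeasure_space)
    moreover have "A \<union> (unit_circle - A) = space Ms"
      using sets.sets_into_space[of A Ms] A(1) unfolding assms(6) spMs by blast
    ultimately show ?thesis by simp
  qed
  have "Ms = null_measure circle_borel"
    by (rule measure_eqI) (simp_all add: assms(6) Ms0)
  moreover have "in_Lp arc_measure p w \<and> inverse_in_Lp arc_measure p w" if p: "1 \<le> p" for p
  proof -
    \<comment> \<open>The positive part is nonnegative everywhere, as the lemmas on densities
      require, and gives the same density because \<open>ennreal\<close> sends negative numbers to
      0.\<close>
    define v where "v z = max 0 (w z)" for z
    have wv: "AE z in arc_measure. w z = v z" using assms(5) by eventually_elim (simp add: v_def)
    have wm: "w \<in> borel_measurable circle_borel"
      using assms(4) by (simp cong: measurable_cong_sets)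
    have v: "v \<in> borel_measurable circle_borel" "\<And>z. 0 \<le> v z"
      unfolding v_def[abs_def] using wm by auto
    have dens: "M = density arc_measure (\<lambda>z. ennreal (v z))"
    proof (rule measure_eqI)
      fix A assume A: "A \<in> sets M"
      have "ennreal (v z) = ennreal (w z)" for z by (simp add: v_def max_def ennreal_neg)
      then show "emeasure M A = emeasure (density arc_measure (\<lambda>z. ennreal (v z))) A"
        using A M assms(4,8) Ms0 by (simp add: emeasure_density)
    qed (simp add: M)
    define k where "k = nat \<lceil>p\<rceil>"
    have k: "p \<le> real k" "1 \<le> k" using p by (auto simp: k_def le_nat_iff)
    have "integrable arc_measure (\<lambda>z. v z ^ Suc (k - 1))"
      by (rule w_power_integrable[OF v dens])
    then have "integrable arc_measure (\<lambda>z. v z ^ k)" using k by simp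
    then have "integrable arc_measure (\<lambda>z. \<bar>w z\<bar> ^ k)"
    proof (rule integrable_cong_AE_imp)
      show "AE z in arc_measure. v z ^ k = \<bar>w z\<bar> ^ k"
        using wv by eventually_elim (simp add: v)
    qed (use assms(4) in measurable)
    then have "integrable arc_measure (\<lambda>z. \<bar>w z\<bar> powr p)"
      using p k by (intro powr_integrable_of_power[OF finite_arc assms(4)]) auto
    moreover have "integrable arc_measure (\<lambda>z. \<bar>inverse (w z)\<bar> ^ k)"
      using w_inverse_power_integrable[OF v dens, of k]
    proof (rule integrable_cong_AE_imp)
      show "AE z in arc_measure. inverse (v z) ^ k = \<bar>inverse (w z)\<bar> ^ k"
        using wv by eventually_elim (simp add: v)
    qed (use assms(4) in measurable)
    then have "integrable arc_measure (\<lambda>z. \<bar>inverse (w z)\<bar> powr p)"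
      using p k assms(4) by (intro powr_integrable_of_power[OF finite_arc, of _ p k]) auto
    moreover have "AE z in arc_measure. w z \<noteq> 0"
      using w_nonzero[OF v dens] wv by eventually_elim simp
    ultimately show ?thesis unfolding in_Lp_def inverse_in_Lp_def using assms(4) by auto
  qed
  ultimately show ?thesis using measure_supp_eq by blast
qed

end
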